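(* Let $\alpha$ be a non-dyadic partition that is either expanding, or expansive of exponent $\tau\ge 0$ and eventually decreasing. Let $\Theta_0:=\{x\in[0,1]:\theta_\alpha'(x)=0\}$, $\Theta_\infty:=\{x\in[0,1]:\theta_\alpha'(x)=\infty\}$ and $\Theta_\sim:=[0,1]\setminus(\Theta_0\cup\Theta_\infty)$. Then $$\dim_{\mathrm H}(\Theta_\infty)=\dim_{\mathrm H}(\Theta_\sim)=\dim_{\mathrm H}(\mathcal L(\log 2))<\dim_{\mathrm H}(\Theta_0)=1 .$$
   Context: $\mathbb N=\{1,2,3,\dots\}$, $\lambda$ is Lebesgue measure, $\dim_{\mathrm H}$ is Hausdorff dimension. Let $\alpha=\{A_n:n\in\mathbb N\}$ be a countably infinite partition of the unit interval (i.e. of $(0,1]$) into non-empty, left-open, right-closed intervals, ordered from right to left starting from $A_1$ and accumulating only at $0$. Put $a_n:=\lambda(A_n)$ and $t_n:=\sum_{k\ge n}a_k$, so $t_1=1$ and $A_n=(t_{n+1},t_n]$. The dyadic partition is $\{(2^{-n},2^{-(n-1)}]:n\in\mathbb N\}$; $\alpha$ is non-dyadic if it is not this partition. $\alpha$ is expansive of exponent $\tau\ge 0$ if $t_n=n^{-\tau}\psi(n)$ for all $n$, with $\psi$ a positive slowly varying function (measurable $f:\mathbb R^+\to\mathbb R^+$ is slowly varying if $\lim_{x\to\infty}f(xy)/f(x)=1$ for all $y>0$); $\alpha$ is expanding if $\lim_{n\to\infty}t_n/t_{n+1}=\rho$ for some $\rho>1$; $\alpha$ is eventually decreasing if $a_n>a_{n+1}$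 for all sufficiently large $n$. $\alpha$-Lüroth map: $L_\alpha(x)=(t_n-x)/a_n$ for $x\in A_n$, $L_\alpha(0)=0$. Each $x\in(0,1]$ has an $\alpha$-Lüroth expansion $x=[\ell_1,\ell_2,\dots]_\alpha:=\sum_{n\ge1}(-1)^{n-1}\bigl(\prod_{i<n}a_{\ell_i}\bigr)t_{\ell_n}$, where $L_\alpha^{k-1}(x)\in A_{\ell_k}$; the sequence is finite, terminating at index $k$, when $L_\alpha^{k-1}(x)=t_n$ for some $n\ge2$ (finite sum; also $1=[1]_\alpha$). Finite expansions are two-fold: $[\ell_1,\dots,\ell_k,1]_\alpha=[\ell_1,\dots,\ell_{k-1},\ell_k+1]_\alpha$. Points with a finite expansion are $\alpha$-rational; points with an infinite (then unique) expansion are $\alpha$-irrational. $\alpha$-Farey-Minkowski function: $\theta_\alpha:[0,1]\to[0,1]$, $\theta_\alpha(0)=0$ and $\theta_\alpha([\ell_1,\ell_2,\dots]_\alpha)=-2\sum_{k\ge1}(-1)^k2^{-\sum_{i=1}^k\ell_i}$ (finite sum for finite expansions); it is a strictly increasing homeomorphism of $[0,1]$. $\theta_\alpha'(x)=\infty$ means the difference quotients at $x$ tend to $\infty$ (one-sided at endpoints of $[0,1]$). The $\alpha$-Farey code of an $\alpha$-irrational $x=[\ell_1,\ell_2,\dots]_\alpha$ is the $0$-$1$ sequence $0^{\ell_1-1},1,0^{\ell_2-1},1,\dots$, where $0^m$ denotes $m$ zeros. $I_n^{(\alpha)}(x)$ is the $n$-th level $\alpha$-Farey cylinder set containing $x$,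 i.e. the closed interval which is the closure of the set of $\alpha$-irrationals whose code has the same first $n$ symbols as that of $x$. For $s\ge0$, $\mathcal L(s)$ is the set of $\alpha$-irrational $x\in[0,1]$ with $\lim_{n\to\infty}\frac{\log\lambda(I_n^{(\alpha)}(x))}{-n}=s$. *)

theory Defs
  imports "HOL-Analysis.Analysis"
begin

section \<open>Hausdorff dimension\<close>

text \<open>The convention is the usual one for \<open>s = 0\<close>: a non-empty set has weight 1, the empty
  set has weight 0. (Note that \<open>0 powr 0 = 0\<close> in HOL.)\<close>

definition diam_weight :: "real \<Rightarrow> 'a::metric_space set \<Rightarrow> ennreal" where
  "diam_weight s U =
     (if U = {} then 0 else if s = 0 then 1 else ennreal (diameter U powr s))"

text \<open>Boundedness of the covering sets is required explicitly because \<^const>\<open>diameter\<close> is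
  meaningless on unbounded sets.\<close>

definition hausdorff_premeasure :: "real \<Rightarrow> real \<Rightarrow> 'a::metric_space set \<Rightarrow> ennreal" where
  "hausdorff_premeasure s \<delta> E =
     (INF U \<in> {U :: nat \<Rightarrow> 'a set. E \<subseteq> (\<Union>i. U i) \<and> (\<forall>i. bounded (U i) \<and> diameter (U i) \<le> \<delta>)}.
        \<Sum>i. diam_weight s (U i))"

definition hausdorff_measure :: "real \<Rightarrow> 'a::metric_space set \<Rightarrow> ennreal" where
  "hausdorff_measure s E = (SUP \<delta> \<in> {0<..}. hausdorff_premeasure s \<delta> E)"

definition hausdorff_dim :: "'a::metric_space set \<Rightarrow> ennreal" where
  "hausdorff_dim E = Inf {ennreal s | s. 0 \<le> s \<and> hausdorff_measure s E = 0}"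


section \<open>Partitions of the unit interval\<close>

text \<open>A partition is given by its sequence of atoms \<open>A 1, A 2, \<dots>\<close>; the value \<open>A 0\<close> is never
  used. That the atoms accumulate only at 0 follows from the right-to-left order and the fact
  that they cover \<open>(0,1]\<close>.\<close>

definition luroth_partition :: "(nat \<Rightarrow> real set) \<Rightarrow> bool" where
  "luroth_partition A \<longleftrightarrow>
     (\<forall>n\<ge>1. \<exists>u v. u < v \<and> A n = {u<..v}) \<and>
     (\<Union>n\<in>{1..}. A n) = {0<..1} \<and>
     disjoint_family_on A {1..} \<and>
     (\<forall>m\<ge>1. \<forall>n>m. \<forall>x\<in>A m. \<forall>y\<in>A n. y < x)"

definition dyadic_partition :: "(nat \<Rightarrow> real set) \<Rightarrow> bool" where
  "dyadic_partition A \<longleftrightarrow> A ` {1..} = (\<lambda>n. {(1/2) ^ n <.. (1/2) ^ (n - 1)}) ` {1..}"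

definition atom_len :: "(nat \<Rightarrow> real set) \<Rightarrow> nat \<Rightarrow> real" where
  "atom_len A n = measure lborel (A n)"

definition tail_len :: "(nat \<Rightarrow> real set) \<Rightarrow> nat \<Rightarrow> real" where
  "tail_len A n = (\<Sum>k. atom_len A (n + k))"

definition slowly_varying :: "(real \<Rightarrow> real) \<Rightarrow> bool" where
  "slowly_varying f \<longleftrightarrow>
     (\<forall>x>0. f x > 0) \<and>
     f \<in> borel_measurable (lebesgue_on {0<..}) \<and>
     (\<forall>y>0. ((\<lambda>x. f (x * y) / f x) \<longlongrightarrow> 1) at_top)"

definition expansive :: "(nat \<Rightarrow> real set) \<Rightarrow> real \<Rightarrow> bool" where
  "expansive A \<tau> \<longleftrightarrow>
     (\<exists>\<psi>. slowly_varying \<psi> \<and> (\<forall>n\<ge>1. tail_len A n = real n powr (- \<tau>) * \<psi> (real n)))"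

definition expanding :: "(nat \<Rightarrow> real set) \<Rightarrow> bool" where
  "expanding A \<longleftrightarrow>
     (\<exists>\<rho>>1. (\<lambda>n. tail_len A n / tail_len A (n + 1)) \<longlonglongrightarrow> \<rho>)"

definition eventually_decreasing :: "(nat \<Rightarrow> real set) \<Rightarrow> bool" where
  "eventually_decreasing A \<longleftrightarrow>
     (\<forall>\<^sub>F n in sequentially. atom_len A n > atom_len A (n + 1))"


section \<open>Lueroth expansions\<close>

definition atom_index :: "(nat \<Rightarrow> real set) \<Rightarrow> real \<Rightarrow> nat" where
  "atom_index A x = (THE n. 1 \<le> n \<and> x \<in> A n)"

definition luroth_map :: "(nat \<Rightarrow> real set) \<Rightarrow> real \<Rightarrow> real" where
  "luroth_map A x =
     (if x = 0 then 0
      else (tail_len A (atom_index A x) - x) / atom_len A (atom_index A x))"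

text \<open>Digits are numbered from 1; \<open>luroth_digit A x k\<close> is meaningful as long as the expansion has
  not terminated before index \<open>k\<close>.\<close>

definition luroth_digit :: "(nat \<Rightarrow> real set) \<Rightarrow> real \<Rightarrow> nat \<Rightarrow> nat" where
  "luroth_digit A x k = atom_index A ((luroth_map A ^^ (k - 1)) x)"

text \<open>The second disjunct is the expansion \<open>1 = [1]\<close>. An orbit reaching some \<open>t\<^sub>n\<close> is mapped to 0
  and stays there, so the index of termination is unique if it exists.\<close>

definition luroth_terminates_at :: "(nat \<Rightarrow> real set) \<Rightarrow> real \<Rightarrow> nat \<Rightarrow> bool" where
  "luroth_terminates_at A x k \<longleftrightarrow>
     1 \<le> k \<and> ((\<exists>n\<ge>2. (luroth_map A ^^ (k - 1)) x = tail_len A n) \<or> (k = 1 \<and> x = 1))"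

definition luroth_irrational :: "(nat \<Rightarrow> real set) \<Rightarrow> real \<Rightarrow> bool" where
  "luroth_irrational A x \<longleftrightarrow> x \<in> {0<..1} \<and> (\<forall>k. \<not> luroth_terminates_at A x k)"


section \<open>The Farey--Minkowski function\<close>

definition farey_minkowski_term :: "(nat \<Rightarrow> real set) \<Rightarrow> real \<Rightarrow> nat \<Rightarrow> real" where
  "farey_minkowski_term A x k = (-1) ^ k * (1/2) ^ (\<Sum>i=1..k. luroth_digit A x i)"

text \<open>On points with a finite expansion the one produced by the orbit is used; the other
  expansion, \<open>[l\<^sub>1, \<dots>, l\<^sub>k, 1] = [l\<^sub>1, \<dots>, l\<^sub>k + 1]\<close>, gives the same value.\<close>

definition farey_minkowski :: "(nat \<Rightarrow> real set) \<Rightarrow> real \<Rightarrow> real" where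
  "farey_minkowski A x =
     (if x = 0 then 0
      else if luroth_irrational A x then - 2 * (\<Sum>k. farey_minkowski_term A x (Suc k))
      else - 2 * (\<Sum>k = 1..(THE m. luroth_terminates_at A x m). farey_minkowski_term A x k))"

text \<open>Taking limits within \<open>[0,1]\<close> gives two-sided derivatives at interior points and one-sided
  ones at the endpoints.\<close>

definition Theta_zero :: "(nat \<Rightarrow> real set) \<Rightarrow> real set" where
  "Theta_zero A = {x \<in> {0..1}. (farey_minkowski A has_real_derivative 0) (at x within {0..1})}"

definition Theta_infinity :: "(nat \<Rightarrow> real set) \<Rightarrow> real set" where
  "Theta_infinity A =
     {x \<in> {0..1}. filterlim (\<lambda>y. (farey_minkowski A y - farey_minkowski A x) / (y - x))
                    at_top (at x within {0..1})}"

definition Theta_sim :: "(nat \<Rightarrow> real set) \<Rightarrow> real set" where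
  "Theta_sim A = {0..1} - (Theta_zero A \<union> Theta_infinity A)"


section \<open>Farey codes and cylinder sets\<close>

text \<open>The first \<open>n\<close> symbols of the code of \<open>x\<close>. Every block has length at least 1, so the first
  \<open>n\<close> blocks suffice.\<close>

definition farey_code_prefix :: "(nat \<Rightarrow> real set) \<Rightarrow> real \<Rightarrow> nat \<Rightarrow> nat list" where
  "farey_code_prefix A x n =
     take n (concat (map (\<lambda>k. replicate (luroth_digit A x k - 1) 0 @ [1]) [1..<n + 1]))"

definition farey_cylinder :: "(nat \<Rightarrow> real set) \<Rightarrow> nat \<Rightarrow> real \<Rightarrow> real set" where
  "farey_cylinder A n x =
     closure {y. luroth_irrational A y \<and> farey_code_prefix A y n = farey_code_prefix A x n}"

definition lyapunov_level :: "(nat \<Rightarrow> real set) \<Rightarrow> real \<Rightarrow> real set" where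
  "lyapunov_level A s =
     {x. luroth_irrational A x \<and>
         (\<lambda>n. ln (measure lborel (farey_cylinder A n x)) / (- real n)) \<longlonglongrightarrow> s}"

end

theory Submission
  imports Defs "HOL-Real_Asymp.Real_Asymp"
begin

text \<open>A Farey word \<open>w\<close> of level \<open>n\<close> has a cylinder of length \<open>|w|\<close> whose image under \<open>\<theta>\<close> has length
  \<open>2^(-n)\<close>; let \<open>D\<close> be the infimum of \<open>u + q\<close> over the pairs \<open>u \<ge> 0\<close>, \<open>q > 0\<close> with
  \<open>\<Sum>\<^sub>l a\<^sub>l^u 2^(-l q) < 1\<close>. By strict AM-GM at \<open>u = q = 1/2\<close>, \<open>D < 1\<close> unless the partition is dyadic.

  Upper bound: two distinct points are separated by the cut point \<open>z(w)\<close> of the smallest cylinder containing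
  both, so a point where the derivative is not 0 lies within \<open>K min(|w|, 2^(-n))\<close> of \<open>z(w)\<close>
  for infinitely many \<open>w\<close>, and \<open>min(|w|, 2^(-n))^(u+q) \<le> |w|^u 2^(-n q)\<close> is summable over all words.
  Hence the complement of \<open>\<Theta>\<^sub>0\<close> has dimension at most \<open>D < 1\<close>, so it is a null set and \<open>\<Theta>\<^sub>0\<close> has dimension 1.

  Lower bound: for \<open>s < D\<close>, exponential tilting yields finitely many words \<open>w\<close> of one length with
  \<open>\<Sum> |w|^s \<ge> 1\<close> such that \<open>2^(-n) / |w|\<close> is always above 1, and others for which it is always below 1. Moran sets
  built from the first kind lie in \<open>\<Theta>\<^sub>\<infinity>\<close>; mixing both kinds so that the product of these ratios stays bounded
  gives points of \<open>\<Theta>\<^sub>\<sim>\<close> and of \<open>L(log 2)\<close>.\<close>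

section \<open>Hausdorff measure\<close>

text \<open>Two scales compete, which is why \<open>s\<close> splits as \<open>u + q\<close>:
  \<open>u\<close> weighs the length of a cylinder, \<open>q\<close> its level. On the line
  \<open>u + q = s\<close> the weight \<open>pressure_term (s - q) q n\<close> is
  \<open>a n powr s\<close> tilted by the \<open>q\<close>-th power of the slope
  \<open>(1/2)^n / a n\<close>. For \<open>s < D\<close> no real tilt brings the total weight down
  to 1, and a large deviation estimate around the minimising tilt turns this into words of either
  sign of the drift. The obstacle is the infinite alphabet: large digits separate length from level
  without control, and the slope over a cylinder then says little about difference quotients inside
  it. Every construction for the lower bound therefore uses finitely many digits, and compactness in
  \<open>q\<close> leads from the full series to partial sums. The level set of \<open>ln 2\<close>
  needs an upper bound of its own, since its points control the slope only up to a subexponential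
  factor.\<close>

lemma hausdorff_measure_zeroI:
  assumes "\<And>\<delta> e. \<delta> > 0 \<Longrightarrow> e > 0 \<Longrightarrow>
     \<exists>U :: nat \<Rightarrow> 'a::metric_space set. E \<subseteq> (\<Union>i. U i) \<and> (\<forall>i. bounded (U i) \<and> diameter (U i) \<le> \<delta>) \<and>
       (\<Sum>i. diam_weight s (U i)) \<le> ennreal e"
  shows "hausdorff_measure s E = 0"
proof -
  have "hausdorff_premeasure s \<delta> E \<le> 0" if d: "\<delta> > 0" for \<delta>
  proof (rule ennreal_le_epsilon)
    fix e :: real assume "e > 0"
    then obtain U where U: "E \<subseteq> (\<Union>i. U i)" "\<forall>i. bounded (U i) \<and> diameter (U i) \<le> \<delta>"
      "(\<Sum>i. diam_weight s (U i)) \<le> ennreal e"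
      using assms[OF d \<open>e > 0\<close>] by blast
    have "hausdorff_premeasure s \<delta> E \<le> (\<Sum>i. diam_weight s (U i))"
      unfolding hausdorff_premeasure_def by (rule INF_lower) (use U in auto)
    then show "hausdorff_premeasure s \<delta> E \<le> 0 + ennreal e" using U(3) by simp
  qed
  then show ?thesis
    unfolding hausdorff_measure_def
    by (metis (no_types, lifting) SUP_least bot.extremum_uniqueI bot_ennreal greaterThan_iff)
qed

lemma hausdorff_measure_zeroE:
  assumes "hausdorff_measure s E = 0" "\<delta> > 0" "(e::ennreal) > 0"
  obtains U :: "nat \<Rightarrow> 'a::metric_space set" where "E \<subseteq> (\<Union>i. U i)"
    "\<And>i. bounded (U i)" "\<And>i. diameter (U i) \<le> \<delta>" "(\<Sum>i. diam_weight s (U i)) < e"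
proof -
  have "hausdorff_premeasure s \<delta> E \<le> hausdorff_measure s E"
    unfolding hausdorff_measure_def by (rule SUP_upper) (use assms in auto)
  then have "hausdorff_premeasure s \<delta> E < e" using assms by simp
  then show ?thesis unfolding hausdorff_premeasure_def INF_less_iff using that by blast
qed

lemma hausdorff_dim_le:
  assumes "0 \<le> s" "hausdorff_measure s E = 0"
  shows "hausdorff_dim E \<le> ennreal s"
  unfolding hausdorff_dim_def by (rule Inf_lower) (use assms in auto)

lemma hausdorff_measure_0_nonempty:
  assumes "hausdorff_measure 0 (E :: 'a::metric_space set) = 0" shows "E = {}"
proof (rule ccontr)
  assume "E \<noteq> {}"
  then obtain x where x: "x \<in> E" by auto
  obtain U :: "nat \<Rightarrow> 'a set" where U: "E \<subseteq> (\<Union>i. U i)" "(\<Sum>i. diam_weight 0 (U i)) < 1"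
    by (rule hausdorff_measure_zeroE[OF assms, of 1 1]) auto
  obtain i where "x \<in> U i" using U(1) x by auto
  then have "diam_weight 0 (U i) = 1" by (auto simp: diam_weight_def)
  moreover have "diam_weight 0 (U i) \<le> (\<Sum>i. diam_weight 0 (U i))"
    using sum_le_suminf[of "\<lambda>i. diam_weight 0 (U i)" "{i}"] by auto
  ultimately show False using U(2) by auto
qed

lemma hausdorff_dim_ge:
  assumes "\<And>s. 0 < s \<Longrightarrow> s < D \<Longrightarrow> hausdorff_measure s E \<noteq> 0"
  shows "ennreal D \<le> hausdorff_dim (E :: 'a::metric_space set)"
  unfolding hausdorff_dim_def
proof (rule Inf_greatest, clarify)
  fix s :: real assume s: "0 \<le> s" "hausdorff_measure s E = 0"
  show "ennreal D \<le> ennreal s"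
  \<comment> \<open>The hypothesis speaks of \<open>s > 0\<close> only. At \<open>s = 0\<close> a
    null set is empty, and the empty set is also null at \<open>D/2\<close>.\<close>
  proof (cases "s = 0 \<and> D > 0")
    case True
    then have "E = {}" using s hausdorff_measure_0_nonempty by auto
    moreover have "hausdorff_measure (D/2) ({} :: 'a set) = 0"
      by (rule hausdorff_measure_zeroI, rule exI[of _ "\<lambda>_. {}"])
         (auto simp: diam_weight_def diameter_def)
    ultimately show ?thesis using assms[of "D/2"] True by auto
  next
    case False
    then show ?thesis using assms[of s] s by (cases "s < D") (auto intro!: ennreal_leI)
  qed
qed

text \<open>The convergence half of Borel-Cantelli: every tail of \<open>B\<close> still covers
  \<open>E\<close>, and its weight is a tail of a convergent series. The diameters become small
  because their \<open>s\<close>-th powers do.\<close>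

lemma hausdorff_measure_limsup_zero:
  fixes B :: "nat \<Rightarrow> 'a::metric_space set" and r :: "nat \<Rightarrow> real"
  assumes s: "s > 0" and B: "\<And>n. bounded (B n)" "\<And>n. diameter (B n) \<le> r n"
    and r: "summable (\<lambda>n. r n powr s)"
    and E: "\<And>x. x \<in> E \<Longrightarrow> infinite {n. x \<in> B n}"
  shows "hausdorff_measure s E = 0"
proof (rule hausdorff_measure_zeroI)
  fix \<delta> e :: real assume pos: "\<delta> > 0" "e > 0"
  have r0: "r n \<ge> 0" for n using diameter_ge_0[OF B(1)] B(2) order_trans by blast
  have "(\<lambda>n. r n powr s) \<longlonglongrightarrow> 0" using r by (rule summable_LIMSEQ_zero)
  then have "\<forall>\<^sub>F n in sequentially. r n powr s < \<delta> powr s"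
    using pos by (auto intro: order_tendstoD)
  then obtain K1 where K1: "\<And>n. n \<ge> K1 \<Longrightarrow> r n powr s < \<delta> powr s"
    by (auto simp: eventually_sequentially)
  have "(\<lambda>k. \<Sum>n. r (n + k) powr s) \<longlonglongrightarrow> 0" using suminf_exist_split2[OF r] .
  then have "\<forall>\<^sub>F k in sequentially. (\<Sum>n. r (n + k) powr s) < e"
    using pos by (auto intro: order_tendstoD)
  then obtain K2 where K2: "\<And>k. k \<ge> K2 \<Longrightarrow> (\<Sum>n. r (n + k) powr s) < e"
    by (auto simp: eventually_sequentially)
  define K where "K = max K1 K2"
  have rK: "r n \<le> \<delta>" if "n \<ge> K" for n
  proof (rule ccontr)
    assume "\<not> r n \<le> \<delta>"
    then have "\<delta> powr s \<le> r n powr s" using s pos by (intro powr_mono2) auto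
    then show False using K1[of n] that by (auto simp: K_def)
  qed
  have w: "diam_weight s (B n) \<le> ennreal (r n powr s)" for n
    using s B(2)[of n] diameter_ge_0[OF B(1)[of n]]
    by (auto simp: diam_weight_def intro!: ennreal_leI powr_mono2)
  show "\<exists>U. E \<subseteq> (\<Union>i. U i) \<and> (\<forall>i. bounded (U i) \<and> diameter (U i) \<le> \<delta>) \<and>
       (\<Sum>i. diam_weight s (U i)) \<le> ennreal e"
  proof (intro exI conjI allI)
    show "E \<subseteq> (\<Union>n. B (n + K))"
    proof
      fix x assume "x \<in> E"
      then obtain n where "n \<ge> K" "x \<in> B n" using E[of x]
        by (metis (mono_tags, lifting) infinite_nat_iff_unbounded_le mem_Collect_eq)
      then show "x \<in> (\<Union>n. B (n + K))" by (intro UN_I[of "n - K"]) auto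
    qed
    show "bounded (B (n + K))" for n by (rule B)
    show "diameter (B (n + K)) \<le> \<delta>" for n using B(2)[of "n+K"] rK[of "n+K"] by auto
    have "(\<Sum>n. diam_weight s (B (n + K))) \<le> (\<Sum>n. ennreal (r (n + K) powr s))"
      by (intro suminf_le w) auto
    also have "\<dots> = ennreal (\<Sum>n. r (n + K) powr s)"
      by (intro suminf_ennreal2) (use summable_ignore_initial_segment[OF r] in auto)
    also have "\<dots> \<le> ennreal e" using K2[of K] by (intro ennreal_leI) (auto simp: K_def)
    finally show "(\<Sum>n. diam_weight s (B (n + K))) \<le> ennreal e" .
  qed
qed

text \<open>Below, words or pairs of a word and a cut index serve as indices; an enumeration reduces
  them to the sequence version.\<close>

lemma hausdorff_measure_limsup_zero_countable:
  fixes B :: "'i \<Rightarrow> 'a::metric_space set" and r :: "'i \<Rightarrow> real"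
  assumes s: "s > 0" and I: "countable I" "infinite I"
    and B: "\<And>i. i \<in> I \<Longrightarrow> bounded (B i)" "\<And>i. i \<in> I \<Longrightarrow> diameter (B i) \<le> r i"
    and r: "(\<lambda>i. r i powr s) summable_on I"
    and E: "\<And>x. x \<in> E \<Longrightarrow> infinite {i \<in> I. x \<in> B i}"
  shows "hausdorff_measure s E = 0"
proof -
  let ?f = "from_nat_into I"
  have bij: "bij_betw ?f UNIV I" using I by (rule bij_betw_from_nat_into)
  have fI: "?f n \<in> I" for n using bij by (auto simp: bij_betw_def)
  show ?thesis
  proof (rule hausdorff_measure_limsup_zero[of s "\<lambda>n. B (?f n)" "\<lambda>n. r (?f n)"])
    have "(\<lambda>n. r (?f n) powr s) summable_on UNIV"
      using summable_on_reindex_bij_betw[OF bij, of "\<lambda>i. r i powr s"] r by simp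
    then show "summable (\<lambda>n. r (?f n) powr s)"
      by (subst (asm) summable_on_UNIV_nonneg_real_iff) auto
    fix x assume "x \<in> E"
    then have "infinite {i \<in> I. x \<in> B i}" by (rule E)
    moreover have "{i \<in> I. x \<in> B i} \<subseteq> ?f ` {n. x \<in> B (?f n)}"
      using bij by (auto simp: bij_betw_def)
    ultimately show "infinite {n. x \<in> B (?f n)}"
      by (meson finite_imageI finite_subset)
  qed (use s B fI in auto)
qed

text \<open>For diameters at most 1 and \<open>s \<le> 1\<close> the weight dominates the diameter,
  so cheap covers have small Lebesgue measure.\<close>

lemma hausdorff_measure_zero_negligible:
  fixes E :: "real set"
  assumes "hausdorff_measure s E = 0" "s \<le> 1"
  shows "negligible E"
  unfolding negligible_outer
proof (intro allI impI)
  fix e :: real assume e: "e > 0"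
  obtain U :: "nat \<Rightarrow> real set" where U: "E \<subseteq> (\<Union>i. U i)"
    "\<And>i. bounded (U i)" "\<And>i. diameter (U i) \<le> 1" "(\<Sum>i. diam_weight s (U i)) < ennreal (e/4)"
    using hausdorff_measure_zeroE[OF assms(1), of 1 "ennreal (e/4)"] e by auto
  \<comment> \<open>Covering sets need not be measurable. A ball about one of their points is, at
    the price of twice the diameter.\<close>
  define V where "V = (\<lambda>i. if U i = {} then {} else cball (SOME x. x \<in> U i) (diameter (U i)))"
  have sub: "U i \<subseteq> V i" for i
  proof
    fix x assume x: "x \<in> U i"
    then have "(SOME x. x \<in> U i) \<in> U i" by (rule someI)
    then show "x \<in> V i" using x diameter_bounded_bound[OF U(2)[of i]] by (auto simp: V_def)
  qed
  have Vm: "emeasure lebesgue (V i) \<le> 2 * diam_weight s (U i)" for i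
  proof (cases "U i = {}")
    case False
    have d: "diameter (U i) \<ge> 0" by (rule diameter_ge_0[OF U(2)])
    have "emeasure lebesgue (V i) = ennreal (2 * diameter (U i))"
      using False d by (simp add: V_def cball_eq_atLeastAtMost)
    moreover have "ennreal (diameter (U i)) \<le> diam_weight s (U i)"
    proof (cases "s = 0")
      case True then show ?thesis using False U(3)[of i] by (auto simp: diam_weight_def)
    next
      case s: False
      have "diameter (U i) powr 1 \<le> diameter (U i) powr s" if "diameter (U i) > 0"
        using that U(3)[of i] assms(2) by (intro powr_mono') auto
      then show ?thesis using False s d
        by (cases "diameter (U i) = 0") (auto simp: diam_weight_def intro!: ennreal_leI)
    qed
    ultimately show ?thesis
      by (simp add: ennreal_mult' mult_left_mono)
  qed (simp add: V_def)
  have Vs: "V i \<in> sets lebesgue" for i by (simp add: V_def)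
  have "emeasure lebesgue (\<Union>i. V i) \<le> (\<Sum>i. emeasure lebesgue (V i))"
    by (rule emeasure_subadditive_countably) (use Vs in auto)
  also have "\<dots> \<le> (\<Sum>i. 2 * diam_weight s (U i))" by (intro suminf_le Vm) auto
  also have "\<dots> = 2 * (\<Sum>i. diam_weight s (U i))" by simp
  also have "\<dots> \<le> 2 * ennreal (e/4)" using U(4) by (intro mult_left_mono) auto
  also have "\<dots> = ennreal (e/2)" using e by (subst ennreal_numeral[symmetric], subst ennreal_mult[symmetric]) auto
  finally have m: "emeasure lebesgue (\<Union>i. V i) \<le> ennreal (e/2)" .
  have Us: "(\<Union>i. V i) \<in> sets lebesgue" using Vs by auto
  have lm: "(\<Union>i. V i) \<in> lmeasurable"
    using m Us by (intro fmeasurableI) (auto simp: order_le_less_trans)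
  have "measure lebesgue (\<Union>i. V i) \<le> e/2"
    unfolding measure_def using m e by (intro enn2real_leI) auto
  then show "\<exists>T. E \<subseteq> T \<and> T \<in> lmeasurable \<and> measure lebesgue T < e"
    using U(1) sub lm e by (intro exI[of _ "\<Union>i. V i"]) (auto, blast)
qed

text \<open>Exponents above 1 suffice to bound the dimension of \<open>Theta_zero\<close> by 1; for
  them, \<open>N\<close> intervals of length \<open>1/N\<close> cost \<open>N powr (1 - s)\<close>,
  which tends to 0.\<close>

lemma hausdorff_measure_unit_interval:
  assumes "s > 1" shows "hausdorff_measure s {0..1::real} = 0"
proof (rule hausdorff_measure_zeroI)
  fix \<delta> e :: real assume pos: "\<delta> > 0" "e > 0"
  have "(\<lambda>n. real (Suc n) powr (1 - s)) \<longlonglongrightarrow> 0"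
    using assms by real_asymp
  then have "\<forall>\<^sub>F n in sequentially. real (Suc n) powr (1 - s) < e"
    using pos by (auto intro: order_tendstoD)
  moreover have "(\<lambda>n. 1 / real (Suc n)) \<longlonglongrightarrow> 0" by real_asymp
  then have "\<forall>\<^sub>F n in sequentially. 1 / real (Suc n) < \<delta>"
    using pos by (auto intro: order_tendstoD)
  ultimately have "\<forall>\<^sub>F n in sequentially. real (Suc n) powr (1 - s) < e \<and> 1 / real (Suc n) < \<delta>"
    by eventually_elim auto
  then obtain n where n: "real (Suc n) powr (1 - s) < e" "1 / real (Suc n) < \<delta>"
    by (auto simp: eventually_sequentially)
  define N where "N = Suc n"
  define U where "U = (\<lambda>i. if i < N then {real i / N .. real (Suc i) / N} else {})"
  have N: "N > 0" by (simp add: N_def)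
  have d: "diameter (U i) = (if i < N then 1 / N else 0)" for i
    using N by (auto simp: U_def field_simps diameter_empty)
  have "(\<Sum>i. diam_weight s (U i)) = (\<Sum>i<N. diam_weight s (U i))"
    by (rule suminf_finite) (auto simp: U_def diam_weight_def)
  also have "\<dots> = (\<Sum>i<N. ennreal ((1/N) powr s))"
    using assms by (intro sum.cong) (auto simp: diam_weight_def d, auto simp: U_def divide_right_mono)
  also have "\<dots> = ennreal (N * (1/N) powr s)"
    by (simp add: ennreal_mult ennreal_of_nat_eq_real_of_nat)
  also have "N * (1/N) powr s = real N powr (1 - s)"
    using N by (simp add: powr_diff powr_divide)
  also have "ennreal \<dots> \<le> ennreal e" using n by (intro ennreal_leI) (auto simp: N_def)
  finally have "(\<Sum>i. diam_weight s (U i)) \<le> ennreal e" .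
  moreover have "{0..1} \<subseteq> (\<Union>i. U i)"
  proof
    fix x :: real assume x: "x \<in> {0..1}"
    show "x \<in> (\<Union>i. U i)"
    proof (cases "x = 1")
      case True
      then show ?thesis using N by (intro UN_I[of n]) (auto simp: U_def N_def)
    next
      case False
      define i where "i = nat \<lfloor>x * N\<rfloor>"
      have "real i \<le> x * N" "x * N < real i + 1" using x by (auto simp: i_def)
      moreover have "x * N < N" using False x N by auto
      ultimately have "real i < real N" by linarith
      then have "i < N" by simp
      moreover have "real i / N \<le> x" "x \<le> real (Suc i) / N"
        using N \<open>real i \<le> x * N\<close> \<open>x * N < real i + 1\<close> by (auto simp: field_simps)
      ultimately show ?thesis by (intro UN_I[of i]) (auto simp: U_def)
    qed
  qed
  ultimately show "\<exists>U :: nat \<Rightarrow> real set. {0..1} \<subseteq> (\<Union>i. U i) \<and> (\<forall>i. bounded (U i) \<and> diameter (U i) \<le> \<delta>) \<and>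
       (\<Sum>i. diam_weight s (U i)) \<le> ennreal e"
    using n(2) pos by (intro exI[of _ U]) (auto simp: d, auto simp: U_def N_def)
qed

section \<open>Countable stability of null sets\<close>

lemma hausdorff_measure_countable_Union:
  fixes F :: "nat \<Rightarrow> 'a::metric_space set"
  assumes F: "\<And>k. hausdorff_measure s (F k) = 0" and E: "E \<subseteq> (\<Union>k. F k)"
  shows "hausdorff_measure s E = 0"
proof (rule hausdorff_measure_zeroI)
  fix \<delta> e :: real assume pos: "\<delta> > 0" "e > 0"
  have "\<exists>U :: nat \<Rightarrow> 'a set. F k \<subseteq> (\<Union>i. U i) \<and> (\<forall>i. bounded (U i) \<and> diameter (U i) \<le> \<delta>) \<and>
     (\<Sum>i. diam_weight s (U i)) < ennreal (e * (1/2) ^ Suc k)" for k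
    by (rule hausdorff_measure_zeroE[OF F[of k] pos(1), of "ennreal (e * (1/2) ^ Suc k)"])
       (use pos in auto)
  then obtain U :: "nat \<Rightarrow> nat \<Rightarrow> 'a set" where U: "\<And>k. F k \<subseteq> (\<Union>i. U k i)"
    "\<And>k i. bounded (U k i)" "\<And>k i. diameter (U k i) \<le> \<delta>"
    "\<And>k. (\<Sum>i. diam_weight s (U k i)) < ennreal (e * (1/2) ^ Suc k)" by metis
  define V where "V = (\<lambda>i. case prod_decode i of (k, j) \<Rightarrow> U k j)"
  have "(\<Sum>i. diam_weight s (V i)) = (\<Sum>k. \<Sum>i. diam_weight s (U k i))"
    using suminf_ennreal_2dimen[of "\<lambda>k. \<Sum>i. diam_weight s (U k i)" "\<lambda>(k, j). diam_weight s (U k j)"]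
    by (simp add: V_def case_prod_unfold)
  also have "\<dots> \<le> (\<Sum>k. ennreal (e * (1/2) ^ Suc k))" using U(4) by (intro suminf_le less_imp_le) auto
  also have "\<dots> = ennreal e"
    using pos power_half_series[THEN sums_mult, of e] by (intro suminf_ennreal_eq) auto
  finally have 1: "(\<Sum>i. diam_weight s (V i)) \<le> ennreal e" .
  have "E \<subseteq> (\<Union>i. V i)"
  proof
    fix x assume "x \<in> E"
    then obtain k j where "x \<in> U k j" using E U(1) by blast
    then have "x \<in> V (prod_encode (k, j))" by (simp add: V_def)
    then show "x \<in> (\<Union>i. V i)" by blast
  qed
  then show "\<exists>U. E \<subseteq> (\<Union>i. U i) \<and> (\<forall>i. bounded (U i) \<and> diameter (U i) \<le> \<delta>) \<and>
     (\<Sum>i. diam_weight s (U i)) \<le> ennreal e"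
    using 1 U(2,3) by (intro exI[of _ V]) (auto simp: V_def split: prod.split)
qed

lemma hausdorff_measure_countable:
  assumes "s > 0" "countable (C :: 'a::metric_space set)"
  shows "hausdorff_measure s C = 0"
proof (rule hausdorff_measure_countable_Union)
  show "hausdorff_measure s {from_nat_into C k} = 0" for k
  proof (rule hausdorff_measure_zeroI)
    fix \<delta> e :: real assume "\<delta> > 0" "e > 0"
    then show "\<exists>U. {from_nat_into C k} \<subseteq> (\<Union>i::nat. U i) \<and>
      (\<forall>i. bounded (U i) \<and> diameter (U i) \<le> \<delta>) \<and> (\<Sum>i. diam_weight s (U i)) \<le> ennreal e"
      using assms by (intro exI[of _ "\<lambda>_. {from_nat_into C k}"]) (auto simp: diam_weight_def)
  qed
  show "C \<subseteq> (\<Union>k. {from_nat_into C k})"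
    using from_nat_into_surj[OF assms(2)] by fastforce
qed

lemma hausdorff_measure_mono_zero:
  "hausdorff_measure s F = 0 \<Longrightarrow> E \<subseteq> F \<Longrightarrow> hausdorff_measure s E = 0"
  by (rule hausdorff_measure_countable_Union[of s "\<lambda>_. F"]) auto

text \<open>Mass distribution without a mass: a cheap cover induces the set function
  \<open>\<nu>(S) = \<Sum>\<^sub>i K d\<^sub>i^(s-1) |S \<inter> B\<^sub>i|\<close>, which is smaller than \<open>len^s\<close> at the root. The sum condition on the
  children propagates this along some branch, whereas \<open>\<nu>\<close> is at least \<open>len^s\<close> on any cylinder of
  diameter about \<open>d\<^sub>i\<close> that meets the \<open>i\<close>-th covering set.\<close>

lemma hausdorff_measure_tree_pos:
  fixes C :: "'h \<Rightarrow> real set" and ch :: "'h \<Rightarrow> 'h set" and len :: "'h \<Rightarrow> real"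
  assumes s: "0 < s" "s \<le> 1" and r: "0 < r" "r \<le> 1" and \<kappa>: "\<kappa> < 1"
    and h0: "P h0" and child: "\<And>h h'. P h \<Longrightarrow> h' \<in> ch h \<Longrightarrow> P h'"
    and C: "\<And>h. P h \<Longrightarrow> C h \<in> sets borel" "\<And>h x y. P h \<Longrightarrow> x \<in> C h \<Longrightarrow> y \<in> C h \<Longrightarrow> \<bar>x - y\<bar> \<le> len h"
      "\<And>h. P h \<Longrightarrow> emeasure lborel (C h) = ennreal (len h)" "\<And>h. P h \<Longrightarrow> len h > 0"
    and ch: "\<And>h. P h \<Longrightarrow> finite (ch h)" "\<And>h. P h \<Longrightarrow> disjoint_family_on C (ch h)"
      "\<And>h h'. P h \<Longrightarrow> h' \<in> ch h \<Longrightarrow> C h' \<subseteq> C h"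
      "\<And>h h'. P h \<Longrightarrow> h' \<in> ch h \<Longrightarrow> r * len h \<le> len h'"
      "\<And>h h'. P h \<Longrightarrow> h' \<in> ch h \<Longrightarrow> len h' \<le> \<kappa> * len h"
      "\<And>h. P h \<Longrightarrow> len h powr s \<le> (\<Sum>h'\<in>ch h. len h' powr s)"
    and E: "\<And>p. p 0 = h0 \<Longrightarrow> (\<And>n. p (Suc n) \<in> ch (p n)) \<Longrightarrow> \<exists>x\<in>E. \<forall>n. x \<in> C (p n)"
  shows "hausdorff_measure s E \<noteq> 0"
proof
  assume H: "hausdorff_measure s E = 0"
  \<comment> \<open>For a cylinder of length at least \<open>r * d\<close>, \<open>s \<le> 1\<close>
    gives \<open>len powr (s - 1) \<le> (r * d) powr (s - 1) = K * d powr (s - 1)\<close>, the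
    inequality behind the final contradiction.\<close>
  define K where "K = r powr (s - 1)"
  define l where "l = len h0"
  have l: "l > 0" using C(4) h0 by (simp add: l_def)
  have K: "K > 0" using r by (simp add: K_def)
  define q where "q = (1/2) powr s"
  have q: "0 < q" "q < 1" using s powr_less_mono'[of "1/2" 0 s] by (auto simp: q_def)
  \<comment> \<open>The cover costs at most \<open>e\<close>, its fattening at most another
    \<open>e\<close>, and balls of radius \<open>2 * d i\<close> contribute a factor
    \<open>4 * K\<close>; this leaves half of \<open>l powr s\<close>.\<close>
  define e where "e = l powr s / (16 * K)"
  have e: "e > 0" using l K by (simp add: e_def)
  \<comment> \<open>Covering sets may be single points, so \<open>d i\<close> is raised to at least
    \<open>\<tau> * (1/2) ^ i\<close>. The extra cost is a geometric series of sum at most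
    \<open>e\<close>, and \<open>\<tau> \<le> l\<close> keeps \<open>d i \<le> l\<close>.\<close>
  define \<tau> where "\<tau> = min l ((e * (1 - q)) powr (1/s))"
  have \<tau>: "\<tau> > 0" using l e q by (auto simp: \<tau>_def)
  have \<tau>s: "\<tau> powr s \<le> e * (1 - q)"
  proof -
    have "\<tau> powr s \<le> ((e * (1 - q)) powr (1/s)) powr s"
      using \<tau> s by (intro powr_mono2) (auto simp: \<tau>_def)
    also have "\<dots> = e * (1 - q)" using s e q by (simp add: powr_powr)
    finally show ?thesis .
  qed
  obtain U :: "nat \<Rightarrow> real set" where U: "E \<subseteq> (\<Union>i. U i)" "\<And>i. bounded (U i)"
    "\<And>i. diameter (U i) \<le> l" "(\<Sum>i. diam_weight s (U i)) < ennreal e"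
    by (rule hausdorff_measure_zeroE[OF H l, of "ennreal e"]) (use e in auto)
  define d where "d = (\<lambda>i. max (diameter (U i)) (\<tau> * (1/2) ^ i))"
  have d0: "d i > 0" for i using \<tau> by (auto simp: d_def less_max_iff_disj)
  have dl: "d i \<le> l" for i
  proof -
    have "\<tau> * (1/2) ^ i \<le> l * 1"
      using l \<tau> by (intro mult_mono) (auto simp: \<tau>_def power_le_one)
    then show ?thesis using U(3) by (simp add: d_def)
  qed
  \<comment> \<open>With radius \<open>2 * d i\<close> about one point of \<open>U i\<close>, the
    ball contains the ball of radius \<open>d i\<close> about every point of
    \<open>U i\<close>.\<close>
  define B where "B = (\<lambda>i. if U i = {} then {} else cball (SOME x. x \<in> U i) (2 * d i))"
  define \<nu> where "\<nu> = (\<lambda>S. \<Sum>i. ennreal (K * d i powr (s - 1)) * emeasure lborel (S \<inter> B i))"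
  have Bs: "B i \<in> sets borel" for i by (simp add: B_def)
  have U_in_B: "cball x (d i) \<subseteq> B i" if "x \<in> U i" for x i
  proof
    fix y assume y: "y \<in> cball x (d i)"
    have c: "(SOME x. x \<in> U i) \<in> U i" using that by (rule someI)
    have "dist (SOME x. x \<in> U i) x \<le> diameter (U i)"
      by (rule diameter_bounded_bound[OF U(2) c that])
    moreover have "diameter (U i) \<le> d i" by (simp add: d_def)
    ultimately have "dist (SOME x. x \<in> U i) y \<le> 2 * d i"
      using y dist_triangle[of "SOME x. x \<in> U i" y x] by auto
    then show "y \<in> B i" using that by (auto simp: B_def)
  qed
  have mB: "ennreal (K * d i powr (s - 1)) * emeasure lborel (B i)
      \<le> ennreal (4 * K) * (diam_weight s (U i) + ennreal (\<tau> powr s * q ^ i))" for i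
  proof (cases "U i = {}")
    case False
    have "emeasure lborel (B i) = ennreal (4 * d i)"
      using False d0[of i] by (simp add: B_def cball_eq_atLeastAtMost)
    then have "ennreal (K * d i powr (s - 1)) * emeasure lborel (B i) =
        ennreal (4 * K * (d i powr (s - 1) * d i))"
      using K d0[of i] by (simp add: ennreal_mult' [symmetric] mult_ac)
    also have "d i powr (s - 1) * d i = d i powr s"
      using d0[of i] by (simp add: powr_diff)
    also have "ennreal (4 * K * d i powr s) \<le> ennreal (4 * K * (diameter (U i) powr s + \<tau> powr s * q ^ i))"
    proof (intro ennreal_leI mult_left_mono)
      have "(\<tau> * (1/2)^i) powr s = \<tau> powr s * q ^ i"
        using \<tau> by (simp add: powr_mult q_def powr_power powr_powr flip: powr_realpow) (simp add: mult_ac)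
      then show "d i powr s \<le> diameter (U i) powr s + \<tau> powr s * q ^ i"
        using q by (auto simp: d_def max_def)
    qed (use K in auto)
    also have "\<dots> = ennreal (4 * K) * (diam_weight s (U i) + ennreal (\<tau> powr s * q ^ i))"
      using K q False s by (simp add: diam_weight_def ennreal_mult' ennreal_plus)
    finally show ?thesis .
  qed (simp add: B_def)
  have "\<nu> (C h0) \<le> (\<Sum>i. ennreal (4 * K) * (diam_weight s (U i) + ennreal (\<tau> powr s * q ^ i)))"
    unfolding \<nu>_def
  proof (intro suminf_le)
    fix i
    have "emeasure lborel (C h0 \<inter> B i) \<le> emeasure lborel (B i)"
      using Bs by (intro emeasure_mono) auto
    then show "ennreal (K * d i powr (s - 1)) * emeasure lborel (C h0 \<inter> B i)
       \<le> ennreal (4 * K) * (diam_weight s (U i) + ennreal (\<tau> powr s * q ^ i))"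
      using mB[of i] by (meson mult_left_mono order_trans zero_le)
  qed auto
  also have "\<dots> = ennreal (4 * K) * ((\<Sum>i. diam_weight s (U i)) + (\<Sum>i. ennreal (\<tau> powr s * q ^ i)))"
    by (simp add: suminf_add[symmetric])
  also have "(\<Sum>i. ennreal (\<tau> powr s * q ^ i)) = ennreal (\<Sum>i. \<tau> powr s * q ^ i)"
    using q by (intro suminf_ennreal2) auto
  also have "(\<Sum>i. \<tau> powr s * q ^ i) = \<tau> powr s / (1 - q)"
    using q by (subst suminf_mult) (auto simp: suminf_geometric)
  also have "ennreal (4 * K) * ((\<Sum>i. diam_weight s (U i)) + ennreal (\<tau> powr s / (1 - q)))
      \<le> ennreal (4 * K) * (ennreal e + ennreal e)"
    using U(4) \<tau>s q by (intro mult_left_mono add_mono ennreal_leI) (auto simp: field_simps)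
  also have "\<dots> = ennreal (4 * K * (2 * e))"
  proof -
    have "ennreal e + ennreal e = ennreal (2 * e)" using e by (simp flip: ennreal_plus)
    then show ?thesis using K e by (simp only: ennreal_mult[symmetric])
  qed
  also have "\<dots> < ennreal (len h0 powr s)"
    using K l by (intro ennreal_lessI) (auto simp: e_def l_def)
  finally have \<nu>h0: "\<nu> (C h0) < ennreal (len h0 powr s)" .
  \<comment> \<open>If every child carried at least \<open>len powr s\<close>, additivity over the
    disjoint children and the sum condition would contradict the bound at the parent.\<close>
  have step: "\<exists>h'. (P h' \<and> \<nu> (C h') < ennreal (len h' powr s)) \<and> h' \<in> ch h"
    if h: "P h \<and> \<nu> (C h) < ennreal (len h powr s)" for h
  proof (rule ccontr)
    assume "\<not> ?thesis"
    then have *: "ennreal (len h' powr s) \<le> \<nu> (C h')" if "h' \<in> ch h" for h'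
      using child h that by (meson not_le)
    have "ennreal (len h powr s) \<le> ennreal (\<Sum>h'\<in>ch h. len h' powr s)"
      using ch(6) h by (intro ennreal_leI) auto
    also have "\<dots> = (\<Sum>h'\<in>ch h. ennreal (len h' powr s))" by (rule sum_ennreal[symmetric]) auto
    also have "\<dots> \<le> (\<Sum>h'\<in>ch h. \<nu> (C h'))" by (intro sum_mono *)
    also have "\<dots> = (\<Sum>i. \<Sum>h'\<in>ch h. ennreal (K * d i powr (s - 1)) * emeasure lborel (C h' \<inter> B i))"
      unfolding \<nu>_def by (rule suminf_sum[symmetric]) auto
    also have "\<dots> \<le> \<nu> (C h)" unfolding \<nu>_def
    proof (intro suminf_le)
      fix i
      have "(\<Sum>h'\<in>ch h. emeasure lborel (C h' \<inter> B i)) = emeasure lborel (\<Union>h'\<in>ch h. C h' \<inter> B i)"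
      proof (rule sum_emeasure)
        show "(\<lambda>h'. C h' \<inter> B i) ` ch h \<subseteq> sets lborel" using C(1) child h Bs by auto
        show "disjoint_family_on (\<lambda>h'. C h' \<inter> B i) (ch h)"
          using ch(2)[of h] h by (auto simp: disjoint_family_on_def)
        show "finite (ch h)" using ch(1) h by auto
      qed
      also have "\<dots> \<le> emeasure lborel (C h \<inter> B i)"
        using ch(3)[of h] C(1) h Bs by (intro emeasure_mono) auto
      finally show "(\<Sum>h'\<in>ch h. ennreal (K * d i powr (s - 1)) * emeasure lborel (C h' \<inter> B i))
        \<le> ennreal (K * d i powr (s - 1)) * emeasure lborel (C h \<inter> B i)"
        by (simp add: sum_distrib_left[symmetric] mult_left_mono)
    qed auto
    finally show False using h by auto
  qed
  have "\<exists>f. f 0 = h0 \<and> (\<forall>n. P (f n) \<and> \<nu> (C (f n)) < ennreal (len (f n) powr s)) \<and> (\<forall>n. f (Suc n) \<in> ch (f n))"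
    by (rule dependent_nat_choice[where P="\<lambda>n h. (n = 0 \<longrightarrow> h = h0) \<and> P h \<and> \<nu> (C h) < ennreal (len h powr s)" 
       and Q="\<lambda>n h h'. h' \<in> ch h", THEN exE])
       (use h0 \<nu>h0 step in auto)
  then obtain f where f: "f 0 = h0" "\<And>n. P (f n)" "\<And>n. \<nu> (C (f n)) < ennreal (len (f n) powr s)"
    "\<And>n. f (Suc n) \<in> ch (f n)" by blast
  obtain x where x: "x \<in> E" "\<And>n. x \<in> C (f n)" using E[of f] f by blast
  then obtain i where i: "x \<in> U i" using U(1) by blast
  have decay: "len (f n) \<le> (max \<kappa> 0) ^ n * l" for n
  proof (induction n)
    case (Suc n)
    have "len (f (Suc n)) \<le> \<kappa> * len (f n)" using ch(5) f by blast
    also have "\<dots> \<le> max \<kappa> 0 * len (f n)" using C(4)[OF f(2)[of n]] by (intro mult_right_mono) auto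
    also have "\<dots> \<le> max \<kappa> 0 * (max \<kappa> 0 ^ n * l)" using Suc by (intro mult_left_mono) auto
    finally show ?case by simp
  qed (simp add: f l_def)
  have "(\<lambda>n. (max \<kappa> 0) ^ n * l) \<longlonglongrightarrow> 0 * l"
    using \<kappa> by (intro tendsto_mult LIMSEQ_power_zero) auto
  then have "\<forall>\<^sub>F n in sequentially. (max \<kappa> 0) ^ n * l < d i"
    using d0 by (auto intro: order_tendstoD)
  then obtain n0 where "(max \<kappa> 0) ^ n0 * l < d i" by (auto simp: eventually_sequentially)
  then have ex: "len (f n0) \<le> d i" using decay[of n0] by auto
  \<comment> \<open>The first cylinder of the branch that is no longer than \<open>d i\<close>. It
    lies in \<open>B i\<close>, and the ratio \<open>r\<close>, or \<open>d i \<le> l\<close> at the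
    root, keeps its length at least \<open>r * d i\<close>.\<close>
  define n where "n = (LEAST n. len (f n) \<le> d i)"
  have n: "len (f n) \<le> d i" unfolding n_def by (rule LeastI[of "\<lambda>n. len (f n) \<le> d i", OF ex])
  have rn: "r * d i \<le> len (f n)"
  proof (cases n)
    case 0
    have "r * d i \<le> 1 * d i" using r d0[of i] by (intro mult_right_mono) auto
    also have "\<dots> \<le> len (f n)" using dl 0 f by (auto simp: l_def)
    finally show ?thesis .
  next
    case (Suc m)
    then have "\<not> len (f m) \<le> d i" unfolding n_def using not_less_Least[of m "\<lambda>n. len (f n) \<le> d i"] by auto
    then have "r * d i \<le> r * len (f m)" using r by (intro mult_left_mono) auto
    also have "\<dots> \<le> len (f n)" using ch(4) f Suc by blast
    finally show ?thesis .
  qed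
  let ?h = "f n"
  have "C ?h \<subseteq> cball x (d i)" using C(2)[OF f(2)[of n] x(2)[of n]] n by (force simp: dist_real_def)
  then have "C ?h \<inter> B i = C ?h" using U_in_B[OF i] by auto
  then have "ennreal (K * d i powr (s - 1) * len ?h) =
     ennreal (K * d i powr (s - 1)) * emeasure lborel (C ?h \<inter> B i)"
    using C(3)[OF f(2)[of n]] C(4)[OF f(2)[of n]] K by (simp add: ennreal_mult)
  also have "\<dots> \<le> \<nu> (C ?h)" unfolding \<nu>_def
    using sum_le_suminf[of "\<lambda>i. ennreal (K * d i powr (s - 1)) * emeasure lborel (C ?h \<inter> B i)" "{i}"] by auto
  also have "\<dots> < ennreal (len ?h powr s)" by (rule f)
  finally have less: "K * d i powr (s - 1) * len ?h < len ?h powr s"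
    by (simp add: ennreal_less_iff K d0 C(4)[OF f(2)] less_imp_le)
  have "len ?h powr s = len ?h powr (s - 1) * len ?h"
    using C(4)[OF f(2)[of n]] by (simp add: powr_diff)
  also have "\<dots> \<le> (r * d i) powr (s - 1) * len ?h"
    using rn r d0[of i] s C(4)[OF f(2)[of n]] by (intro mult_right_mono powr_mono2') auto
  also have "\<dots> = K * d i powr (s - 1) * len ?h"
    using r d0[of i] by (simp add: powr_mult K_def)
  finally show False using less by simp
qed

section \<open>Weights of finite words\<close>

definition words :: "'a set \<Rightarrow> nat \<Rightarrow> 'a list set" where
  "words \<Lambda> M = {w. set w \<subseteq> \<Lambda> \<and> length w = M}"

lemma finite_words: "finite \<Lambda> \<Longrightarrow> finite (words \<Lambda> M)"
  unfolding words_def by (rule finite_lists_length_eq)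

lemma words_mono: "\<Lambda> \<subseteq> \<Lambda>' \<Longrightarrow> words \<Lambda> M \<subseteq> words \<Lambda>' M"
  by (auto simp: words_def)

lemma sum_words_prod_list:
  fixes f :: "'a \<Rightarrow> 'b::comm_semiring_1"
  assumes "finite \<Lambda>"
  shows "(\<Sum>w\<in>words \<Lambda> M. prod_list (map f w)) = (\<Sum>x\<in>\<Lambda>. f x) ^ M"
proof (induction M)
  case 0
  have "words \<Lambda> 0 = {[]}" by (auto simp: words_def)
  then show ?case by simp
next
  case (Suc M)
  have "words \<Lambda> (Suc M) = (\<lambda>(x, w). x # w) ` (\<Lambda> \<times> words \<Lambda> M)"
    by (auto simp: words_def image_iff length_Suc_conv)
  moreover have "inj_on (\<lambda>(x, w). x # w) (\<Lambda> \<times> words \<Lambda> M)" by (auto simp: inj_on_def)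
  ultimately have "(\<Sum>w\<in>words \<Lambda> (Suc M). prod_list (map f w)) =
     (\<Sum>(x, w)\<in>\<Lambda> \<times> words \<Lambda> M. f x * prod_list (map f w))"
    by (simp add: sum.reindex case_prod_unfold)
  also have "\<dots> = (\<Sum>x\<in>\<Lambda>. f x) * (\<Sum>w\<in>words \<Lambda> M. prod_list (map f w))"
    using assms by (simp add: sum.cartesian_product[symmetric] sum_product)
  finally show ?case using Suc by simp
qed

text \<open>Words of length \<open>m\<close> have total weight the \<open>m\<close>-th power of the
  letter sum, so one geometric series bounds all finite subfamilies.\<close>

lemma summable_on_words:
  fixes p :: "nat \<Rightarrow> real"
  assumes p: "\<And>n. n \<ge> 1 \<Longrightarrow> p n \<ge> 0" and summ: "summable (\<lambda>k. p (Suc k))" and less: "(\<Sum>k. p (Suc k)) < 1"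
  shows "(\<lambda>ds. prod_list (map p ds)) summable_on {ds. set ds \<subseteq> {1..}}"
proof (rule nonneg_bdd_above_summable_on)
  let ?P = "\<Sum>k. p (Suc k)"
  have nn: "prod_list (map p ds) \<ge> 0" if "set ds \<subseteq> {1..}" for ds
    using that p by (intro prod_list_nonneg) auto
  then show "0 \<le> prod_list (map p ds)" if "ds \<in> {ds. set ds \<subseteq> {1..}}" for ds using that by auto
  have P0: "?P \<ge> 0" using summ p by (intro suminf_nonneg) auto
  have "sum (\<lambda>ds. prod_list (map p ds)) F \<le> 1 / (1 - ?P)"
    if F: "F \<subseteq> {ds. set ds \<subseteq> {1..}}" "finite F" for F
  proof -
    have "finite (\<Union>ds\<in>F. set ds)" "finite (length ` F)" using F by auto
    then obtain N M where N: "(\<Union>ds\<in>F. set ds) \<subseteq> {..N}" and M: "length ` F \<subseteq> {..M}"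
      using finite_nat_iff_bounded_le by metis
    have sub: "F \<subseteq> (\<Union>m\<in>{..M}. words {1..N} m)"
    proof
      fix ds assume ds: "ds \<in> F"
      have "length ds \<le> M" using M ds by auto
      moreover have "set ds \<subseteq> {1..N}"
      proof
        fix d assume d: "d \<in> set ds"
        then have "d \<le> N" using N ds by auto
        moreover have "d \<ge> 1" using F(1) ds d by auto
        ultimately show "d \<in> {1..N}" by simp
      qed
      ultimately show "ds \<in> (\<Union>m\<in>{..M}. words {1..N} m)" by (auto simp: words_def)
    qed
    have "sum (\<lambda>ds. prod_list (map p ds)) F \<le> sum (\<lambda>ds. prod_list (map p ds)) (\<Union>m\<in>{..M}. words {1..N} m)"
      by (rule sum_mono2) (use sub finite_words[of "{1..N}"] in \<open>auto intro!: nn simp: words_def\<close>)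
    also have "\<dots> = (\<Sum>m\<le>M. sum (\<lambda>ds. prod_list (map p ds)) (words {1..N} m))"
      by (rule sum.UNION_disjoint) (use finite_words[of "{1..N}"] in \<open>auto simp: words_def\<close>)
    also have "\<dots> = (\<Sum>m\<le>M. (\<Sum>n\<in>{1..N}. p n) ^ m)" by (simp add: sum_words_prod_list)
    also have "\<dots> \<le> (\<Sum>m\<le>M. ?P ^ m)"
    proof (intro sum_mono power_mono)
      show "(\<Sum>n\<in>{1..N}. p n) \<le> ?P"
        using sum_le_suminf[OF summ, of "{..<N}"] p by (simp add: sum.atLeast1_atMost_eq)
    qed (use p in \<open>auto intro!: sum_nonneg\<close>)
    also have "\<dots> \<le> (\<Sum>m. ?P ^ m)" using P0 less by (intro sum_le_suminf) auto
    also have "\<dots> = 1 / (1 - ?P)" using P0 less by (intro suminf_geometric) auto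
    finally show ?thesis .
  qed
  then show "bdd_above (sum (\<lambda>ds. prod_list (map p ds)) ` {F. F \<subseteq> {ds. set ds \<subseteq> {1..}} \<and> finite F})"
    by (intro bdd_aboveI[of _ "1 / (1 - ?P)"]) auto
qed

lemma prod_list_exp: "prod_list (map (\<lambda>x. p x * exp (q * X x)) w) =
    prod_list (map p w) * exp (q * sum_list (map X w))" for p X :: "'a \<Rightarrow> real"
  by (induction w) (auto simp: algebra_simps exp_add)

text \<open>A lower bound of Cramer type. Let \<open>g q\<close> be the letter sum tilted by
  \<open>exp (q * X x)\<close>. As \<open>X\<close> takes both signs, \<open>g\<close> has a
  minimiser \<open>q0\<close>; tilt by a slightly larger \<open>q1\<close>, so that words of length
  \<open>M\<close> have total \<open>g q1 ^ M\<close>. Those with nonpositive sum contribute at most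
  \<open>g q0 ^ M\<close>; those with sum at least \<open>b * M\<close> contribute exponentially
  little compared with the total, as a still larger tilt \<open>q2\<close> shows. The mass therefore
  sits at positive sums below \<open>b * M\<close>, where undoing the tilt costs at most
  \<open>exp (Q * b * M)\<close>, less than what \<open>g > 1\<close> supplies.\<close>

lemma words_positive_drift:
  fixes p X :: "'a \<Rightarrow> real"
  assumes fin: "finite \<Lambda>" and p: "\<And>x. x \<in> \<Lambda> \<Longrightarrow> p x > 0"
    and i: "i \<in> \<Lambda>" "X i > 0" and j: "j \<in> \<Lambda>" "X j < 0"
    and gt1: "\<And>q. (\<Sum>x\<in>\<Lambda>. p x * exp (q * X x)) > 1"
  shows "\<exists>M>0. (\<Sum>w\<in>{w\<in>words \<Lambda> M. sum_list (map X w) > 0}. prod_list (map p w)) \<ge> 1"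
proof -
  define g where "g = (\<lambda>q. \<Sum>x\<in>\<Lambda>. p x * exp (q * X x))"
  define g' where "g' = (\<lambda>q. \<Sum>x\<in>\<Lambda>. p x * X x * exp (q * X x))"
  have g1: "g q > 1" for q using gt1 by (simp add: g_def)
  have dg: "(g has_real_derivative g' q) (at q)" for q
    unfolding g_def g'_def by (auto intro!: derivative_eq_intros sum.cong simp: mult_ac)
  have gi: "p k * exp (q * X k) \<le> g q" if "k \<in> \<Lambda>" for k q
    unfolding g_def using fin p that by (intro member_le_sum) (auto simp: less_imp_le)
  \<comment> \<open>To the right of \<open>ci\<close> the term of \<open>i\<close> alone reaches
    \<open>g 0\<close>, to the left of \<open>cj\<close> that of \<open>j\<close>. Hence a minimum
    over \<open>[-R, R]\<close> is global.\<close>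
  define ci where "ci = ln (g 0 / p i) / X i"
  define cj where "cj = ln (g 0 / p j) / X j"
  define R where "R = \<bar>ci\<bar> + \<bar>cj\<bar>"
  have big: "g 0 \<le> g q" if "\<bar>q\<bar> \<ge> R" for q
  proof (cases "q \<ge> 0")
    case True
    then have "q \<ge> ci" using that by (auto simp: R_def)
    then have "ln (g 0 / p i) \<le> q * X i" using i by (simp add: ci_def field_simps)
    then have "exp (ln (g 0 / p i)) \<le> exp (q * X i)" by (simp only: exp_le_cancel_iff)
    then have "g 0 / p i \<le> exp (q * X i)" using g1[of 0] p[OF i(1)] by (subst (asm) exp_ln) auto
    then show ?thesis using gi[OF i(1), of q] p[OF i(1)] by (simp add: field_simps)
  next
    case False
    then have "q \<le> cj" using that by (auto simp: R_def)
    then have "ln (g 0 / p j) \<le> q * X j" using j by (simp add: cj_def field_simps)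
    then have "exp (ln (g 0 / p j)) \<le> exp (q * X j)" by (simp only: exp_le_cancel_iff)
    then have "g 0 / p j \<le> exp (q * X j)" using g1[of 0] p[OF j(1)] by (subst (asm) exp_ln) auto
    then show ?thesis using gi[OF j(1), of q] p[OF j(1)] by (simp add: field_simps)
  qed
  have cont: "continuous_on {-R..R} g" by (meson DERIV_isCont continuous_at_imp_continuous_on dg)
  have R0: "R \<ge> 0" by (simp add: R_def)
  have "\<exists>x\<in>{-R..R}. \<forall>y\<in>{-R..R}. g x \<le> g y"
    using cont R0 by (intro continuous_attains_inf) auto
  then obtain q0 where q0: "\<forall>q\<in>{-R..R}. g q0 \<le> g q" by blast
  have min: "g q0 \<le> g q" for q
  proof (cases "q \<in> {-R..R}")
    case False
    have "g q0 \<le> g 0" using q0 R0 by auto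
    also have "\<dots> \<le> g q" using False by (intro big) auto
    finally show ?thesis .
  qed (use q0 in auto)
  have g'0: "g' q0 = 0" by (rule DERIV_local_min[OF dg, of 1]) (use min in auto)
  \<comment> \<open>\<open>Q\<close> bounds \<open>q1\<close> from above. With the next choice of
    \<open>b\<close>, \<open>exp (Q * b)\<close> is the square root of \<open>g q0\<close>, hence
    below \<open>g q1\<close>; here \<open>g q0 > 1\<close> is essential.\<close>
  define Q where "Q = \<bar>q0\<bar> + 1"
  define b where "b = ln (g q0) / (2 * Q)"
  have Q: "Q > 0" by (simp add: Q_def)
  have b: "b > 0" using g1[of q0] Q by (simp add: b_def)
  have "isCont g' q0" unfolding g'_def by (intro continuous_intros)
  then obtain \<eta> where \<eta>: "\<eta> > 0" "\<And>q. \<bar>q - q0\<bar> < \<eta> \<Longrightarrow> \<bar>g' q\<bar> < b"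
    using b g'0 unfolding continuous_at_eps_delta by (auto simp: dist_real_def)
  define h where "h = min (1/2) (\<eta> / 3)"
  have h: "h > 0" "h \<le> 1/2" "2 * h < \<eta>" using \<eta>(1) by (auto simp: h_def)
  define q1 where "q1 = q0 + h"
  define q2 where "q2 = q0 + 2 * h"
  \<comment> \<open>Near the critical point \<open>q0\<close> the slope of \<open>g\<close> is below
    \<open>b\<close>. So from \<open>q1\<close> to \<open>q2\<close> the function grows by a factor
    below \<open>exp (h * b)\<close>, which is the factor per letter gained on sums of at least
    \<open>b * M\<close>.\<close>
  have "\<exists>z>q1. z < q2 \<and> g q2 - g q1 = (q2 - q1) * g' z"
    by (rule MVT2) (use h dg in \<open>auto simp: q1_def q2_def\<close>)
  then obtain z where z: "q1 < z" "z < q2" "g q2 - g q1 = (q2 - q1) * g' z" by blast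
  have "\<bar>g' z\<bar> < b" by (rule \<eta>) (use z h in \<open>auto simp: q1_def q2_def\<close>)
  then have "g q2 - g q1 < h * b" using z h by (auto simp: q1_def q2_def)
  also have "\<dots> \<le> h * b * g q1" using h b g1[of q1] by simp
  finally have "g q2 < (1 + h * b) * g q1" by (simp add: algebra_simps)
  also have "\<dots> \<le> exp (h * b) * g q1"
    using g1[of q1] exp_ge_add_one_self[of "h * b"] by (intro mult_right_mono) auto
  finally have C: "exp (- (h * b)) * g q2 < g q1" by (simp add: exp_minus field_simps)
  have B: "g q0 < g q1"
  proof (rule ccontr)
    assume "\<not> ?thesis"
    then have eq: "g q1 = g q0" using min[of q1] by auto
    \<comment> \<open>Midpoint convexity, strict because of the letter \<open>i\<close> with
      \<open>X i > 0\<close>: equal values at \<open>q0\<close> and \<open>q1\<close> would push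
      \<open>g\<close> below its minimum.\<close>
    define m where "m = q0 + h / 2"
    have sq: "exp (m * y) * 2 \<le> exp (q0 * y) + exp (q1 * y)" and
      sq': "y > 0 \<Longrightarrow> exp (m * y) * 2 < exp (q0 * y) + exp (q1 * y)" for y
    proof -
      have e: "exp (q0 * y) = exp (q0 * y / 2) ^ 2" "exp (q1 * y) = exp (q1 * y / 2) ^ 2"
        "exp (m * y) = exp (q0 * y / 2) * exp (q1 * y / 2)"
        by (auto simp: power2_eq_square m_def q1_def field_simps simp flip: exp_add)
      have *: "(exp (q0 * y / 2) - exp (q1 * y / 2)) ^ 2 \<ge> 0" by simp
      show "exp (m * y) * 2 \<le> exp (q0 * y) + exp (q1 * y)"
        unfolding e using * by (simp add: power2_eq_square algebra_simps)
      assume "y > 0"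
      then have "(exp (q0 * y / 2) - exp (q1 * y / 2)) ^ 2 > 0" using h by (simp add: q1_def)
      then show "exp (m * y) * 2 < exp (q0 * y) + exp (q1 * y)"
        unfolding e by (simp add: power2_eq_square algebra_simps)
    qed
    have "g m * 2 = (\<Sum>x\<in>\<Lambda>. p x * (exp (m * X x) * 2))"
      unfolding g_def by (simp add: sum_distrib_right mult.assoc)
    also have "\<dots> < (\<Sum>x\<in>\<Lambda>. p x * (exp (q0 * X x) + exp (q1 * X x)))"
      using fin p i sq sq' by (intro sum_strict_mono_ex1) (auto intro!: mult_left_mono less_imp_le[OF p])
    also have "\<dots> = g q0 + g q1" unfolding g_def by (simp add: distrib_left sum.distrib)
    finally show False using min[of m] eq by auto
  qed
  define A where "A = g q1"
  define C' where "C' = exp (- (h * b)) * g q2"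
  have A1: "A > 1" using g1 by (simp add: A_def)
  have C'0: "C' \<ge> 0" using g1[of q2] by (simp add: C'_def)
  let ?S = "\<lambda>w. sum_list (map X w)" and ?P = "\<lambda>w. prod_list (map p w)"
  have P0: "?P w \<ge> 0" if "w \<in> words \<Lambda> M" for w M
    using that p by (intro prod_list_nonneg) (auto simp: words_def less_imp_le)
  have tot: "(\<Sum>w\<in>words \<Lambda> M. ?P w * exp (q * ?S w)) = g q ^ M" for M q
    using sum_words_prod_list[OF fin, of "\<lambda>x. p x * exp (q * X x)" M] by (simp add: prod_list_exp g_def)
  have main: "A ^ M \<le> g q0 ^ M + C' ^ M + exp (Q * b * M) * (\<Sum>w\<in>{w\<in>words \<Lambda> M. ?S w > 0}. ?P w)" for M
  proof -
    let ?W = "words \<Lambda> M"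
    have pt: "?P w * exp (q1 * ?S w) \<le> ?P w * exp (q0 * ?S w) + exp (- (h * b) * M) * (?P w * exp (q2 * ?S w))
        + exp (Q * b * M) * (if ?S w > 0 then ?P w else 0)" if w: "w \<in> ?W" for w
    proof -
      consider "?S w \<le> 0" | "?S w \<ge> b * M" | "?S w > 0" "?S w < b * M" by linarith
      then have "exp (q1 * ?S w) \<le> exp (q0 * ?S w) + exp (- (h * b) * M) * exp (q2 * ?S w)
        + exp (Q * b * M) * (if ?S w > 0 then 1 else 0)"
      proof cases
        case 1
        then have "exp (q1 * ?S w) \<le> exp (q0 * ?S w)"
          using h by (simp add: q1_def algebra_simps mult_nonneg_nonpos)
        then show ?thesis using 1 by (simp add: add_increasing2)
      next
        case 2
        have "q1 * ?S w = q2 * ?S w - h * ?S w" by (simp add: q1_def q2_def algebra_simps)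
        also have "\<dots> \<le> - (h * b) * M + q2 * ?S w" using 2 h mult_left_mono[of "b * M" "?S w" h] by (simp add: mult_ac)
        finally have "exp (q1 * ?S w) \<le> exp (- (h * b) * M) * exp (q2 * ?S w)" by (simp flip: exp_add)
        then show ?thesis by (simp add: add_increasing add_increasing2)
      next
        case 3
        have "q1 * ?S w \<le> Q * ?S w" using 3 h by (intro mult_right_mono) (auto simp: q1_def Q_def)
        also have "\<dots> \<le> Q * (b * M)" using 3 Q by (intro mult_left_mono) auto
        finally have "exp (q1 * ?S w) \<le> exp (Q * b * M)" by (simp add: mult_ac)
        then show ?thesis using 3 by (simp add: add_increasing)
      qed
      from mult_left_mono[OF this P0[OF w]] show ?thesis by (simp add: algebra_simps split: if_splits)
    qed
    have "A ^ M = (\<Sum>w\<in>?W. ?P w * exp (q1 * ?S w))" by (simp add: tot A_def)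
    also have "\<dots> \<le> (\<Sum>w\<in>?W. ?P w * exp (q0 * ?S w) + exp (- (h * b) * M) * (?P w * exp (q2 * ?S w))
        + exp (Q * b * M) * (if ?S w > 0 then ?P w else 0))" by (intro sum_mono pt)
    also have "\<dots> = g q0 ^ M + exp (- (h * b) * M) * g q2 ^ M + exp (Q * b * M) * (\<Sum>w\<in>?W. if ?S w > 0 then ?P w else 0)"
      by (simp add: sum.distrib sum_distrib_left[symmetric] tot)
    also have "(\<Sum>w\<in>?W. if ?S w > 0 then ?P w else 0) = (\<Sum>w\<in>{w\<in>?W. ?S w > 0}. ?P w)"
      using finite_words[OF fin] by (simp add: sum.inter_filter)
    also have "exp (- (h * b) * M) * g q2 ^ M = C' ^ M"
      by (simp add: C'_def power_mult_distrib exp_of_nat_mult[symmetric] mult_ac)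
    finally show ?thesis .
  qed
  have lim1: "(\<lambda>M. (g q0 / A) ^ M) \<longlonglongrightarrow> 0"
    using B A1 g1[of q0] by (intro LIMSEQ_power_zero) (auto simp: A_def)
  have lim2: "(\<lambda>M. (C' / A) ^ M) \<longlonglongrightarrow> 0"
    using C A1 C'0 by (intro LIMSEQ_power_zero) (auto simp: A_def C'_def)
  \<comment> \<open>Half of \<open>A ^ M\<close> survives the two discarded parts; divided by
    \<open>exp (Q * b * M)\<close> it is \<open>D ^ M / 2\<close>, which eventually exceeds
    1.\<close>
  define D where "D = exp (- (Q * b)) * A"
  have "exp (Q * b) < A"
  proof -
    have "Q * b = ln (g q0) / 2" using Q by (simp add: b_def)
    also have "\<dots> < ln (g q0)" using g1[of q0] by simp
    finally have "exp (Q * b) < exp (ln (g q0))" by (simp only: exp_less_cancel_iff)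
    then have "exp (Q * b) < g q0" using g1[of q0] by (subst (asm) exp_ln) auto
    then show ?thesis using B by (simp add: A_def)
  qed
  then have D1: "D > 1" by (simp add: D_def exp_minus field_simps)
  have "\<forall>\<^sub>F M in sequentially. (g q0 / A) ^ M < 1/4" using lim1 by (rule order_tendstoD) auto
  moreover have "\<forall>\<^sub>F M in sequentially. (C' / A) ^ M < 1/4" using lim2 by (rule order_tendstoD) auto
  moreover have "\<forall>\<^sub>F M in sequentially. D ^ M > 2"
  proof -
    obtain n where n: "2 < D ^ n" using real_arch_pow[OF D1] by blast
    have "D ^ n \<le> D ^ M" if "M \<ge> n" for M
      using that D1 by (intro power_increasing) auto
    then have "2 < D ^ M" if "M \<ge> n" for M
      using that n by fastforce
    then show ?thesis by (auto simp: eventually_sequentially)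
  qed
  moreover have "\<forall>\<^sub>F M::nat in sequentially. M > 0" by (rule eventually_gt_at_top)
  ultimately have "\<forall>\<^sub>F M in sequentially. M > 0 \<and> (g q0 / A) ^ M < 1/4 \<and> (C' / A) ^ M < 1/4 \<and> D ^ M > 2"
    by eventually_elim auto
  then obtain M where M: "M > 0" "(g q0 / A) ^ M < 1/4" "(C' / A) ^ M < 1/4" "D ^ M > 2"
    by (auto simp: eventually_sequentially)
  let ?Z = "\<Sum>w\<in>{w\<in>words \<Lambda> M. ?S w > 0}. ?P w"
  have AM: "A ^ M > 0" using A1 by simp
  have "g q0 ^ M < A ^ M / 4" "C' ^ M < A ^ M / 4"
    using M(2,3) AM by (simp_all add: power_divide field_simps)
  with main[of M] have "A ^ M / 2 < exp (Q * b * M) * ?Z" by linarith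
  then have "exp (- (Q * b * M)) * A ^ M / 2 < ?Z" by (simp add: exp_minus field_simps)
  moreover have "exp (- (Q * b * M)) * A ^ M = D ^ M"
    by (simp add: D_def power_mult_distrib exp_of_nat_mult[symmetric] mult_ac)
  ultimately show ?thesis using M by (intro exI[of _ M]) auto
qed

text \<open>A power below 1 enlarges every weight in \<open>(0,1)\<close>, and the gain on the first
  weight alone eventually lifts the partial sums above the total 1. It will exclude tilts outside
  \<open>[0, s]\<close>.\<close>

lemma sums_1_powr_partial_gt:
  fixes w :: "nat \<Rightarrow> real"
  assumes w: "\<And>n. n \<ge> 1 \<Longrightarrow> w n > 0" "\<And>n. n \<ge> 1 \<Longrightarrow> w n < 1" "(\<lambda>k. w (Suc k)) sums 1" and v: "v < 1"
  shows "\<exists>N. (\<Sum>n=1..N. w n powr v) > 1"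
proof (rule ccontr)
  assume "\<not> ?thesis"
  then have le: "(\<Sum>n=1..N. w n powr v) \<le> 1" for N by (meson not_le)
  define d where "d = w 1 powr v - w 1"
  have gt: "w n powr v > w n" if "n \<ge> 1" for n
    using powr_less_mono'[of "w n" v 1] w(1,2)[OF that] v by simp
  then have d: "d > 0" by (simp add: d_def)
  have "(\<Sum>k<N. w (Suc k)) \<le> 1 - d" if "N \<ge> 1" for N
  proof -
    have "(\<Sum>n=1..N. w n) + d = (\<Sum>n=1..N. w n + (if n = 1 then d else 0))"
      using that by (simp add: sum.distrib sum.delta)
    also have "\<dots> \<le> (\<Sum>n=1..N. w n powr v)"
      using gt by (intro sum_mono) (auto simp: d_def less_imp_le)
    also have "\<dots> \<le> 1" by (rule le)
    finally show ?thesis by (simp add: sum.atLeast1_atMost_eq)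
  qed
  then have "1 \<le> 1 - d" using w(3) unfolding sums_def by (intro LIMSEQ_le_const2) auto
  then show False using d by simp
qed

lemma affine_image_unit_interval:
  fixes c d :: real assumes "c \<noteq> 0"
  shows "(\<lambda>x. d + c * x) ` {0<..<1} = {min d (d + c)<..<max d (d + c)}"
proof (intro equalityI subsetI)
  fix y assume "y \<in> (\<lambda>x. d + c * x) ` {0<..<1}"
  then obtain x where x: "0 < x" "x < 1" "y = d + c * x" by auto
  show "y \<in> {min d (d + c)<..<max d (d + c)}"
  proof (cases "c > 0")
    case True
    then have "c * x < c" "0 < c * x" using x by auto
    then show ?thesis using x True by auto
  next
    case False
    then have "c < 0" using assms by simp
    then have "c * x > c" "0 > c * x" using x by (auto simp: mult_neg_pos)
    then show ?thesis using x by auto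
  qed
next
  fix y assume y: "y \<in> {min d (d + c)<..<max d (d + c)}"
  have "(y - d) / c \<in> {0<..<1}"
    using y assms by (cases "c > 0") (auto simp: field_simps min_def max_def split: if_splits)
  moreover have "y = d + c * ((y - d) / c)" using assms by simp
  ultimately show "y \<in> (\<lambda>x. d + c * x) ` {0<..<1}" by blast
qed

section \<open>Farey codes of finite digit words\<close>

definition code_block :: "nat \<Rightarrow> nat list" where "code_block d = replicate (d - 1) 0 @ [1]"

definition code :: "nat list \<Rightarrow> nat list" where "code ds = concat (map code_block ds)"

lemma code_simps [simp]: "code [] = []" "code (d # ds) = code_block d @ code ds"
  "code (ds @ es) = code ds @ code es"
  by (auto simp: code_def)

lemma length_code_ge: "length ds \<le> length (code ds)"
  by (induction ds) (auto simp: code_block_def)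

lemma length_code: "set ds \<subseteq> {1..} \<Longrightarrow> length (code ds) = sum_list ds"
  by (induction ds) (auto simp: code_block_def)

lemma length_le_sum_list: "set ds \<subseteq> {1..} \<Longrightarrow> length ds \<le> sum_list (ds :: nat list)"
  using length_code_ge[of ds] by (simp add: length_code)

text \<open>The zeros before the first 1 determine the block. Truncated subtraction makes
  \<open>code_block 0 = code_block 1\<close>, hence a conclusion about \<open>d - 1\<close>.\<close>

lemma code_block_append_inject:
  assumes "code_block d @ r = code_block e @ r'" shows "d - 1 = e - 1"
proof -
  have "takeWhile (\<lambda>s. s = 0) (code_block d @ r) = replicate (d - 1) 0" for d r
  proof -
    have "takeWhile (\<lambda>s. s = 0) (replicate n 0 @ (1::nat) # q) = replicate n 0" for n q
      by (induction n) auto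
    then show ?thesis by (simp add: code_block_def)
  qed
  then have "replicate (d - 1) (0::nat) = replicate (e - 1) 0" using assms by metis
  then show ?thesis by (metis length_replicate)
qed

text \<open>Each block ends at its only 1, so the blocks form a prefix code: agreement over the full
  length \<open>sum_list ds\<close> of the code of \<open>ds\<close> is agreement of digits.\<close>

lemma code_decode:
  assumes "set ds \<subseteq> {1..}" "set es \<subseteq> {1..}" "length ds \<le> length es"
    "take (sum_list ds) (code es) = code ds"
  shows "take (length ds) es = ds"
  using assms
proof (induction ds arbitrary: es)
  case (Cons d ds)
  then obtain e es' where es: "es = e # es'" by (cases es) auto
  have de: "d \<ge> 1" "e \<ge> 1" using Cons.prems es by auto
  have "code es = take (sum_list (d # ds)) (code es) @ drop (sum_list (d # ds)) (code es)"
    by (rule append_take_drop_id[symmetric])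
  also have "\<dots> = code_block d @ code ds @ drop (sum_list (d # ds)) (code es)"
    unfolding Cons.prems(4) by (simp only: code_simps append_assoc)
  finally obtain R where "code es = code_block d @ R" by blast
  then have "code_block d @ R = code_block e @ code es'" by (simp only: es code_simps)
  then have eq: "d = e" using code_block_append_inject[of d R e "code es'"] de by linarith
  have lb: "length (code_block d) = d" using de by (simp add: code_block_def)
  have "take (d + sum_list ds) (code_block d @ code es') = code_block d @ code ds"
    using Cons.prems(4) unfolding es eq by simp
  then have "take (sum_list ds) (code es') = code ds" by (simp add: lb)
  then have "take (length ds) es' = ds" using Cons.IH[of es'] Cons.prems es by auto
  then show ?case using es eq by simp
qed simp

section \<open>Lueroth cylinders\<close>

locale luroth =
  fixes A :: "nat \<Rightarrow> real set"
  assumes partition: "luroth_partition A"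
begin

abbreviation "a \<equiv> atom_len A"
abbreviation "t \<equiv> tail_len A"
abbreviation "L \<equiv> luroth_map A"
abbreviation "digit \<equiv> luroth_digit A"
abbreviation "\<theta> \<equiv> farey_minkowski A"

text \<open>\<open>luroth_partition\<close> provides only abstract end points. The right ones are
  tail sums because the atoms from \<open>n\<close> on tile \<open>(0, v n]\<close>; the left ones
  follow by removing the atoms from \<open>n + 1\<close> on.\<close>

lemma atom_structure:
  assumes n: "n \<ge> 1"
  shows atom_eq: "A n = {t (n+1)<..t n}" and tail_less: "t (n+1) < t n"
    and Union_atoms: "(\<Union>k. A (n + k)) = {0<..t n}"
proof -
  have "\<exists>u v. \<forall>n\<ge>1. u n < v n \<and> A n = {u n<..v n}"
    using partition unfolding luroth_partition_def by metis
  then obtain u v where uv: "\<And>n. n \<ge> 1 \<Longrightarrow> u n < v n" "\<And>n. n \<ge> 1 \<Longrightarrow> A n = {u n<..(v n :: real)}"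
    by blast
  have cover: "(\<Union>n\<in>{1..}. A n) = {0<..1}" and disj: "disjoint_family_on A {1..}"
    and order: "\<And>m n x y. m \<ge> 1 \<Longrightarrow> n > m \<Longrightarrow> x \<in> A m \<Longrightarrow> y \<in> A n \<Longrightarrow> y < x"
    using partition unfolding luroth_partition_def by blast+
  have vA: "v n \<in> A n" if "n \<ge> 1" for n using uv[OF that] by auto
  have pos: "x > 0" "x \<le> 1" if "x \<in> A n" "n \<ge> 1" for x n using cover that by auto
  have Un: "(\<Union>k. A (n + k)) = {0<..v n}" if n: "n \<ge> 1" for n
  proof (intro equalityI subsetI)
    fix x assume "x \<in> (\<Union>k. A (n + k))"
    then obtain k where k: "x \<in> A (n + k)" by auto
    have "x \<le> v n"
    proof (cases "k = 0")
      case True then show ?thesis using k uv(2)[OF n] by auto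
    next
      case False then show ?thesis using order[OF n _ vA[OF n] k] by auto
    qed
    then show "x \<in> {0<..v n}" using pos[OF k] n by auto
  next
    fix x assume x: "x \<in> {0<..v n}"
    then have "x \<in> {0<..1}" using pos(2)[OF vA[OF n] n] by auto
    then obtain m where m: "m \<ge> 1" "x \<in> A m" unfolding cover[symmetric] by auto
    have "m \<ge> n" using order[OF m(1) _ m(2) vA[OF n]] x by force
    then show "x \<in> (\<Union>k. A (n + k))" using m by (intro UN_I[of "m - n"]) auto
  qed
  have tv: "t n = v n" if n: "n \<ge> 1" for n
  proof -
    have v0: "v n > 0" using pos(1)[OF vA[OF n] n] .
    have "(\<lambda>k. measure lborel (A (n + k))) sums measure lborel (\<Union>k. A (n + k))"
    proof (rule measure_UNION)
      show "range (\<lambda>k. A (n + k)) \<subseteq> sets lborel" using uv(2) n by auto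
      show "disjoint_family (\<lambda>k. A (n + k))"
        using disj n by (auto simp: disjoint_family_on_def)
      show "emeasure lborel (\<Union>k. A (n + k)) \<noteq> \<infinity>" using v0 unfolding Un[OF n] by simp
    qed
    moreover have "measure lborel (\<Union>k. A (n + k)) = v n" using v0 unfolding Un[OF n] by simp
    ultimately show ?thesis by (simp add: tail_len_def atom_len_def sums_iff)
  qed
  show "(\<Union>k. A (n + k)) = {0<..t n}" using Un tv n by simp
  have lt: "v (n+1) < v n" using order[OF n _ vA[OF n] vA[of "n+1"]] by simp
  then show "t (n+1) < t n" using tv n by simp
  have "A n \<union> {0<..v (n+1)} = {0<..v n}"
  proof -
    have "A n \<union> (\<Union>k. A (n + 1 + k)) = (\<Union>k. A (n + k))"
    proof -
      have "(\<Union>k. A (n + k)) = (\<Union>k\<in>insert 0 (range Suc). A (n + k))"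
        by (simp only: UNIV_nat_eq[symmetric])
      also have "\<dots> = A n \<union> (\<Union>k. A (n + 1 + k))" by simp
      finally show ?thesis by (rule sym)
    qed
    moreover have "(\<Union>k. A (n + 1 + k)) = {0<..v (n+1)}" by (rule Un) simp
    ultimately show ?thesis by (simp only: Un[OF n])
  qed
  moreover have "A n \<inter> {0<..v (n+1)} = {}"
  proof (intro equals0I)
    fix x assume x: "x \<in> A n \<inter> {0<..v (n+1)}"
    then have "x \<in> (\<Union>k. A (n + 1 + k))" using Un[of "n+1"] by simp
    then obtain k where "x \<in> A (n + 1 + k)" by blast
    then have "x < x" using order[OF n, of "n + 1 + k" x x] x by simp
    then show False by simp
  qed
  ultimately have "A n = {0<..v n} - {0<..v (n+1)}" by blast
  also have "\<dots> = {v (n+1)<..v n}" using pos(1)[OF vA[of "n+1"]] by auto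
  finally show "A n = {t (n+1)<..t n}" using tv n by simp
qed

lemma tail_pos: assumes "n \<ge> 1" shows "t n > 0"
proof -
  have "t n \<in> A (n + 0)" using atom_eq[OF assms] tail_less[OF assms] by simp
  then have "t n \<in> (\<Union>k. A (n + k))" by blast
  then show ?thesis unfolding Union_atoms[OF assms] by simp
qed

lemma tail_1: "t 1 = 1"
proof -
  have "(\<Union>k. A (1 + k)) = (\<Union>n\<in>{1..}. A n)"
    by (auto simp: image_iff) (metis le_add_diff_inverse One_nat_def plus_1_eq_Suc)
  also have "\<dots> = {0<..1}" using partition unfolding luroth_partition_def by blast
  finally have "{0<..t 1} = {0<..1::real}" using Union_atoms[of 1] by simp
  then show ?thesis by (simp add: Ioc_inj)
qed

lemma atom_len_eq: "n \<ge> 1 \<Longrightarrow> a n = t n - t (n+1)"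
  using atom_eq[of n] tail_less[of n] by (simp add: atom_len_def)

lemma atom_len_pos: "n \<ge> 1 \<Longrightarrow> a n > 0"
  using atom_len_eq[of n] tail_less[of n] by simp

lemma tail_antimono:
  assumes "1 \<le> m" "m \<le> n" shows "t n \<le> t m"
  using assms(2)
proof (induction rule: dec_induct)
  case (step n)
  then show ?case using tail_less[of n] assms(1) by simp
qed simp

lemma tail_le_1: "n \<ge> 1 \<Longrightarrow> t n \<le> 1"
  using tail_antimono[of 1 n] tail_1 by simp

lemma atom_len_sums: "(\<lambda>k. a (Suc k)) sums 1"
proof -
  have "(\<lambda>k. measure lborel (A (1 + k))) sums measure lborel (\<Union>k. A (1 + k))"
  proof (rule measure_UNION)
    show "range (\<lambda>k. A (1 + k)) \<subseteq> sets lborel" using atom_eq by auto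
    show "disjoint_family (\<lambda>k. A (1 + k))"
      using partition by (auto simp: luroth_partition_def disjoint_family_on_def)
    show "emeasure lborel (\<Union>k. A (1 + k)) \<noteq> \<infinity>" unfolding Union_atoms[OF order_refl] tail_1 by simp
  qed
  then show ?thesis unfolding Union_atoms[OF order_refl] tail_1 by (simp add: atom_len_def)
qed

text \<open>A uniform contraction ratio: all atoms but the first lie in \<open>(0, t 2]\<close>, an
  interval of length \<open>1 - a 1\<close>.\<close>

definition \<kappa> :: real where "\<kappa> = max (a 1) (1 - a 1)"

lemma \<kappa>: "0 < \<kappa>" "\<kappa> < 1" "n \<ge> 1 \<Longrightarrow> a n \<le> \<kappa>"
proof -
  have "a 1 = t 1 - t (1 + 1)" by (rule atom_len_eq) simp
  then have e: "a 1 = 1 - t 2" by (simp only: tail_1 one_add_one)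
  have "t 2 > 0" by (rule tail_pos) simp
  moreover have "a 1 > 0" by (rule atom_len_pos) simp
  ultimately have *: "0 < a 1" "a 1 < 1" "1 - a 1 = t 2" using e by linarith+
  then show "0 < \<kappa>" "\<kappa> < 1" by (auto simp: \<kappa>_def)
  assume n: "n \<ge> 1"
  show "a n \<le> \<kappa>"
  proof (cases "n = 1")
    case False
    then have "t n \<le> t 2" using n by (intro tail_antimono) auto
    moreover have "t (n + 1) > 0" by (rule tail_pos) simp
    ultimately have "a n \<le> 1 - a 1" using atom_len_eq[OF n] *(3) by linarith
    then show ?thesis by (simp add: \<kappa>_def)
  qed (simp add: \<kappa>_def)
qed

lemma atom_len_less_1: "n \<ge> 1 \<Longrightarrow> a n < 1"
  using \<kappa> by fastforce

section \<open>Inverse branches, orbits and termination\<close>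

lemma atom_index_eq:
  assumes "n \<ge> 1" "x \<in> A n" shows "atom_index A x = n"
  unfolding atom_index_def
proof (rule the_equality)
  fix m assume m: "1 \<le> m \<and> x \<in> A m"
  have "disjoint_family_on A {1..}" using partition by (simp add: luroth_partition_def)
  then show "m = n" using m assms unfolding disjoint_family_on_def by (metis atLeast_iff disjoint_iff)
qed (use assms in auto)

lemma atom_cases:
  assumes "0 < x" "x \<le> 1" obtains n where "n \<ge> 1" "x \<in> A n"
proof -
  have "(\<Union>n\<in>{1..}. A n) = {0<..1}" using partition unfolding luroth_partition_def by blast
  moreover have "x \<in> {0<..1}" using assms by simp
  ultimately have "x \<in> (\<Union>n\<in>{1..}. A n)" by simp
  then show ?thesis using that by blast
qed

text \<open>The inverse branches of the Lueroth map. They are affine on the whole line, so that both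
  end points can be inserted: 0 goes to \<open>t n\<close>, which lies in \<open>A n\<close>, and 1
  to \<open>t (n+1)\<close>, which does not. Each branch reverses orientation.\<close>

definition phi :: "nat \<Rightarrow> real \<Rightarrow> real" where "phi n x = t n - a n * x"

definition phis :: "nat list \<Rightarrow> real \<Rightarrow> real" where "phis ds = foldr phi ds"

definition lam :: "nat list \<Rightarrow> real" where "lam ds = prod_list (map a ds)"

lemma phis_simps [simp]: "phis [] x = x" "phis (n # ds) x = phi n (phis ds x)"
  "phis (ds @ es) x = phis ds (phis es x)"
  by (auto simp: phis_def)

lemma lam_simps [simp]: "lam [] = 1" "lam (n # ds) = a n * lam ds" "lam (ds @ es) = lam ds * lam es"
  by (auto simp: lam_def)

lemma lam_pos: "set ds \<subseteq> {1..} \<Longrightarrow> lam ds > 0"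
  by (induction ds) (auto simp: atom_len_pos)

lemma lam_le: "set ds \<subseteq> {1..} \<Longrightarrow> lam ds \<le> \<kappa> ^ length ds"
proof (induction ds)
  case (Cons n ds)
  then show ?case using \<kappa>(1) \<kappa>(3)[of n] atom_len_pos[of n] lam_pos[of ds]
    by (auto intro!: mult_mono)
qed auto

lemma phis_diff: "phis ds x - phis ds y = (-1) ^ length ds * lam ds * (x - y)"
proof (induction ds)
  case (Cons n ds)
  have "phis (n # ds) x - phis (n # ds) y = - a n * (phis ds x - phis ds y)"
    by (simp add: phi_def algebra_simps)
  then show ?case unfolding Cons.IH by simp
qed auto

lemma abs_phis_diff: "set ds \<subseteq> {1..} \<Longrightarrow> \<bar>phis ds x - phis ds y\<bar> = lam ds * \<bar>x - y\<bar>"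
  using lam_pos[of ds] by (simp add: phis_diff abs_mult power_abs)

lemma phi_0 [simp]: "phi n 0 = t n" by (simp add: phi_def)
lemma phi_1: "n \<ge> 1 \<Longrightarrow> phi n 1 = t (n + 1)" by (simp add: phi_def atom_len_eq)

lemma phi_bounds:
  assumes "n \<ge> 1"
  shows "0 \<le> y \<Longrightarrow> phi n y \<le> t n" "0 < y \<Longrightarrow> phi n y < t n"
    "y \<le> 1 \<Longrightarrow> t (n+1) \<le> phi n y" "y < 1 \<Longrightarrow> t (n+1) < phi n y"
proof -
  have a: "a n > 0" by (rule atom_len_pos[OF assms])
  have e: "phi n y - t (n+1) = a n * (1 - y)" "t n - phi n y = a n * y"
    using atom_len_eq[OF assms] by (auto simp: phi_def algebra_simps)
  show "0 \<le> y \<Longrightarrow> phi n y \<le> t n" "0 < y \<Longrightarrow> phi n y < t n"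
    using e(2) a mult_nonneg_nonneg[of "a n" y] mult_pos_pos[of "a n" y] by linarith+
  show "y \<le> 1 \<Longrightarrow> t (n+1) \<le> phi n y" "y < 1 \<Longrightarrow> t (n+1) < phi n y"
    using e(1) a mult_nonneg_nonneg[of "a n" "1 - y"] mult_pos_pos[of "a n" "1 - y"] by linarith+
qed

lemma phi_mem: "n \<ge> 1 \<Longrightarrow> 0 \<le> y \<Longrightarrow> y < 1 \<Longrightarrow> phi n y \<in> A n"
  using phi_bounds(1,4)[of n y] by (simp add: atom_eq)

lemma phi_unit: "n \<ge> 1 \<Longrightarrow> y \<in> {0..1} \<Longrightarrow> phi n y \<in> {0..1}"
  using phi_bounds[of n y] tail_le_1[of n] tail_pos[of "n+1"] by auto

lemma phis_unit: "set ds \<subseteq> {1..} \<Longrightarrow> y \<in> {0..1} \<Longrightarrow> phis ds y \<in> {0..1}"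
  by (induction ds) (use phi_unit in auto)

lemma phi_unit_open: "n \<ge> 1 \<Longrightarrow> y \<in> {0<..<1} \<Longrightarrow> phi n y \<in> {0<..<1}"
  using phi_bounds[of n y] tail_le_1[of n] tail_pos[of "n+1"] by auto

lemma phis_unit_open: "set ds \<subseteq> {1..} \<Longrightarrow> y \<in> {0<..<1} \<Longrightarrow> phis ds y \<in> {0<..<1}"
  by (induction ds) (use phi_unit_open in auto)

lemma luroth_map_atom:
  assumes "n \<ge> 1" "x \<in> A n"
  shows "L x = (t n - x) / a n" "L x \<in> {0..<1}" "phi n (L x) = x"
proof -
  have "x \<in> {t (n+1)<..t n}" using assms atom_eq by blast
  moreover have "t (n+1) > 0" by (rule tail_pos) simp
  ultimately have x: "t (n+1) < x" "x \<le> t n" "x \<noteq> 0" by auto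
  show *: "L x = (t n - x) / a n"
    using x by (simp add: luroth_map_def atom_index_eq[OF assms])
  have a: "a n > 0" by (rule atom_len_pos[OF assms(1)])
  show "phi n (L x) = x" using a by (simp add: * phi_def)
  have "t n - x < a n" using x atom_len_eq[OF assms(1)] by linarith
  then show "L x \<in> {0..<1}" using x a by (simp add: *)
qed

lemma luroth_map_phi: "n \<ge> 1 \<Longrightarrow> y \<in> {0..<1} \<Longrightarrow> L (phi n y) = y"
  using luroth_map_atom(1)[of n "phi n y"] phi_mem[of n y] atom_len_pos[of n] by (simp add: phi_def)

lemma luroth_map_0 [simp]: "L 0 = 0" by (simp add: luroth_map_def)

lemma funpow_luroth_map_0 [simp]: "(L ^^ k) 0 = 0"
  by (induction k) auto

lemma luroth_map_unit: assumes "x \<in> {0..1}" shows "L x \<in> {0..<1}"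
proof (cases "x = 0")
  case False
  then obtain n where "n \<ge> 1" "x \<in> A n" using atom_cases[of x] assms by auto
  then show ?thesis by (rule luroth_map_atom(2))
qed simp

lemma orbit_unit: assumes "x \<in> {0..1}" shows "(L ^^ k) x \<in> {0..1}"
proof (induction k)
  case (Suc k)
  then show ?case using luroth_map_unit[OF Suc.IH] by simp
qed (use assms in simp)

lemma luroth_map_tail: "n \<ge> 1 \<Longrightarrow> L (t n) = 0"
  using luroth_map_atom(1)[of n "t n"] atom_eq[of n] tail_less[of n] by simp

lemma digit_phi:
  assumes "n \<ge> 1" "y \<in> {0..<1}"
  shows "digit (phi n y) 1 = n" "k \<ge> 1 \<Longrightarrow> digit (phi n y) (Suc k) = digit y k"
    "(L ^^ Suc k) (phi n y) = (L ^^ k) y"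
proof -
  show "digit (phi n y) 1 = n" using assms phi_mem by (auto simp: luroth_digit_def atom_index_eq)
  show *: "(L ^^ Suc k) (phi n y) = (L ^^ k) y" for k
    using luroth_map_phi[OF assms] by (simp only: funpow_Suc_right o_apply)
  assume "k \<ge> 1"
  then show "digit (phi n y) (Suc k) = digit y k"
    using *[of "k - 1"] by (simp add: luroth_digit_def del: funpow.simps)
qed

lemma digit_ge_1: "(L ^^ (k - 1)) x \<in> {0<..1} \<Longrightarrow> digit x k \<ge> 1"
  by (rule atom_cases[of "(L ^^ (k - 1)) x"]) (auto simp: luroth_digit_def atom_index_eq)

text \<open>Interior points go strictly between consecutive tails, so termination is merely shifted.
  The open interval matters: \<open>y = 0\<close> would give the tail \<open>t n\<close>, where the
  expansion ends at once.\<close>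

lemma terminates_phi:
  assumes n: "n \<ge> 1" and y: "y \<in> {0<..<1}"
  shows "\<not> luroth_terminates_at A (phi n y) 1"
    "k \<ge> 1 \<Longrightarrow> luroth_terminates_at A (phi n y) (Suc k) \<longleftrightarrow> luroth_terminates_at A y k"
proof -
  have "phi n y \<noteq> t m" if "m \<ge> 1" for m
  proof
    assume eq: "phi n y = t m"
    have "t (n+1) < phi n y" "phi n y < t n" using phi_bounds[OF n] y by auto
    with eq show False using tail_antimono[of m n] tail_antimono[of "n+1" m] that n
      by (cases "m \<le> n") auto
  qed
  then show "\<not> luroth_terminates_at A (phi n y) 1"
    using phi_unit_open[OF assms] by (auto simp: luroth_terminates_at_def)
  assume k: "k \<ge> 1"
  have "(L ^^ k) (phi n y) = (L ^^ (k - 1)) y"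
    using digit_phi(3)[OF n, of y "k - 1"] k y by (simp del: funpow.simps)
  then show "luroth_terminates_at A (phi n y) (Suc k) \<longleftrightarrow> luroth_terminates_at A y k"
    using k y by (auto simp: luroth_terminates_at_def)
qed

text \<open>A termination index is the last time at which the orbit is positive. This yields
  uniqueness and gives the \<open>THE\<close> in \<open>farey_minkowski\<close> its value.\<close>

lemma terminates_orbit:
  assumes "luroth_terminates_at A x m"
  shows "(L ^^ (m - 1)) x > 0" "(L ^^ m) x = 0"
proof -
  have m: "m \<ge> 1" using assms by (simp add: luroth_terminates_at_def)
  have "(\<exists>n\<ge>2. (L ^^ (m - 1)) x = t n) \<or> (m = 1 \<and> x = 1)"
    using assms unfolding luroth_terminates_at_def by blast
  then have "\<exists>n\<ge>1. (L ^^ (m - 1)) x = t n"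
  proof
    assume "\<exists>n\<ge>2. (L ^^ (m - 1)) x = t n"
    then obtain n where "n \<ge> 2" "(L ^^ (m - 1)) x = t n" by blast
    then show ?thesis by (intro exI[of _ n]) simp
  next
    assume "m = 1 \<and> x = 1"
    then show ?thesis using tail_1 by (intro exI[of _ 1]) simp
  qed
  then obtain n where n: "n \<ge> 1" "(L ^^ (m - 1)) x = t n" by blast
  show "(L ^^ (m - 1)) x > 0" unfolding n(2) by (rule tail_pos[OF n(1)])
  have "(L ^^ m) x = L ((L ^^ (m - 1)) x)" using m by (cases m) auto
  then show "(L ^^ m) x = 0" unfolding n(2) by (simp add: luroth_map_tail[OF n(1)])
qed

lemma orbit_zero_mono:
  assumes "(L ^^ k) x = 0" "k \<le> m" shows "(L ^^ m) x = 0"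
proof -
  have "(L ^^ ((m - k) + k)) x = (L ^^ (m - k)) ((L ^^ k) x)" by (simp only: funpow_add o_apply)
  then show ?thesis using assms by simp
qed

lemma terminates_unique:
  assumes "luroth_terminates_at A x k" "luroth_terminates_at A x m" shows "k = m"
proof -
  have False if "luroth_terminates_at A x k" "luroth_terminates_at A x m" "k < m" for k m
  proof -
    have "k \<le> m - 1" using that(3) by simp
    then have "(L ^^ (m - 1)) x = 0" using orbit_zero_mono terminates_orbit(2)[OF that(1)] by blast
    then show False using terminates_orbit(1)[OF that(2)] by simp
  qed
  then show ?thesis using assms by (metis linorder_neqE_nat)
qed

lemma The_terminates: "luroth_terminates_at A x k \<Longrightarrow> (THE m. luroth_terminates_at A x m) = k"
  using terminates_unique by blast

lemma irrational_orbit: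
  assumes "luroth_irrational A x" shows "(L ^^ k) x \<in> {0<..1}"
proof (induction k)
  case (Suc k)
  obtain n where n: "n \<ge> 1" "(L ^^ k) x \<in> A n" using Suc atom_cases[of "(L ^^ k) x"] by auto
  have "\<not> luroth_terminates_at A x (Suc k)" using assms by (simp add: luroth_irrational_def)
  then have ne: "(L ^^ k) x \<noteq> t n"
  \<comment> \<open>Termination asks for \<open>n \<ge> 2\<close>, so the tail
    \<open>t 1 = 1\<close> is special: only the starting point can equal 1, since \<open>L\<close>
    takes values below 1, and a start at 1 terminates by definition.\<close>
  proof (cases "n = 1")
    case True
    show ?thesis
    proof (cases k)
      case 0
      then show ?thesis using True tail_1 \<open>\<not> luroth_terminates_at A x (Suc k)\<close>
        by (auto simp: luroth_terminates_at_def)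
    next
      case (Suc j)
      have "(L ^^ j) x \<in> {0..1}" using assms by (intro orbit_unit) (auto simp: luroth_irrational_def)
      then show ?thesis using luroth_map_unit[of "(L ^^ j) x"] Suc True tail_1 by auto
    qed
  qed (use n in \<open>auto simp: luroth_terminates_at_def\<close>)
  have "L ((L ^^ k) x) = (t n - (L ^^ k) x) / a n" using luroth_map_atom(1)[OF n] .
  moreover have "(L ^^ k) x < t n" using n atom_eq[of n] ne by auto
  ultimately show ?case using luroth_map_atom(2)[OF n] atom_len_pos[OF n(1)] by auto
qed (use assms in \<open>simp add: luroth_irrational_def\<close>)

lemma irrational_digit_ge_1: "luroth_irrational A x \<Longrightarrow> digit x k \<ge> 1"
  using irrational_orbit digit_ge_1 by blast

section \<open>The Farey--Minkowski function\<close>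

text \<open>Serves both cases of \<open>farey_minkowski\<close>: exact at the termination index,
  convergent to the value for irrational points.\<close>

definition fm_trunc :: "(nat \<Rightarrow> nat) \<Rightarrow> nat \<Rightarrow> real" where
  "fm_trunc d m = - 2 * (\<Sum>k = 1..m. (-1) ^ k * (1/2) ^ (\<Sum>i = 1..k. d i))"

lemma sum_1_Suc: "(\<Sum>k = 1..Suc m. f k) = f 1 + (\<Sum>k = 1..m. f (Suc k))"
  for f :: "nat \<Rightarrow> 'b::comm_monoid_add"
  by (induction m) (auto simp: add_ac)

lemma fm_trunc_0 [simp]: "fm_trunc d 0 = 0"
  by (simp add: fm_trunc_def)

text \<open>The finite form of the functional equation \<open>theta_phi\<close>: the first digit is
  split off, and the remaining signs flip.\<close>

lemma fm_trunc_Suc: "fm_trunc d (Suc m) = (1/2) ^ d 1 * (2 - fm_trunc (\<lambda>i. d (Suc i)) m)"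
proof -
  have "(\<Sum>k = 1..m. (-1) ^ Suc k * (1/2) ^ (\<Sum>i = 1..Suc k. d i)) =
    - ((1/2) ^ d 1) * (\<Sum>k = 1..m. (-1) ^ k * (1/2::real) ^ (\<Sum>i = 1..k. d (Suc i)))"
    unfolding sum_distrib_left
    by (intro sum.cong refl) (subst sum_1_Suc, simp add: power_add)
  then show ?thesis unfolding fm_trunc_def
    by (subst sum_1_Suc) (simp add: algebra_simps)
qed

lemma fm_trunc_cong: "(\<And>i. 1 \<le> i \<Longrightarrow> i \<le> m \<Longrightarrow> d i = d' i) \<Longrightarrow> fm_trunc d m = fm_trunc d' m"
  unfolding fm_trunc_def by (intro arg_cong2[where f="(*)"] sum.cong refl arg_cong2[where f="(^)"]) auto

lemma fm_trunc_unit: "(\<And>i. 1 \<le> i \<Longrightarrow> i \<le> m \<Longrightarrow> d i \<ge> 1) \<Longrightarrow> fm_trunc d m \<in> {0..1}"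
proof (induction m arbitrary: d)
  case (Suc m)
  have IH: "fm_trunc (\<lambda>i. d (Suc i)) m \<in> {0..1}" by (rule Suc.IH) (use Suc.prems in auto)
  have "(1/2::real) ^ d 1 \<le> (1/2) ^ 1" using Suc.prems[of 1] by (intro power_decreasing) auto
  then have "(1/2::real) ^ d 1 * (2 - fm_trunc (\<lambda>i. d (Suc i)) m) \<le> (1/2) ^ 1 * 2"
    using IH by (intro mult_mono) auto
  then show ?case using IH unfolding fm_trunc_Suc by auto
qed simp

lemma theta_0 [simp]: "\<theta> 0 = 0"
  by (simp add: farey_minkowski_def)

lemma theta_terminating:
  assumes "luroth_terminates_at A x m" "x \<noteq> 0"
  shows "\<theta> x = fm_trunc (digit x) m"
proof -
  have "\<not> luroth_irrational A x" using assms by (auto simp: luroth_irrational_def)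
  then show ?thesis
    using assms by (simp add: farey_minkowski_def The_terminates[OF assms(1)] fm_trunc_def farey_minkowski_term_def)
qed

lemma theta_irrational:
  assumes "luroth_irrational A x"
  shows "(\<lambda>m. fm_trunc (digit x) m) \<longlonglongrightarrow> \<theta> x"
proof -
  have x0: "x \<noteq> 0" using assms by (auto simp: luroth_irrational_def)
  have bound: "norm (farey_minkowski_term A x (Suc k)) \<le> (1/2) ^ k" for k
  proof -
    have "(\<Sum>i = 1..Suc k. digit x i) \<ge> (\<Sum>i = 1..Suc k. 1)"
      using irrational_digit_ge_1[OF assms] by (intro sum_mono)
    then have "(\<Sum>i = 1..Suc k. digit x i) \<ge> k" by simp
    then have "(1/2::real) ^ (\<Sum>i = 1..Suc k. digit x i) \<le> (1/2) ^ k"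
      by (intro power_decreasing) auto
    then show ?thesis by (simp add: farey_minkowski_term_def abs_mult power_abs)
  qed
  have geom: "summable (\<lambda>k. (1/2::real) ^ k)" by (rule summable_geometric) simp
  have "summable (\<lambda>k. farey_minkowski_term A x (Suc k))"
    by (rule summable_comparison_test'[OF geom bound])
  then have "(\<lambda>m. - 2 * (\<Sum>k<m. farey_minkowski_term A x (Suc k))) \<longlonglongrightarrow> - 2 * (\<Sum>k. farey_minkowski_term A x (Suc k))"
    by (intro tendsto_intros summable_LIMSEQ)
  moreover have "- 2 * (\<Sum>k<m. farey_minkowski_term A x (Suc k)) = fm_trunc (digit x) m" for m
    unfolding fm_trunc_def farey_minkowski_term_def by (simp add: sum.atLeast1_atMost_eq)
  ultimately show ?thesis using assms x0 by (simp add: farey_minkowski_def)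
qed

lemma theta_tail: assumes "n \<ge> 1" shows "\<theta> (t n) = 2 * (1/2) ^ n"
proof -
  have "luroth_terminates_at A (t n) 1"
  proof (cases "n = 1")
    case True
    then show ?thesis using tail_1 by (simp add: luroth_terminates_at_def)
  next
    case False
    then have "n \<ge> 2" using assms by simp
    then show ?thesis unfolding luroth_terminates_at_def by auto
  qed
  then have "\<theta> (t n) = fm_trunc (digit (t n)) (Suc 0)"
    using tail_pos[OF assms] by (subst theta_terminating[of "t n" 1]) auto
  also have "\<dots> = 2 * (1/2) ^ n"
    using digit_phi(1)[OF assms, of 0] by (simp add: fm_trunc_Suc)
  finally show ?thesis .
qed

text \<open>\<open>\<theta>\<close> carries \<open>phi n\<close> to the branch
  \<open>2 * (1/2)^n - (1/2)^n * y\<close> of the dyadic Lueroth map. At \<open>y = 1\<close> this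
  reconciles the two expansions of \<open>t (n+1)\<close>.\<close>

lemma theta_phi:
  assumes n: "n \<ge> 1" and y: "y \<in> {0..1}"
  shows "\<theta> (phi n y) = (1/2) ^ n * (2 - \<theta> y)"
proof -
  consider "y = 0" | "y = 1" | "y \<in> {0<..<1}" using y by fastforce
  then show ?thesis
  proof cases
    case 1
    then show ?thesis using theta_tail[OF n] by simp
  next
    case 2
    then show ?thesis using theta_tail[of "n+1"] theta_tail[of 1] tail_1 n by (simp add: phi_1)
  next
    case 3
    let ?x = "phi n y"
    have x: "?x \<in> {0<..<1}" by (rule phi_unit_open[OF n 3])
    have dx: "fm_trunc (digit ?x) (Suc m) = (1/2) ^ n * (2 - fm_trunc (digit y) m)" for m
    proof -
      have "digit ?x 1 = n" by (rule digit_phi(1)[OF n]) (use 3 in auto)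
      moreover have "fm_trunc (\<lambda>i. digit ?x (Suc i)) m = fm_trunc (digit y) m"
        by (rule fm_trunc_cong, rule digit_phi(2)[OF n]) (use 3 in auto)
      ultimately show ?thesis by (simp add: fm_trunc_Suc)
    qed
    show ?thesis
    proof (cases "luroth_irrational A y")
      case True
      have "\<not> luroth_terminates_at A ?x k" for k
      proof (cases "k \<ge> 2")
        case k: True
        then obtain j where "k = Suc j" "j \<ge> 1" by (cases k) auto
        then show ?thesis using terminates_phi(2)[OF n 3, of j] True by (simp add: luroth_irrational_def)
      next
        case False
        then have "k = 0 \<or> k = 1" by linarith
        then show ?thesis using terminates_phi(1)[OF n 3] by (auto simp: luroth_terminates_at_def)
      qed
      then have "luroth_irrational A ?x" using x by (simp add: luroth_irrational_def)
      then have "(\<lambda>m. fm_trunc (digit ?x) (Suc m)) \<longlonglongrightarrow> \<theta> ?x"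
        by (intro LIMSEQ_Suc theta_irrational)
      moreover have "(\<lambda>m. fm_trunc (digit ?x) (Suc m)) \<longlonglongrightarrow> (1/2) ^ n * (2 - \<theta> y)"
        unfolding dx by (intro tendsto_intros theta_irrational[OF True])
      ultimately show ?thesis by (rule LIMSEQ_unique)
    next
      case False
      then obtain k where k: "luroth_terminates_at A y k" using 3 by (auto simp: luroth_irrational_def)
      then have k1: "k \<ge> 1" by (simp add: luroth_terminates_at_def)
      have "luroth_terminates_at A ?x (Suc k)" using terminates_phi(2)[OF n 3 k1] k by simp
      then show ?thesis using theta_terminating[of ?x "Suc k"] theta_terminating[OF k] dx x 3 by auto
    qed
  qed
qed

lemma theta_unit: assumes "x \<in> {0..1}" shows "\<theta> x \<in> {0..1}"
proof (cases "x = 0")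
  case False
  then have x: "x \<in> {0<..1}" using assms by auto
  show ?thesis
  proof (cases "luroth_irrational A x")
    case True
    have *: "fm_trunc (digit x) m \<in> {0..1}" for m
      using irrational_digit_ge_1[OF True] by (intro fm_trunc_unit)
    show ?thesis
      by (rule closed_sequentially[OF closed_real_atLeastAtMost _ theta_irrational[OF True]])
         (use * in auto)
  next
    case False
    then obtain m where m: "luroth_terminates_at A x m" using x by (auto simp: luroth_irrational_def)
    have "digit x i \<ge> 1" if "1 \<le> i" "i \<le> m" for i
    proof (rule digit_ge_1)
      have "(L ^^ (i - 1)) x \<noteq> 0"
      proof
        assume "(L ^^ (i - 1)) x = 0"
        moreover have "i - 1 \<le> m - 1" using that by simp
        ultimately have "(L ^^ (m - 1)) x = 0" by (rule orbit_zero_mono)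
        then show False using terminates_orbit(1)[OF m] by simp
      qed
      then show "(L ^^ (i - 1)) x \<in> {0<..1}" using orbit_unit[OF assms, of "i - 1"] by auto
    qed
    then have "fm_trunc (digit x) m \<in> {0..1}" by (rule fm_trunc_unit)
    then show ?thesis using theta_terminating[OF m] x by simp
  qed
qed simp

lemma theta_phis_diff:
  assumes "set ds \<subseteq> {1..}" "y \<in> {0..1}" "z \<in> {0..1}"
  shows "\<theta> (phis ds y) - \<theta> (phis ds z) = (-1) ^ length ds * (1/2) ^ sum_list ds * (\<theta> y - \<theta> z)"
  using assms(1)
proof (induction ds)
  case (Cons n ds)
  have "\<theta> (phis (n # ds) y) - \<theta> (phis (n # ds) z) = - ((1/2) ^ n) * (\<theta> (phis ds y) - \<theta> (phis ds z))"
    using Cons.prems assms phis_unit[of ds] by (simp add: theta_phi algebra_simps)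
  also have "\<theta> (phis ds y) - \<theta> (phis ds z) = (-1) ^ length ds * (1/2) ^ sum_list ds * (\<theta> y - \<theta> z)"
    by (rule Cons.IH) (use Cons.prems in auto)
  finally show ?case by (simp add: power_add)
qed simp

lemma theta_atom:
  assumes "n \<ge> 1" "x \<in> A n"
  shows "\<theta> x = (1/2) ^ n * (2 - \<theta> (L x))" "(1/2) ^ n \<le> \<theta> x" "\<theta> x \<le> 2 * (1/2) ^ n"
proof -
  have u: "L x \<in> {0..1}" using luroth_map_atom(2)[OF assms] by auto
  show *: "\<theta> x = (1/2) ^ n * (2 - \<theta> (L x))"
    using theta_phi[OF assms(1) u] luroth_map_atom(3)[OF assms] by simp
  show "(1/2) ^ n \<le> \<theta> x" "\<theta> x \<le> 2 * (1/2) ^ n"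
    using theta_unit[OF u] unfolding * by auto
qed

text \<open>Stands in for monotonicity of \<open>\<theta>\<close> at the cut point, as
  \<open>(1/2)^n = \<theta> (t (n+1))\<close>: positive points up to the cut lie in later
  atoms.\<close>

lemma theta_below_tail:
  assumes n: "n \<ge> 1" and y: "0 \<le> y" "y \<le> t (n+1)"
  shows "\<theta> y \<le> (1/2) ^ n"
proof (cases "y = 0")
  case False
  have "y \<le> 1" using y tail_le_1[of "n+1"] by simp
  then obtain m where m: "m \<ge> 1" "y \<in> A m" using atom_cases[of y] False y by auto
  have "m \<ge> n + 1"
  proof (rule ccontr)
    assume "\<not> ?thesis"
    then have "t (n + 1) \<le> t (m + 1)" by (intro tail_antimono) auto
    then show False using m atom_eq[OF m(1)] y by auto
  qed
  then have "(1/2::real) ^ m \<le> (1/2) ^ (n + 1)" by (intro power_decreasing) auto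
  then show ?thesis using theta_atom(3)[OF m] by simp
qed simp

text \<open>Strip common digits. Each step expands the distance by at least
  \<open>1/\<kappa>\<close>, so the process stops, and it stops at a pair separated by a tail. The
  point 0, which lies in no atom, is separated from any other point in this way at once.\<close>

lemma separating_word:
  assumes "x \<in> {0..1}" "y \<in> {0..1}" "x \<noteq> y"
  obtains ds x' y' n where "set ds \<subseteq> {1..}" "x = phis ds x'" "y = phis ds y'"
    "x' = (L ^^ length ds) x" "ds = map (digit x) [1..<length ds + 1]" "n \<ge> 1"
    "(x' \<in> A n \<and> y' \<in> {0..t (n+1)}) \<or> (y' \<in> A n \<and> x' \<in> {0..t (n+1)})"
proof -
  define R where "R = (\<lambda>x y ds x' y' n. set ds \<subseteq> {1..} \<and> x = phis ds x' \<and> y = phis ds y' \<and>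
    x' = (L ^^ length ds) x \<and> ds = map (digit x) [1..<length ds + 1] \<and> n \<ge> 1 \<and>
    ((x' \<in> A n \<and> y' \<in> {0..t (n+1)}) \<or> (y' \<in> A n \<and> x' \<in> {0..t (n+1)})))"
  \<comment> \<open>Induction on the number of strippings that the distance leaves room for; with
    \<open>N = 0\<close> the distance would exceed 1.\<close>
  have main: "\<exists>ds x' y' n. R x y ds x' y' n"
    if "x \<in> {0..1}" "y \<in> {0..1}" "\<kappa> ^ N < \<bar>x - y\<bar>" for N x y
    using that
  proof (induction N arbitrary: x y)
    case (Suc N)
    have base: "\<exists>ds x' y' n. R x y ds x' y' n"
      if "n \<ge> 1" "(x \<in> A n \<and> y \<in> {0..t (n+1)}) \<or> (y \<in> A n \<and> x \<in> {0..t (n+1)})" for n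
      unfolding R_def using that by (intro exI[of _ "[]"] exI[of _ x] exI[of _ y] exI[of _ n]) auto
    have "0 < \<kappa> ^ Suc N" using \<kappa>(1) by (rule zero_less_power)
    then have ne: "x \<noteq> y" using Suc.prems(3) by auto
    consider "x = 0" | "y = 0" | "x \<in> {0<..1}" "y \<in> {0<..1}" using Suc.prems by fastforce
    then show ?case
    proof cases
      case 1
      then obtain n where "n \<ge> 1" "y \<in> A n" using ne Suc.prems atom_cases[of y] by auto
      then show ?thesis using 1 tail_pos[of "n+1"] by (intro base) auto
    next
      case 2
      then obtain n where "n \<ge> 1" "x \<in> A n" using ne Suc.prems atom_cases[of x] by auto
      then show ?thesis using 2 tail_pos[of "n+1"] by (intro base) auto
    next
      case 3
      obtain n where n: "n \<ge> 1" "x \<in> A n" using 3(1) atom_cases[of x] by auto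
      obtain m where m: "m \<ge> 1" "y \<in> A m" using 3(2) atom_cases[of y] by auto
      note nm = n m
      have xy: "x \<le> t n" "y \<le> t m" using nm by (auto simp: atom_eq)
      consider "n < m" | "m < n" | "n = m" by linarith
      then show ?thesis
      proof cases
        case 1
        then have "t m \<le> t (n+1)" by (intro tail_antimono) auto
        then show ?thesis using nm 3 xy by (intro base[of n]) auto
      next
        case 2
        then have "t n \<le> t (m+1)" by (intro tail_antimono) auto
        then show ?thesis using nm 3 xy by (intro base[of m]) auto
      next
        case eq: 3
        have x: "phi n (L x) = x" "L x \<in> {0..<1}" using luroth_map_atom[OF nm(1,2)] by auto
        have y: "phi n (L y) = y" "L y \<in> {0..<1}" using luroth_map_atom[OF nm(3,4)] eq by auto
        have "x - y = phis [n] (L x) - phis [n] (L y)" using x y by simp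
        then have "\<bar>x - y\<bar> = a n * \<bar>L x - L y\<bar>" using abs_phis_diff[of "[n]"] nm(1) by simp
        also have "\<dots> \<le> \<kappa> * \<bar>L x - L y\<bar>" using \<kappa>(3)[OF nm(1)] by (intro mult_right_mono) auto
        finally have "\<kappa> * \<kappa> ^ N < \<kappa> * \<bar>L x - L y\<bar>" using Suc.prems(3) by simp
        then have "\<kappa> ^ N < \<bar>L x - L y\<bar>" using \<kappa>(1) by (simp only: mult_less_cancel_left_pos)
        then obtain ds x' y' k where R: "R (L x) (L y) ds x' y' k"
          using Suc.IH[of "L x" "L y"] x(2) y(2) by fastforce
        have dig: "map (digit x) [1..<length (n # ds) + 1] = n # map (digit (L x)) [1..<length ds + 1]"
        proof -
          have d1: "digit x 1 = n" using digit_phi(1)[OF nm(1) x(2)] x(1) by simp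
          have d2: "digit x (Suc k) = digit (L x) k" if "k \<ge> 1" for k
            using digit_phi(2)[OF nm(1) x(2) that] x(1) by simp
          have "[1..<length (n # ds) + 1] = 1 # map Suc [1..<length ds + 1]"
            by (simp add: map_Suc_upt upt_conv_Cons del: upt_Suc)
          then have "map (digit x) [1..<length (n # ds) + 1] = digit x 1 # map (\<lambda>k. digit x (Suc k)) [1..<length ds + 1]"
            by (simp only: list.map map_map o_def)
          also have "map (\<lambda>k. digit x (Suc k)) [1..<length ds + 1] = map (digit (L x)) [1..<length ds + 1]"
            by (intro map_cong refl d2) (simp del: upt_Suc)
          finally show ?thesis unfolding d1 .
        qed
        have "R x y (n # ds) x' y' k"
          unfolding R_def
        proof (intro conjI)
          have Rs: "set ds \<subseteq> {1..}" "L x = phis ds x'" "L y = phis ds y'" "x' = (L ^^ length ds) (L x)"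
            "ds = map (digit (L x)) [1..<length ds + 1]" "k \<ge> 1"
            "(x' \<in> A k \<and> y' \<in> {0..t (k+1)}) \<or> (y' \<in> A k \<and> x' \<in> {0..t (k+1)})"
            using R unfolding R_def by blast+
          show "set (n # ds) \<subseteq> {1..}" using Rs(1) nm(1) by simp
          show "x = phis (n # ds) x'" "y = phis (n # ds) y'"
            using x(1) y(1) unfolding phis_simps(2) Rs(2)[symmetric] Rs(3)[symmetric] by simp_all
          show "x' = (L ^^ length (n # ds)) x"
            using digit_phi(3)[OF nm(1) x(2), of "length ds"] Rs(4) x(1) by (simp del: funpow.simps)
          show "n # ds = map (digit x) [1..<length (n # ds) + 1]"
            unfolding dig Rs(5)[symmetric] ..
          show "k \<ge> 1" by (rule Rs(6))
          show "(x' \<in> A k \<and> y' \<in> {0..t (k+1)}) \<or> (y' \<in> A k \<and> x' \<in> {0..t (k+1)})" by (rule Rs(7))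
        qed
        then show ?thesis by blast
      qed
    qed
  qed auto
  have "(\<lambda>N. \<kappa> ^ N) \<longlonglongrightarrow> 0" using \<kappa> by (intro LIMSEQ_power_zero) auto
  then have "\<forall>\<^sub>F N in sequentially. \<kappa> ^ N < \<bar>x - y\<bar>" using assms(3) by (auto intro: order_tendstoD)
  then obtain N where "\<kappa> ^ N < \<bar>x - y\<bar>" by (auto simp: eventually_sequentially)
  then obtain ds x' y' n where "R x y ds x' y' n" using main assms by blast
  then show ?thesis unfolding R_def using that by blast
qed

section \<open>The upper bound\<close>

definition pressure_term :: "real \<Rightarrow> real \<Rightarrow> nat \<Rightarrow> real" where
  "pressure_term u q n = a n powr u * ((1/2) ^ n) powr q"

text \<open>\<open>u \<ge> 0\<close> and \<open>q > 0\<close> make the series converge, so that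
  \<open>suminf\<close> has its intended value.\<close>

definition feasible :: "real \<Rightarrow> real \<Rightarrow> bool" where
  "feasible u q \<longleftrightarrow> 0 \<le> u \<and> 0 < q \<and> (\<Sum>k. pressure_term u q (Suc k)) < 1"

lemma pressure_term_nonneg: "pressure_term u q n \<ge> 0"
  by (simp add: pressure_term_def)

lemma half_powr_power: "((1/2::real) ^ n) powr q = ((1/2) powr q) ^ n"
  by (simp add: powr_realpow[symmetric] powr_powr mult.commute)

lemma half_powr_less_1: "q > 0 \<Longrightarrow> (1/2::real) powr q < 1"
  using powr_less_mono'[of "1/2::real" 0 q] by simp

lemma summable_pressure_term:
  assumes "0 \<le> u" "0 < q" shows "summable (\<lambda>k. pressure_term u q (Suc k))"
proof (rule summable_comparison_test')
  show "summable (\<lambda>k. ((1/2) powr q) ^ Suc k)"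
    using half_powr_less_1[OF assms(2)] by (subst summable_Suc_iff) (auto intro: summable_geometric)
  fix k :: nat assume "k \<ge> 0"
  have "a (Suc k) powr u \<le> 1"
    using atom_len_pos[of "Suc k"] atom_len_less_1[of "Suc k"] assms by (intro powr_le1) auto
  then show "norm (pressure_term u q (Suc k)) \<le> ((1/2) powr q) ^ Suc k"
    by (simp add: pressure_term_def half_powr_power mult_left_le_one_le del: power_Suc)
qed

lemma prod_list_pressure_term:
  "set ds \<subseteq> {1..} \<Longrightarrow> prod_list (map (pressure_term u q) ds) = lam ds powr u * ((1/2) ^ sum_list ds) powr q"
proof (induction ds)
  case (Cons n ds)
  then show ?case using atom_len_pos[of n] lam_pos[of ds]
    by (simp add: pressure_term_def powr_mult power_add)
qed simp

text \<open>The second family also carries the cut index \<open>n\<close>, which costs only the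
  factor of a geometric series in \<open>(1/2) powr q\<close>.\<close>

lemma summable_on_weights:
  assumes "feasible u q"
  shows "(\<lambda>ds. lam ds powr u * ((1/2) ^ sum_list ds) powr q) summable_on {ds. set ds \<subseteq> {1..}}"
    (is ?A)
    "(\<lambda>(ds, n). lam ds powr u * ((1/2) ^ (sum_list ds + n)) powr q) summable_on {ds. set ds \<subseteq> {1..}} \<times> {1..}"
proof -
  have uq: "0 \<le> u" "0 < q" "(\<Sum>k. pressure_term u q (Suc k)) < 1" using assms by (auto simp: feasible_def)
  have "(\<lambda>ds. prod_list (map (pressure_term u q) ds)) summable_on {ds. set ds \<subseteq> {1..}}"
    by (rule summable_on_words) (use uq summable_pressure_term pressure_term_nonneg in auto)
  then show A: ?A
    by (rule summable_on_cong[THEN iffD1, rotated]) (auto simp: prod_list_pressure_term)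
  let ?c = "(1/2::real) powr q"
  have c: "?c < 1" using half_powr_less_1 uq by auto
  have "((\<lambda>n. ?c ^ n) summable_on (UNIV :: nat set))"
    using c by (subst summable_on_UNIV_nonneg_real_iff) (auto intro: summable_geometric)
  then have "(\<lambda>n. ?c ^ n) summable_on {1..}" by (rule summable_on_subset_banach) auto
  then have hs: "((\<lambda>n. ?c ^ n) has_sum infsum (\<lambda>n. ?c ^ n) {1..}) {1..}" by (rule has_sum_infsum)
  show "(\<lambda>(ds, n). lam ds powr u * ((1/2) ^ (sum_list ds + n)) powr q) summable_on {ds. set ds \<subseteq> {1..}} \<times> {1..}"
  proof (rule summable_on_SigmaI)
    fix ds :: "nat list"
    have "((\<lambda>n. (lam ds powr u * ((1/2) ^ sum_list ds) powr q) * ?c ^ n) has_sum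
        (lam ds powr u * ((1/2) ^ sum_list ds) powr q) * infsum (\<lambda>n. ?c ^ n) {1..}) {1..}"
      by (rule has_sum_cmult_right[OF hs])
    then show "((\<lambda>n. case (ds, n) of (ds, n) \<Rightarrow> lam ds powr u * ((1/2) ^ (sum_list ds + n)) powr q) has_sum
        (lam ds powr u * ((1/2) ^ sum_list ds) powr q) * infsum (\<lambda>n. ?c ^ n) {1..}) {1..}"
      by (simp add: power_add powr_mult half_powr_power mult_ac)
  next
    show "(\<lambda>ds. (lam ds powr u * ((1/2) ^ sum_list ds) powr q) * infsum (\<lambda>n. ?c ^ n) {1..})
        summable_on {ds. set ds \<subseteq> {1..}}"
      by (rule summable_on_cmult_left[OF A])
  qed auto
qed

text \<open>The pair \<open>(ds, n)\<close> stands for the Farey word of \<open>ds\<close> followed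
  by \<open>n - 1\<close> zeros: its cut point is \<open>phis ds (t (n+1))\<close>, its length
  \<open>lam ds * t n\<close>, and its image under \<open>\<theta>\<close> has length
  \<open>2 * (1/2) ^ (sum_list ds + n)\<close>. The factor \<open>t n\<close> is dropped from the
  length.\<close>

lemma separating_word_bounds:
  assumes "x \<in> {0..1}" "y \<in> {0..1}" "x \<noteq> y"
  obtains ds n where "set ds \<subseteq> {1..}" "n \<ge> 1" "\<bar>x - phis ds (t (n+1))\<bar> \<le> \<bar>x - y\<bar>"
    "\<bar>x - phis ds (t (n+1))\<bar> \<le> lam ds" "\<bar>\<theta> x - \<theta> y\<bar> \<le> 2 * (1/2) ^ (sum_list ds + n)"
proof -
  obtain ds x' y' n where *: "set ds \<subseteq> {1..}" "x = phis ds x'" "y = phis ds y'" "n \<ge> 1"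
    "(x' \<in> A n \<and> y' \<in> {0..t (n+1)}) \<or> (y' \<in> A n \<and> x' \<in> {0..t (n+1)})"
    using separating_word[OF assms] by metis
  define z where "z = t (n+1)"
  have z: "0 < z" "z < t n" "t n \<le> 1"
    using tail_pos[of "n+1"] tail_less[OF *(4)] tail_le_1[OF *(4)] by (auto simp: z_def)
  have b: "(z < x' \<and> x' \<le> t n \<and> 0 \<le> y' \<and> y' \<le> z) \<or> (z < y' \<and> y' \<le> t n \<and> 0 \<le> x' \<and> x' \<le> z)"
    using *(5) atom_eq[OF *(4)] by (auto simp: z_def)
  have th: "\<theta> w \<in> {0..2 * (1/2) ^ n}" if "w \<in> A n \<or> w \<in> {0..z}" for w
  proof (cases "w \<in> A n")
    case True
    then have "(1/2) ^ n \<le> \<theta> w" "\<theta> w \<le> 2 * (1/2) ^ n" using theta_atom[OF *(4)] by auto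
    moreover have "(1/2::real) ^ n \<ge> 0" by simp
    ultimately have "0 \<le> \<theta> w" "\<theta> w \<le> 2 * (1/2) ^ n" by linarith+
    then show ?thesis by simp
  next
    case False
    then have w: "w \<in> {0..z}" using that by auto
    then have "\<theta> w \<le> (1/2) ^ n" using theta_below_tail[OF *(4), of w] by (simp add: z_def)
    moreover have "(1/2::real) ^ n \<ge> 0" by simp
    moreover have "\<theta> w \<in> {0..1}" using w z by (intro theta_unit) auto
    ultimately have "0 \<le> \<theta> w" "\<theta> w \<le> 2 * (1/2) ^ n" by auto
    then show ?thesis by simp
  qed
  have u: "x' \<in> {0..1}" "y' \<in> {0..1}" using b z by auto
  have l: "lam ds > 0" using lam_pos *(1) by auto
  have 1: "\<bar>x - phis ds z\<bar> = lam ds * \<bar>x' - z\<bar>" unfolding *(2) by (rule abs_phis_diff[OF *(1)])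
  have 2: "\<bar>x - y\<bar> = lam ds * \<bar>x' - y'\<bar>" unfolding *(2,3) by (rule abs_phis_diff[OF *(1)])
  have 3: "\<bar>\<theta> x - \<theta> y\<bar> = (1/2) ^ sum_list ds * \<bar>\<theta> x' - \<theta> y'\<bar>"
    unfolding *(2,3) theta_phis_diff[OF *(1) u] by (simp add: abs_mult power_abs)
  have 4: "\<bar>\<theta> x' - \<theta> y'\<bar> \<le> 2 * (1/2) ^ n"
  proof -
    have "x' \<in> A n \<or> x' \<in> {0..z}" "y' \<in> A n \<or> y' \<in> {0..z}" using *(5) unfolding z_def by blast+
    then have "\<theta> x' \<in> {0..2 * (1/2) ^ n}" "\<theta> y' \<in> {0..2 * (1/2) ^ n}" using th by blast+
    then show ?thesis by (simp add: abs_le_iff)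
  qed
  show ?thesis
  proof (rule that[OF *(1,4)])
    show "\<bar>x - phis ds (t (n+1))\<bar> \<le> \<bar>x - y\<bar>"
      using 1 2 l b by (auto simp: z_def)
    have "\<bar>x' - z\<bar> \<le> 1" using b z by auto
    then show "\<bar>x - phis ds (t (n+1))\<bar> \<le> lam ds" using 1 l by (simp add: z_def mult_left_le)
    show "\<bar>\<theta> x - \<theta> y\<bar> \<le> 2 * (1/2) ^ (sum_list ds + n)"
      using 3 mult_left_mono[OF 4, of "(1/2) ^ sum_list ds"] by (simp add: power_add mult_ac)
  qed
qed

lemma hausdorff_measure_non_Theta_zero:
  assumes "feasible u q"
  shows "hausdorff_measure (u + q) ({0..1} - Theta_zero A) = 0"
proof -
  have uq: "0 \<le> u" "0 < q" using assms by (auto simp: feasible_def)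
  define I where "I = {ds. set ds \<subseteq> {1::nat..}} \<times> {1::nat..}"
  define z where "z = (\<lambda>(ds, n). phis ds (t (n+1)))"
  define r where "r = (\<lambda>(ds, n). min (lam ds) ((1/2) ^ (sum_list ds + n)))"
  \<comment> \<open>The index 0 is reserved for the cut points themselves, a countable set, where
    distances to cut points say nothing. For \<open>K > 0\<close> the index bounds these distances
    in units of \<open>r\<close>.\<close>
  define F where "F = (\<lambda>K::nat. if K = 0 then z ` I else {x. infinite {i\<in>I. x \<in> cball (z i) (real K * r i)}})"
  have r0: "r i \<ge> 0" if "i \<in> I" for i using that lam_pos by (auto simp: r_def I_def less_imp_le)
  have cI: "countable I" by (rule countableI_type)
  have iI: "infinite I"
  proof
    assume "finite I"
    then have "finite (snd ` I)" by simp
    moreover have "snd ` I = {1::nat..}" by (force simp: I_def image_iff intro: exI[of _ "[]"])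
    ultimately show False using infinite_Ici[of "1::nat"] by simp
  qed
  have rs: "(\<lambda>i. r i powr (u + q)) summable_on I"
  proof (rule summable_on_comparison_test)
    show "(\<lambda>(ds, n). lam ds powr u * ((1/2) ^ (sum_list ds + n)) powr q) summable_on I"
      unfolding I_def by (rule summable_on_weights(2)[OF assms])
    fix i assume i: "i \<in> I"
    obtain ds n where dn: "i = (ds, n)" by force
    have l: "lam ds > 0" using i lam_pos by (auto simp: dn I_def)
    have "r i powr (u + q) = r i powr u * r i powr q" by (rule powr_add)
    also have "\<dots> \<le> lam ds powr u * ((1/2) ^ (sum_list ds + n)) powr q"
      using uq l r0[OF i] by (intro mult_mono powr_mono2) (auto simp: r_def dn)
    finally show "r i powr (u + q) \<le> (case i of (ds, n) \<Rightarrow> lam ds powr u * ((1/2) ^ (sum_list ds + n)) powr q)"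
      by (simp add: dn)
  qed simp
  have "hausdorff_measure (u + q) (F K) = 0" for K
  proof (cases "K = 0")
    case True
    then show ?thesis using uq cI by (simp add: F_def hausdorff_measure_countable)
  next
    case False
    show ?thesis
    proof (rule hausdorff_measure_limsup_zero_countable[of "u + q" I "\<lambda>i. cball (z i) (real K * r i)" "\<lambda>i. 2 * real K * r i"])
      show "diameter (cball (z i) (real K * r i)) \<le> 2 * real K * r i" if "i \<in> I" for i
        using r0[OF that] by (simp add: mult_ac)
      have "(\<lambda>i. (2 * real K) powr (u + q) * r i powr (u + q)) summable_on I"
        by (rule summable_on_cmult_right[OF rs])
      then show "(\<lambda>i. (2 * real K * r i) powr (u + q)) summable_on I"
        by (simp add: powr_mult)
      show "infinite {i \<in> I. x \<in> cball (z i) (real K * r i)}" if "x \<in> F K" for x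
        using that False by (simp add: F_def)
    qed (use uq cI iI in auto)
  qed
  then show ?thesis
  proof (rule hausdorff_measure_countable_Union)
    show "{0..1} - Theta_zero A \<subseteq> (\<Union>K. F K)"
    proof
      fix x assume x: "x \<in> {0..1} - Theta_zero A"
      show "x \<in> (\<Union>K. F K)"
      proof (cases "x \<in> z ` I")
        case True
        then have "x \<in> F 0" by (simp add: F_def)
        then show ?thesis by blast
      next
        case xz: False
        let ?Q = "\<lambda>y. (\<theta> y - \<theta> x) / (y - x)"
        have "\<not> (?Q \<longlongrightarrow> 0) (at x within {0..1})"
          using x by (auto simp: Theta_zero_def has_field_derivative_iff)
        then obtain e where e: "e > 0" "\<not> (\<forall>\<^sub>F y in at x within {0..1}. \<bar>?Q y\<bar> < e)"
          unfolding tendsto_iff by (auto simp: dist_real_def)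
        \<comment> \<open>\<open>K \<ge> 2 / e\<close> turns a quotient of size at least
          \<open>e\<close> into the bound by the level, \<open>K \<ge> 1\<close> covers the bound by
          \<open>lam ds\<close>, and \<open>Suc\<close> avoids the reserved index 0.\<close>
        define K where "K = Suc (nat \<lceil>2 / e\<rceil>)"
        have K: "real K \<ge> 2 / e" "real K \<ge> 1" by (auto simp: K_def) linarith
        have "infinite {i\<in>I. x \<in> cball (z i) (real K * r i)}"
        proof
          assume fin: "finite {i\<in>I. x \<in> cball (z i) (real K * r i)}" (is "finite ?W")
          \<comment> \<open>If only finitely many cut points were this close, \<open>y\<close> could
            be taken nearer to \<open>x\<close> than all of them. But the cut point that separates
            \<open>x\<close> from \<open>y\<close> is no farther from \<open>x\<close> than
            \<open>y\<close> is.\<close>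
          have "\<forall>i\<in>?W. \<forall>\<^sub>F y in at x within {0..1}. \<bar>x - y\<bar> < \<bar>x - z i\<bar>"
          proof
            fix i assume "i \<in> ?W"
            then have "\<bar>x - z i\<bar> > 0" using xz by auto
            then show "\<forall>\<^sub>F y in at x within {0..1}. \<bar>x - y\<bar> < \<bar>x - z i\<bar>"
              unfolding eventually_at by (intro exI[of _ "\<bar>x - z i\<bar>"]) (auto simp: dist_real_def abs_minus_commute)
          qed
          then have ev: "\<forall>\<^sub>F y in at x within {0..1}. \<forall>i\<in>?W. \<bar>x - y\<bar> < \<bar>x - z i\<bar>"
            by (rule eventually_ball_finite[OF fin])
          have ev2: "\<forall>\<^sub>F y in at x within {0..1}. y \<in> {0..1} \<and> y \<noteq> x"
            by (auto simp: eventually_at_filter)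
          have "\<forall>\<^sub>F y in at x within {0..1}. \<bar>?Q y\<bar> < e"
            using ev ev2
          proof eventually_elim
            case (elim y)
            show ?case
            proof (rule ccontr)
              assume Q: "\<not> \<bar>?Q y\<bar> < e"
              obtain ds n where s: "set ds \<subseteq> {1..}" "n \<ge> 1" "\<bar>x - phis ds (t (n+1))\<bar> \<le> \<bar>x - y\<bar>"
                "\<bar>x - phis ds (t (n+1))\<bar> \<le> lam ds" "\<bar>\<theta> x - \<theta> y\<bar> \<le> 2 * (1/2) ^ (sum_list ds + n)"
                using separating_word_bounds[of x y] x elim by blast
              have iI: "(ds, n) \<in> I" using s by (auto simp: I_def)
              have "e * \<bar>y - x\<bar> \<le> \<bar>\<theta> y - \<theta> x\<bar>" using Q elim by (simp add: abs_divide field_simps)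
              then have "\<bar>x - y\<bar> \<le> \<bar>\<theta> x - \<theta> y\<bar> / e" using e by (simp add: field_simps abs_minus_commute)
              also have "\<dots> \<le> (2 * (1/2) ^ (sum_list ds + n)) / e" using s(5) e by (intro divide_right_mono) auto
              also have "\<dots> = 2 / e * (1/2) ^ (sum_list ds + n)" by simp
              also have "\<dots> \<le> K * (1/2) ^ (sum_list ds + n)" using K by (intro mult_right_mono) auto
              finally have 1: "\<bar>x - z (ds, n)\<bar> \<le> K * (1/2) ^ (sum_list ds + n)" using s(3) by (simp add: z_def)
              have "lam ds \<le> K * lam ds" using K lam_pos[OF s(1)] by simp
              then have "\<bar>x - z (ds, n)\<bar> \<le> K * lam ds" using s(4) by (simp add: z_def)
              with 1 have "\<bar>x - z (ds, n)\<bar> \<le> K * r (ds, n)" by (simp add: r_def min_def)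
              then have "(ds, n) \<in> ?W" using iI by (simp add: dist_real_def abs_minus_commute)
              then have "\<bar>x - y\<bar> < \<bar>x - z (ds, n)\<bar>" using elim by blast
              then show False using s(3) by (simp add: z_def)
            qed
          qed
          then show False using e(2) by simp
        qed
        then have "x \<in> F K" by (simp add: F_def K_def)
        then show ?thesis by blast
      qed
    qed
  qed
qed

section \<open>The critical exponent\<close>

lemma half_sums: "(\<lambda>k. (1/2::real) ^ Suc k) sums 1"
  using power_half_series by simp

lemma not_dyadic_imp_neq:
  assumes "\<not> dyadic_partition A" shows "\<exists>n\<ge>1. a n \<noteq> (1/2) ^ n"
proof (rule ccontr)
  assume "\<not> ?thesis"
  then have an: "a n = (1/2) ^ n" if "n \<ge> 1" for n using that by auto
  have tn: "t (Suc n) = (1/2) ^ n" for n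
  proof (induction n)
    case 0 then show ?case using tail_1 by simp
  next
    case (Suc n)
    then show ?case using atom_len_eq[of "Suc n"] an[of "Suc n"] by simp
  qed
  have "A n = {(1/2) ^ n <.. (1/2) ^ (n - 1)}" if "n \<ge> 1" for n
    using atom_eq[OF that] tn[of n] tn[of "n - 1"] that by simp
  then have "A ` {1..} = (\<lambda>n. {(1/2) ^ n <.. (1/2) ^ (n - 1)}) ` {1..}"
    by (intro image_cong) auto
  then show False using assms by (simp add: dyadic_partition_def)
qed

text \<open>Two different sequences of the same total exceed each other somewhere. The two indices
  become letters of positive and of negative \<open>log_ratio\<close>.\<close>

lemma exists_larger_smaller:
  assumes "\<not> dyadic_partition A"
  shows "\<exists>i\<ge>1. a i < (1/2) ^ i" "\<exists>j\<ge>1. a j > (1/2) ^ j"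
proof -
  obtain n where n: "n \<ge> 1" "a n \<noteq> (1/2) ^ n" using not_dyadic_imp_neq[OF assms] by blast
  have d: "(\<lambda>k. a (Suc k) - (1/2) ^ Suc k) sums 0"
    using sums_diff[OF atom_len_sums half_sums] by simp
  show "\<exists>i\<ge>1. a i < (1/2) ^ i"
  proof (rule ccontr)
    assume "\<not> ?thesis"
    then have nn: "a (Suc k) - (1/2) ^ Suc k \<ge> 0" for k by (metis diff_ge_0_iff_ge le_add1 not_le plus_1_eq_Suc)
    have "(\<Sum>k. a (Suc k) - (1/2) ^ Suc k) = 0 \<longleftrightarrow> (\<forall>k. a (Suc k) - (1/2) ^ Suc k = 0)"
      by (rule suminf_eq_zero_iff[OF sums_summable[OF d] nn])
    then have "a (Suc (n - 1)) - (1/2) ^ Suc (n - 1) = 0" using sums_unique[OF d] by metis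
    then show False using n by simp
  qed
  have d': "(\<lambda>k. (1/2) ^ Suc k - a (Suc k)) sums 0"
    using sums_diff[OF half_sums atom_len_sums] by simp
  show "\<exists>j\<ge>1. a j > (1/2) ^ j"
  proof (rule ccontr)
    assume "\<not> ?thesis"
    then have nn: "(1/2) ^ Suc k - a (Suc k) \<ge> 0" for k by (metis diff_ge_0_iff_ge le_add1 not_le plus_1_eq_Suc)
    have "(\<Sum>k. (1/2) ^ Suc k - a (Suc k)) = 0 \<longleftrightarrow> (\<forall>k. (1/2) ^ Suc k - a (Suc k) = 0)"
      by (rule suminf_eq_zero_iff[OF sums_summable[OF d'] nn])
    then have "(1/2) ^ Suc (n - 1) - a (Suc (n - 1)) = 0" using sums_unique[OF d'] by metis
    then show False using n by simp
  qed
qed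

text \<open>AM-GM gives a sum below 1 only on the line \<open>u + q = 1\<close>. With
  \<open>u = 1/2\<close> fixed, the sum is a power series in \<open>(1/2) powr q\<close>, continuous
  inside its disc of convergence, so \<open>q\<close> can be lowered a little.\<close>

lemma exists_feasible_less_1:
  assumes "\<not> dyadic_partition A"
  shows "\<exists>u q. feasible u q \<and> u + q < 1"
proof -
  let ?c = "\<lambda>k. a (Suc k) powr (1/2)"
  let ?x = "\<lambda>q. (1/2::real) powr q"
  define G where "G = (\<lambda>x::real. \<Sum>k. ?c k * x ^ k)"
  have pt_eq: "pressure_term (1/2) q (Suc k) = ?x q * (?c k * ?x q ^ k)" for q k
    by (simp add: pressure_term_def half_powr_power del: power_Suc) simp
  have summ: "summable (\<lambda>k. ?c k * ?x q ^ k)" if "q > 0" for q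
  proof -
    have "summable (\<lambda>k. ?x q * (?c k * ?x q ^ k))"
      using summable_pressure_term[of "1/2" q] that unfolding pt_eq by simp
    then show ?thesis by (rule summable_mult_D) simp
  qed
  have H: "(\<Sum>k. pressure_term (1/2) q (Suc k)) = ?x q * G (?x q)" if "q > 0" for q
    unfolding pt_eq G_def by (rule suminf_mult[OF summ[OF that]])
  obtain n where n: "n \<ge> 1" "a n \<noteq> (1/2) ^ n" using not_dyadic_imp_neq[OF assms] by blast
  have "?x (1/2) * G (?x (1/2)) < 1"
  proof -
    let ?g = "\<lambda>k. (a (Suc k) + (1/2) ^ Suc k) / 2"
    let ?f = "\<lambda>k. pressure_term (1/2) (1/2) (Suc k)"
    have g: "?g sums 1" using sums_divide[OF sums_add[OF atom_len_sums half_sums], of 2] by simp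
    have f: "summable ?f" by (rule summable_pressure_term) auto
    have sq: "?g k - ?f k = (sqrt (a (Suc k)) - sqrt ((1/2) ^ Suc k)) ^ 2 / 2" for k
    proof -
      have "?f k = sqrt (a (Suc k)) * sqrt ((1/2) ^ Suc k)"
        using atom_len_pos[of "Suc k"] by (simp add: pressure_term_def powr_half_sqrt del: power_Suc)
      then show ?thesis using atom_len_pos[of "Suc k"]
        by (simp add: power2_diff field_simps less_imp_le del: power_Suc)
    qed
    have "(\<Sum>k. ?g k - ?f k) > 0"
    proof (rule suminf_pos2)
      show "summable (\<lambda>k. ?g k - ?f k)" using g f by (intro summable_diff) (auto simp: sums_iff)
      show "0 \<le> ?g k - ?f k" for k unfolding sq by simp
      have "sqrt (a (Suc (n - 1))) \<noteq> sqrt ((1/2) ^ Suc (n - 1))"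
        using n by (simp del: power_Suc)
      then show "0 < ?g (n - 1) - ?f (n - 1)" unfolding sq by simp
    qed
    also have "(\<Sum>k. ?g k - ?f k) = 1 - (\<Sum>k. ?f k)"
      using suminf_diff[OF sums_summable[OF g] f] sums_unique[OF g] by simp
    finally show ?thesis using H[of "1/2"] by simp
  qed
  moreover have "isCont (\<lambda>q. ?x q * G (?x q)) (1/2)"
  proof -
    have "isCont G (?x (1/2))" unfolding G_def
    proof (rule isCont_powser)
      \<comment> \<open>Any exponent in \<open>(0, 1/2)\<close> would do: it gives a point of
        convergence beyond \<open>(1/2) powr (1/2)\<close>.\<close>
      show "summable (\<lambda>k. ?c k * ?x (1/4) ^ k)" by (rule summ) simp
      show "norm (?x (1/2)) < norm (?x (1/4))"
        using powr_less_mono'[of "1/2::real" "1/4" "1/2"] by simp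
    qed
    moreover have x: "isCont ?x (1/2)" by (intro continuous_intros) auto
    ultimately have "isCont (\<lambda>q. G (?x q)) (1/2)" by (intro isCont_o2[OF x])
    with x show ?thesis by (rule continuous_mult)
  qed
  ultimately have "\<forall>\<^sub>F q in at (1/2). ?x q * G (?x q) < 1"
    unfolding isCont_def by (rule order_tendstoD(2)[rotated])
  then obtain \<delta> where \<delta>: "\<delta> > 0" "\<And>q. q \<noteq> 1/2 \<Longrightarrow> \<bar>q - 1/2\<bar> < \<delta> \<Longrightarrow> ?x q * G (?x q) < 1"
    unfolding eventually_at by (auto simp: dist_real_def)
  define q where "q = 1/2 - min (\<delta> / 2) (1/4)"
  have q: "q > 0" "q < 1/2" "\<bar>q - 1/2\<bar> < \<delta>" using \<delta>(1) by (auto simp: q_def min_def)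
  then have "feasible (1/2) q" using \<delta>(2)[of q] H[of q] by (simp add: feasible_def)
  then show ?thesis using q by (intro exI[of _ "1/2"] exI[of _ q]) auto
qed

definition log_ratio :: "nat \<Rightarrow> real" where "log_ratio n = ln ((1/2) ^ n / a n)"

text \<open>The logarithm of the mean slope of \<open>\<theta>\<close> over the cylinder of
  \<open>ds\<close>. It is additive under concatenation, so along an expansion it is a walk with
  steps \<open>log_ratio\<close>.\<close>

definition drift :: "nat list \<Rightarrow> real" where "drift ds = ln ((1/2) ^ sum_list ds / lam ds)"

lemma sum_list_log_ratio: "set ds \<subseteq> {1..} \<Longrightarrow> sum_list (map log_ratio ds) = drift ds"
proof (induction ds)
  case (Cons n ds)
  then show ?case using atom_len_pos[of n] lam_pos[of ds]
    by (simp add: log_ratio_def drift_def power_add ln_mult ln_div)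
qed (simp add: drift_def)

lemma drift_append: "set ds \<subseteq> {1..} \<Longrightarrow> set es \<subseteq> {1..} \<Longrightarrow> drift (ds @ es) = drift ds + drift es"
  using sum_list_log_ratio[of ds] sum_list_log_ratio[of es] sum_list_log_ratio[of "ds @ es"] by simp

text \<open>Tilting moves along the line \<open>u + q = s\<close>; this ties \<open>feasible\<close>
  to the hypothesis of \<open>words_positive_drift\<close>.\<close>

lemma tilted_term:
  assumes "n \<ge> 1" shows "a n powr s * exp (q * log_ratio n) = pressure_term (s - q) q n"
proof -
  have "exp (q * log_ratio n) = ((1/2) ^ n / a n) powr q"
    using atom_len_pos[OF assms] by (simp add: powr_def log_ratio_def)
  then show ?thesis using atom_len_pos[OF assms]
    by (simp add: pressure_term_def powr_divide powr_diff)
qed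

text \<open>If all these sums could be made at most 1, then by compactness so could the full series at
  one \<open>q\<close>; AM-GM against the weight sequences \<open>a\<close> and \<open>(1/2)^n\<close> forces \<open>0 \<le> q \<le> s\<close>, and a slight
  increase of \<open>q\<close> yields a feasible pair below \<open>D\<close>.\<close>

lemma tilted_sum_gt_1:
  assumes nd: "\<not> dyadic_partition A" and s: "0 < s" "s < 1"
    and D: "\<And>u q. feasible u q \<Longrightarrow> D \<le> u + q" "s < D"
  shows "\<exists>N0. \<forall>N\<ge>N0. \<forall>q. (\<Sum>n=1..N. pressure_term (s - q) q n) > 1"
proof (rule ccontr)
  assume neg: "\<not> ?thesis"
  define g where "g = (\<lambda>N q. \<Sum>n=1..N. pressure_term (s - q) q n)"
  have gmono: "g m q \<le> g n q" if "m \<le> n" for m n q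
    unfolding g_def using that by (intro sum_mono2) (auto simp: pressure_term_nonneg)
  have ex: "\<exists>q. g N q \<le> 1" for N
  proof -
    obtain N' q where "N' \<ge> N" "g N' q \<le> 1" using neg unfolding g_def by (meson not_le)
    then show ?thesis using gmono[of N N' q] by (intro exI[of _ q]) auto
  qed
  obtain i j where ij: "i \<ge> 1" "a i < (1/2) ^ i" "j \<ge> 1" "a j > (1/2) ^ j"
    using exists_larger_smaller[OF nd] by blast
  have Xi: "log_ratio i > 0" unfolding log_ratio_def using ij atom_len_pos[OF ij(1)] by (intro ln_gt_zero) (simp add: field_simps)
  have Xj: "log_ratio j < 0" unfolding log_ratio_def using ij atom_len_pos[OF ij(3)] by (intro ln_less_zero) (auto simp: field_simps)
  \<comment> \<open>The shift by \<open>max i j\<close> keeps both letters in range; their log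
    ratios have opposite signs and bound \<open>q\<close> from both sides.\<close>
  define F where "F = (\<lambda>N. {q. g (N + max i j) q \<le> 1})"
  define ci where "ci = - (s * ln (a i)) / log_ratio i"
  define cj where "cj = - (s * ln (a j)) / log_ratio j"
  have le1: "s * ln (a k) + q * log_ratio k \<le> 0" if "q \<in> F N" "k \<ge> 1" "k \<le> max i j" for q N k
  proof -
    have "pressure_term (s - q) q k \<le> g (N + max i j) q"
      unfolding g_def using that by (intro member_le_sum) (auto simp: pressure_term_nonneg)
    then have "a k powr s * exp (q * log_ratio k) \<le> 1" using that by (simp add: tilted_term F_def)
    moreover have "a k powr s * exp (q * log_ratio k) = exp (s * ln (a k) + q * log_ratio k)"
      using atom_len_pos[OF that(2)] by (simp add: powr_def exp_add)
    ultimately show ?thesis by (simp only: exp_le_one_iff)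
  qed
  have bd: "F N \<subseteq> {cj..ci}" for N
  proof
    fix q assume q: "q \<in> F N"
    have "q * log_ratio i \<le> - (s * ln (a i))" "q * log_ratio j \<le> - (s * ln (a j))"
      using le1[OF q, of i] le1[OF q, of j] ij by auto
    then have "q \<le> ci" "cj \<le> q"
      unfolding ci_def cj_def pos_le_divide_eq[OF Xi] neg_divide_le_eq[OF Xj] by blast+
    then show "q \<in> {cj..ci}" by simp
  qed
  have cont: "continuous_on UNIV (g N)" for N
    unfolding g_def pressure_term_def using atom_len_pos
    by (intro continuous_intros) (auto simp: less_imp_neq[symmetric])
  have "\<Inter>(range F) \<noteq> {}"
  proof (rule compact_nest)
    fix N
    have "closed (F N)" unfolding F_def by (intro closed_Collect_le cont) simp
    then show "compact (F N)" using bd[of N] by (meson bounded_closed_interval bounded_subset compact_eq_bounded_closed)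
    show "F N \<noteq> {}" using ex by (auto simp: F_def)
  next
    fix m n :: nat assume "m \<le> n"
    then show "F n \<subseteq> F m" unfolding F_def using gmono[of "m + max i j" "n + max i j"] by (auto intro: order_trans)
  qed
  then obtain q where q: "\<And>N. q \<in> F N" by auto
  have gq: "g N q \<le> 1" for N using q[of N] gmono[of N "N + max i j" q] by (simp add: F_def)
  have young: "x powr \<alpha> * y powr \<beta> \<le> \<alpha> * x + \<beta> * y" if "0 \<le> \<alpha>" "0 \<le> \<beta>" "\<alpha> + \<beta> = 1" "x > 0" "y > 0" for x y \<alpha> \<beta> :: real
    using Youngs_inequality_0[OF that] .
  have asum: "(\<Sum>n=1..N. a n) \<le> 1" for N
    using sum_le_suminf[OF sums_summable[OF atom_len_sums], of "{..<N}"] sums_unique[OF atom_len_sums] atom_len_pos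
    by (simp add: sum.atLeast1_atMost_eq less_imp_le)
  have bsum: "(\<Sum>n=1..N. (1/2::real) ^ n) \<le> 1" for N
    using sum_le_suminf[OF sums_summable[OF half_sums], of "{..<N}"] sums_unique[OF half_sums]
    by (simp add: sum.atLeast1_atMost_eq)
  have ptpos: "pressure_term (s - q) q n > 0" if "n \<ge> 1" for n
    using atom_len_pos[OF that] by (simp add: pressure_term_def)
  have q0: "q \<ge> 0"
  proof (rule ccontr)
    assume "\<not> q \<ge> 0"
    then have qn: "q < 0" by simp
    \<comment> \<open>\<open>T\<close> is chosen so that the geometric mean of
      \<open>pressure_term (s - q) q n\<close> and \<open>(1/2)^n\<close>, with weights
      \<open>1 - T\<close> and \<open>T\<close>, is free of powers of \<open>1/2\<close>. It equals
      \<open>a n powr v\<close> with \<open>v < 1\<close>, and such partial sums cannot all be at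
      most 1.\<close>
    define T where "T = - q / (1 - q)"
    define v where "v = (s - q) / (1 - q)"
    have T: "0 \<le> T" "0 \<le> 1 - T" "1 - T = 1 / (1 - q)" using qn by (auto simp: T_def field_simps)
    have v: "v < 1" using qn s by (simp add: v_def)
    have "(\<Sum>n=1..N. a n powr v) \<le> 1" for N
    proof -
      have pt: "a n powr v \<le> (1 - T) * pressure_term (s - q) q n + T * (1/2) ^ n" if "n \<ge> 1" for n
      proof -
        have "pressure_term (s - q) q n powr (1 - T) * ((1/2) ^ n) powr T =
          a n powr ((s - q) * (1 - T)) * ((1/2) ^ n) powr (q * (1 - T) + T)"
          using atom_len_pos[OF that] by (simp add: pressure_term_def powr_mult powr_powr powr_add)
        also have "q * (1 - T) + T = 0" using qn T(3) by (simp add: T_def field_simps)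
        also have "(s - q) * (1 - T) = v" using T(3) by (simp add: v_def)
        finally show ?thesis using young[OF T(2,1) _ ptpos[OF that], of "(1/2) ^ n"] by simp
      qed
      have "(\<Sum>n=1..N. a n powr v) \<le> (\<Sum>n=1..N. (1 - T) * pressure_term (s - q) q n + T * (1/2) ^ n)"
        by (intro sum_mono pt) auto
      also have "\<dots> = (1 - T) * g N q + T * (\<Sum>n=1..N. (1/2) ^ n)"
        by (simp add: g_def sum.distrib sum_distrib_left)
      also have "\<dots> \<le> (1 - T) * 1 + T * 1" using T gq bsum by (intro add_mono mult_left_mono) auto
      finally show ?thesis by simp
    qed
    moreover obtain N where "(\<Sum>n=1..N. a n powr v) > 1"
      using sums_1_powr_partial_gt[of a v] atom_len_pos atom_len_less_1 atom_len_sums v by blast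
    ultimately show False by (meson not_le)
  qed
  have qs: "q \<le> s"
  proof (rule ccontr)
    assume "\<not> q \<le> s"
    then have un: "s - q < 0" by simp
    \<comment> \<open>The same device with the roles of \<open>a n\<close> and
      \<open>(1/2)^n\<close> exchanged: now the power of \<open>a n\<close> cancels.\<close>
    define T where "T = - (s - q) / (1 - (s - q))"
    define v where "v = q / (1 - (s - q))"
    have T: "0 \<le> T" "0 \<le> 1 - T" "1 - T = 1 / (1 - (s - q))" using un by (auto simp: T_def field_simps)
    have v: "v < 1" using un s by (simp add: v_def)
    have "(\<Sum>n=1..N. ((1/2) ^ n) powr v) \<le> 1" for N
    proof -
      have pt: "((1/2) ^ n) powr v \<le> (1 - T) * pressure_term (s - q) q n + T * a n" if "n \<ge> 1" for n
      proof -
        have "pressure_term (s - q) q n powr (1 - T) * a n powr T =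
          a n powr ((s - q) * (1 - T) + T) * ((1/2) ^ n) powr (q * (1 - T))"
          using atom_len_pos[OF that] by (simp add: pressure_term_def powr_mult powr_powr powr_add)
        also have "(s - q) * (1 - T) + T = 0" using un unfolding T(3) by (simp add: T_def field_simps)
        also have "q * (1 - T) = v" using T(3) by (simp add: v_def)
        finally show ?thesis
          using young[OF T(2,1) _ ptpos[OF that] atom_len_pos[OF that]] atom_len_pos[OF that] by simp
      qed
      have "(\<Sum>n=1..N. ((1/2) ^ n) powr v) \<le> (\<Sum>n=1..N. (1 - T) * pressure_term (s - q) q n + T * a n)"
        by (intro sum_mono pt) auto
      also have "\<dots> = (1 - T) * g N q + T * (\<Sum>n=1..N. a n)"
        by (simp add: g_def sum.distrib sum_distrib_left)
      also have "\<dots> \<le> (1 - T) * 1 + T * 1" using T gq asum by (intro add_mono mult_left_mono) auto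
      finally show ?thesis by simp
    qed
    moreover obtain N where "(\<Sum>n=1..N. ((1/2::real) ^ n) powr v) > 1"
      using sums_1_powr_partial_gt[of "\<lambda>n. (1/2) ^ n" v] half_sums v power_strict_decreasing[of 0 _ "1/2::real"]
      by auto
    ultimately show False by (meson not_le)
  qed
  \<comment> \<open>Half the gap to \<open>D\<close>. Raising \<open>q\<close> by \<open>e\<close>
    multiplies every term by at most \<open>(1/2) powr e < 1\<close>, while
    \<open>(s - q) + (q + e)\<close> stays below \<open>D\<close>.\<close>
  define e where "e = (D - s) / 2"
  have e: "e > 0" using D(2) by (simp add: e_def)
  have summ: "summable (\<lambda>k. pressure_term (s - q) q (Suc k))"
    by (rule summableI_nonneg_bounded[of _ 1])
       (use gq in \<open>auto simp: g_def pressure_term_nonneg sum.atLeast1_atMost_eq\<close>)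
  have sle: "(\<Sum>k. pressure_term (s - q) q (Suc k)) \<le> 1"
    by (rule suminf_le_const[OF summ]) (use gq in \<open>auto simp: g_def sum.atLeast1_atMost_eq\<close>)
  have "(\<Sum>k. pressure_term (s - q) (q + e) (Suc k)) \<le> (\<Sum>k. (1/2) powr e * pressure_term (s - q) q (Suc k))"
  proof (rule suminf_le)
    fix k
    have "((1/2::real) ^ Suc k) powr e \<le> (1/2) powr e"
      using e by (intro powr_mono2) (auto simp: power_le_one mult_le_one)
    then have "pressure_term (s - q) q (Suc k) * ((1/2) ^ Suc k) powr e \<le> pressure_term (s - q) q (Suc k) * (1/2) powr e"
      by (intro mult_left_mono pressure_term_nonneg)
    then show "pressure_term (s - q) (q + e) (Suc k) \<le> (1/2) powr e * pressure_term (s - q) q (Suc k)"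
      by (simp add: pressure_term_def powr_add mult_ac del: power_Suc)
    show "summable (\<lambda>k. pressure_term (s - q) (q + e) (Suc k))"
      using qs q0 e by (intro summable_pressure_term) auto
    show "summable (\<lambda>k. (1/2) powr e * pressure_term (s - q) q (Suc k))" using summ by (rule summable_mult)
  qed
  also have "\<dots> = (1/2) powr e * (\<Sum>k. pressure_term (s - q) q (Suc k))" by (rule suminf_mult[OF summ])
  also have "\<dots> \<le> (1/2) powr e * 1" using sle by (intro mult_left_mono) auto
  also have "\<dots> < 1" using half_powr_less_1[OF e] by simp
  finally have "feasible (s - q) (q + e)" using qs q0 e by (simp add: feasible_def)
  then have "D \<le> s + e" using D(1) by fastforce
  then show False using D(2) by (simp add: e_def field_simps)
qed

text \<open>The common length makes the cylinders disjoint, the finite alphabet bounds the digits,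
  and the last condition is what \<open>hausdorff_measure_tree_pos\<close> asks of the children of a
  node.\<close>

definition good_words :: "real \<Rightarrow> nat list set \<Rightarrow> bool" where
  "good_words s W \<longleftrightarrow> finite W \<and> (\<exists>N M. M > 0 \<and> W \<subseteq> words {1..N} M) \<and> (\<Sum>w\<in>W. lam w powr s) \<ge> 1"

text \<open>\<open>words_positive_drift\<close> applied to \<open>log_ratio\<close> and to its
  negative. The second use replaces \<open>q\<close> by \<open>-q\<close>, which is harmless because
  the tilted sums exceed 1 for every real \<open>q\<close>.\<close>

lemma exists_good_words:
  assumes nd: "\<not> dyadic_partition A" and s: "0 < s" "s < 1"
    and D: "\<And>u q. feasible u q \<Longrightarrow> D \<le> u + q" "s < D"
  shows "\<exists>W. good_words s W \<and> (\<forall>w\<in>W. drift w > 0)" "\<exists>W. good_words s W \<and> (\<forall>w\<in>W. drift w < 0)"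
proof -
  obtain N0 where N0: "\<And>N q. N \<ge> N0 \<Longrightarrow> (\<Sum>n=1..N. pressure_term (s - q) q n) > 1"
    using tilted_sum_gt_1[OF assms] by blast
  obtain i j where ij: "i \<ge> 1" "a i < (1/2) ^ i" "j \<ge> 1" "a j > (1/2) ^ j"
    using exists_larger_smaller[OF nd] by blast
  have Xi: "log_ratio i > 0" unfolding log_ratio_def using ij atom_len_pos[OF ij(1)] by (intro ln_gt_zero) (simp add: field_simps)
  have Xj: "log_ratio j < 0" unfolding log_ratio_def using ij atom_len_pos[OF ij(3)] by (intro ln_less_zero) (auto simp: field_simps)
  define N where "N = max N0 (max i j)"
  have mem: "i \<in> {1..N}" "j \<in> {1..N}" using ij by (auto simp: N_def)
  let ?p = "\<lambda>n. a n powr s"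
  have p: "?p n > 0" if "n \<in> {1..N}" for n using that atom_len_pos[of n] by auto
  have gt: "(\<Sum>n\<in>{1..N}. ?p n * exp (q * log_ratio n)) > 1" for q
  proof -
    have "(\<Sum>n\<in>{1..N}. ?p n * exp (q * log_ratio n)) = (\<Sum>n=1..N. pressure_term (s - q) q n)"
      by (intro sum.cong refl tilted_term) auto
    then show ?thesis using N0[of N q] by (simp add: N_def)
  qed
  have sub: "set w \<subseteq> {1..}" if "w \<in> words {1..N} M" for w M using that by (auto simp: words_def)
  have pl: "prod_list (map ?p w) = lam w powr s" if "w \<in> words {1..N} M" for w M
    using prod_list_pressure_term[OF sub[OF that], of s 0] by (simp add: pressure_term_def[abs_def] lam_pos)
  have good: "good_words s {w\<in>words {1..N} M. Q w}"
    if "M > 0" "(\<Sum>w\<in>{w\<in>words {1..N} M. Q w}. prod_list (map ?p w)) \<ge> 1" for M Q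
  proof -
    have "(\<Sum>w\<in>{w\<in>words {1..N} M. Q w}. prod_list (map ?p w)) = (\<Sum>w\<in>{w\<in>words {1..N} M. Q w}. lam w powr s)"
      by (intro sum.cong refl pl) auto
    moreover have "finite {w\<in>words {1..N} M. Q w}" using finite_words[of "{1..N}" M] by simp
    moreover have "{w\<in>words {1..N} M. Q w} \<subseteq> words {1..N} M" by blast
    ultimately show ?thesis unfolding good_words_def using that by metis
  qed
  have "\<exists>M>0. (\<Sum>w\<in>{w\<in>words {1..N} M. sum_list (map log_ratio w) > 0}. prod_list (map ?p w)) \<ge> 1"
    by (rule words_positive_drift[OF _ p mem(1) Xi mem(2) Xj gt]) auto
  then obtain M where M: "M > 0" "(\<Sum>w\<in>{w\<in>words {1..N} M. sum_list (map log_ratio w) > 0}. prod_list (map ?p w)) \<ge> 1"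
    by blast
  have "good_words s {w\<in>words {1..N} M. sum_list (map log_ratio w) > 0}"
    by (rule good[OF M])
  then show "\<exists>W. good_words s W \<and> (\<forall>w\<in>W. drift w > 0)"
    using sub sum_list_log_ratio by (intro exI[of _ "{w\<in>words {1..N} M. sum_list (map log_ratio w) > 0}"]) auto
  have gt': "(\<Sum>n\<in>{1..N}. ?p n * exp (q * - log_ratio n)) > 1" for q using gt[of "- q"] by simp
  have "\<exists>M>0. (\<Sum>w\<in>{w\<in>words {1..N} M. sum_list (map (\<lambda>n. - log_ratio n) w) > 0}. prod_list (map ?p w)) \<ge> 1"
    by (rule words_positive_drift[OF _ p mem(2) _ mem(1) _ gt']) (use Xi Xj in auto)
  moreover have neg: "sum_list (map (\<lambda>n. - log_ratio n) w) = - sum_list (map log_ratio w)" for w by (induction w) auto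
  ultimately obtain M' where M': "M' > 0" "(\<Sum>w\<in>{w\<in>words {1..N} M'. sum_list (map log_ratio w) < 0}. prod_list (map ?p w)) \<ge> 1"
    by auto
  have "good_words s {w\<in>words {1..N} M'. sum_list (map log_ratio w) < 0}"
    by (rule good[OF M'])
  then show "\<exists>W. good_words s W \<and> (\<forall>w\<in>W. drift w < 0)"
    using sub sum_list_log_ratio by (intro exI[of _ "{w\<in>words {1..N} M'. sum_list (map log_ratio w) < 0}"]) auto
qed

section \<open>Moran sets\<close>

text \<open>Open intervals: words of equal length give disjoint sets, and by
  \<open>irrational_of_cyl\<close> a point in cylinders of unbounded word length is
  irrational.\<close>

definition cyl :: "nat list \<Rightarrow> real set" where "cyl ds = phis ds ` {0<..<1}"

lemma cyl_Cons: "cyl (n # ds) = phi n ` cyl ds" by (simp add: cyl_def image_image)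

lemma phis_affine: "phis ds x = phis ds 0 + ((-1) ^ length ds * lam ds) * x"
  using phis_diff[of ds x 0] by (simp add: algebra_simps)

lemma phis_continuous: "continuous_on S (phis ds)"
  by (subst continuous_on_cong[OF refl phis_affine]) (intro continuous_intros)

lemma phis_inj: "set ds \<subseteq> {1..} \<Longrightarrow> phis ds x = phis ds y \<longleftrightarrow> x = y"
  using abs_phis_diff[of ds x y] lam_pos[of ds] by auto

lemma cyl_eq:
  assumes "set ds \<subseteq> {1..}"
  obtains l u where "cyl ds = {l<..<u}" "u - l = lam ds"
proof -
  let ?c = "(-1) ^ length ds * lam ds" and ?d = "phis ds 0"
  have c: "?c \<noteq> 0" "\<bar>?c\<bar> = lam ds" using lam_pos[OF assms] by (auto simp: abs_mult power_abs)
  have "cyl ds = (\<lambda>x. ?d + ?c * x) ` {0<..<1}"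
    unfolding cyl_def by (rule image_cong[OF refl]) (rule phis_affine)
  also have "\<dots> = {min ?d (?d + ?c)<..<max ?d (?d + ?c)}" by (rule affine_image_unit_interval[OF c(1)])
  finally have "cyl ds = {min ?d (?d + ?c)<..<max ?d (?d + ?c)}" .
  moreover have "max ?d (?d + ?c) - min ?d (?d + ?c) = \<bar>?c\<bar>" by (auto simp: max_def min_def)
  ultimately show ?thesis using that c(2) by metis
qed

lemma open_cyl: "set ds \<subseteq> {1..} \<Longrightarrow> open (cyl ds)"
  using cyl_eq[of ds] by (metis open_greaterThanLessThan)

lemma emeasure_cyl: "set ds \<subseteq> {1..} \<Longrightarrow> emeasure lborel (cyl ds) = ennreal (lam ds)"
  using cyl_eq[of ds] lam_pos[of ds] by (metis diff_gt_0_iff_gt emeasure_lborel_Ioo less_imp_le)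

lemma cyl_subset: "set es \<subseteq> {1..} \<Longrightarrow> cyl (ds @ es) \<subseteq> cyl ds"
  using phis_unit_open[of es] by (auto simp: cyl_def)

lemma cyl_disjoint:
  assumes "set ds \<subseteq> {1..}" "set es \<subseteq> {1..}" "length ds = length es" "x \<in> cyl ds" "x \<in> cyl es"
  shows "ds = es"
  using assms(3,1,2,4,5)
proof (induction ds es arbitrary: x rule: list_induct2)
  case (Cons n ds m es)
  obtain y z where y: "y \<in> cyl ds" "x = phi n y" and z: "z \<in> cyl es" "x = phi m z"
    using Cons.prems(3,4) unfolding cyl_Cons by blast
  have yz: "y \<in> {0<..<1}" "z \<in> {0<..<1}"
    using y z Cons.prems phis_unit_open[of ds] phis_unit_open[of es] by (auto simp: cyl_def)
  have n: "n \<ge> 1" and m: "m \<ge> 1" using Cons.prems by auto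
  have "x \<in> A n" "x \<in> A m" using phi_mem[OF n, of y] phi_mem[OF m, of z] yz y z by auto
  then have nm: "n = m" using atom_index_eq[OF n] atom_index_eq[OF m] by metis
  then have "y = z" using y(2) z(2) phis_inj[of "[n]" y z] n by simp
  then have "ds = es" using Cons.IH[of y] Cons.prems y z by simp
  then show ?case using nm by simp
qed simp

lemma orbit_phis:
  assumes "set ds \<subseteq> {1..}" "y \<in> {0<..<1}"
  shows "(L ^^ length ds) (phis ds y) = y"
    "map (digit (phis ds y)) [1..<length ds + 1] = ds"
    "luroth_terminates_at A (phis ds y) k \<Longrightarrow> k > length ds"
proof -
  have "(L ^^ length ds) (phis ds y) = y \<and> map (digit (phis ds y)) [1..<length ds + 1] = ds \<and>
     (\<forall>k. luroth_terminates_at A (phis ds y) k \<longrightarrow> k > length ds)"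
    using assms(1)
  proof (induction ds)
    case Nil
    then show ?case by (auto simp: luroth_terminates_at_def)
  next
    case (Cons n ds)
    let ?z = "phis ds y"
    have z: "?z \<in> {0<..<1}" using phis_unit_open assms(2) Cons.prems by auto
    then have z': "?z \<in> {0..<1}" by auto
    have n: "n \<ge> 1" using Cons.prems by simp
    have IH: "(L ^^ length ds) ?z = y" "map (digit ?z) [1..<length ds + 1] = ds"
      "\<And>k. luroth_terminates_at A ?z k \<Longrightarrow> k > length ds" using Cons by auto
    have "(L ^^ length (n # ds)) (phis (n # ds) y) = y"
      using digit_phi(3)[OF n z', of "length ds"] IH(1) by (simp del: funpow.simps)
    moreover have "map (digit (phis (n # ds) y)) [1..<length (n # ds) + 1] = n # ds"
    proof -
      have "[1..<length (n # ds) + 1] = 1 # map Suc [1..<length ds + 1]"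
        by (simp add: map_Suc_upt upt_conv_Cons del: upt_Suc)
      then have "map (digit (phi n ?z)) [1..<length (n # ds) + 1] =
          digit (phi n ?z) 1 # map (\<lambda>k. digit (phi n ?z) (Suc k)) [1..<length ds + 1]"
        by (simp only: list.map map_map o_def)
      also have "map (\<lambda>k. digit (phi n ?z) (Suc k)) [1..<length ds + 1] = map (digit ?z) [1..<length ds + 1]"
        by (intro map_cong refl digit_phi(2)[OF n z']) (simp del: upt_Suc)
      finally show ?thesis using digit_phi(1)[OF n z'] IH(2) by simp
    qed
    moreover have "k > length (n # ds)" if k: "luroth_terminates_at A (phis (n # ds) y) k" for k
    proof -
      have "k \<ge> 1" using k by (simp add: luroth_terminates_at_def)
      moreover have "k \<noteq> 1" using k terminates_phi(1)[OF n z] by auto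
      ultimately obtain j where j: "k = Suc j" "j \<ge> 1" by (cases k) auto
      then have "luroth_terminates_at A ?z j" using k terminates_phi(2)[OF n z, of j] by simp
      then show ?thesis using IH(3) j by simp
    qed
    ultimately show ?case by blast
  qed
  then show "(L ^^ length ds) (phis ds y) = y" "map (digit (phis ds y)) [1..<length ds + 1] = ds"
    "luroth_terminates_at A (phis ds y) k \<Longrightarrow> k > length ds" by blast+
qed

section \<open>Digits and cylinders of a point\<close>

definition pre :: "real \<Rightarrow> nat \<Rightarrow> nat list" where "pre x k = map (digit x) [1..<k + 1]"

lemma length_pre [simp]: "length (pre x k) = k" by (simp add: pre_def)

lemma pre_Suc: "pre x (Suc k) = pre x k @ [digit x (Suc k)]" by (simp add: pre_def)

lemma pre_append: "pre x (k + m) = pre x k @ map (\<lambda>i. digit x (k + i)) [1..<m + 1]"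
  by (induction m) (auto simp: pre_Suc)

lemma set_pre: "luroth_irrational A x \<Longrightarrow> set (pre x k) \<subseteq> {1..}"
  using irrational_digit_ge_1 by (auto simp: pre_def)

lemma irrational_unit: assumes "luroth_irrational A x" shows "x \<in> {0<..<1}"
proof -
  have "x \<noteq> 1" using assms by (auto simp: luroth_irrational_def luroth_terminates_at_def)
  then show ?thesis using assms by (auto simp: luroth_irrational_def)
qed

lemma irrational_luroth_map:
  assumes "luroth_irrational A x"
  shows "luroth_irrational A (L x)" "x = phi (digit x 1) (L x)" "digit x (Suc (Suc k)) = digit (L x) (Suc k)"
proof -
  have L1: "L x \<in> {0<..<1}"
    using irrational_orbit[OF assms, of 1] luroth_map_unit[of x] irrational_unit[OF assms] by auto
  obtain n where n: "n \<ge> 1" "x \<in> A n" using irrational_unit[OF assms] atom_cases[of x] by auto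
  have x: "x = phi n (L x)" using luroth_map_atom(3)[OF n] by simp
  have dn: "digit x 1 = n" using n by (simp add: luroth_digit_def atom_index_eq)
  show "x = phi (digit x 1) (L x)" using x dn by simp
  have "\<not> luroth_terminates_at A (L x) k" for k
  proof (cases "k \<ge> 1")
    case True
    then show ?thesis using terminates_phi(2)[OF n(1) L1 True] x assms by (simp add: luroth_irrational_def)
  qed (simp add: luroth_terminates_at_def)
  then show "luroth_irrational A (L x)" using L1 by (simp add: luroth_irrational_def)
  show "digit x (Suc (Suc k)) = digit (L x) (Suc k)"
    using digit_phi(2)[OF n(1), of "L x" "Suc k"] L1 x by simp
qed

lemma irrational_funpow:
  assumes "luroth_irrational A x"
  shows "luroth_irrational A ((L ^^ k) x)" "x = phis (pre x k) ((L ^^ k) x)"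
    "digit ((L ^^ k) x) (Suc i) = digit x (Suc (k + i))"
proof -
  have "luroth_irrational A ((L ^^ k) x) \<and> x = phis (pre x k) ((L ^^ k) x) \<and>
    (\<forall>i. digit ((L ^^ k) x) (Suc i) = digit x (Suc (k + i)))"
  proof (induction k)
    case 0
    then show ?case using assms by (simp add: pre_def)
  next
    case (Suc k)
    let ?y = "(L ^^ k) x"
    have IH: "luroth_irrational A ?y" "x = phis (pre x k) ?y" "\<And>i. digit ?y (Suc i) = digit x (Suc (k + i))"
      using Suc by blast+
    note m = irrational_luroth_map[OF IH(1)]
    have "digit ?y 1 = digit x (Suc k)" using IH(3)[of 0] by simp
    then have "x = phis (pre x (Suc k)) (L ?y)"
      using IH(2) m(2) by (simp add: pre_Suc)
    moreover have "digit (L ?y) (Suc i) = digit x (Suc (Suc k + i))" for i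
      using m(3)[of i] IH(3)[of "Suc i"] by simp
    ultimately show ?case using m(1) by simp
  qed
  then show "luroth_irrational A ((L ^^ k) x)" "x = phis (pre x k) ((L ^^ k) x)"
    "digit ((L ^^ k) x) (Suc i) = digit x (Suc (k + i))" by blast+
qed

lemma irrational_mem_cyl: "luroth_irrational A x \<Longrightarrow> x \<in> cyl (pre x k)"
  using irrational_funpow(1,2)[of x k] irrational_unit[of "(L ^^ k) x"] by (auto simp: cyl_def)

lemma mem_cyl_pre:
  assumes "set ds \<subseteq> {1..}" "x \<in> cyl ds" shows "pre x (length ds) = ds"
proof -
  obtain y where "y \<in> {0<..<1}" "x = phis ds y" using assms(2) by (auto simp: cyl_def)
  then show ?thesis using orbit_phis(2)[OF assms(1)] by (simp only: pre_def)
qed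

lemma irrational_of_cyl:
  assumes "\<And>k. \<exists>ds. set ds \<subseteq> {1..} \<and> length ds \<ge> k \<and> x \<in> cyl ds"
  shows "luroth_irrational A x"
proof -
  have "\<not> luroth_terminates_at A x k" for k
  proof -
    obtain ds where ds: "set ds \<subseteq> {1..}" "length ds \<ge> k" "x \<in> cyl ds" using assms by blast
    then obtain y where y: "y \<in> {0<..<1}" "x = phis ds y" by (auto simp: cyl_def)
    show ?thesis using orbit_phis(3)[OF ds(1) y(1), of k] ds(2) y(2) by auto
  qed
  moreover have "x \<in> {0<..1}"
  proof -
    obtain ds where ds: "set ds \<subseteq> {1..}" "x \<in> cyl ds" using assms by blast
    then have "x \<in> {0<..<1}" using phis_unit_open[of ds] by (auto simp: cyl_def)
    then show ?thesis by simp
  qed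
  ultimately show ?thesis by (simp add: luroth_irrational_def)
qed

text \<open>\<open>W\<close> sees the whole history \<open>p n\<close>, so that the next word may be
  chosen according to the current drift.\<close>

definition branch :: "(nat list \<Rightarrow> nat list set) \<Rightarrow> (nat \<Rightarrow> nat list) \<Rightarrow> bool" where
  "branch W p \<longleftrightarrow> p 0 = [] \<and> (\<forall>n. \<exists>w\<in>W (p n). p (Suc n) = p n @ w)"

text \<open>One letter is not enough, since \<open>phi 1 0 = 1\<close>. The second letter brings the
  unit interval into \<open>(0,1]\<close>, and the first, applied after it, brings that into
  \<open>(0,1)\<close>.\<close>

lemma phis_two_unit:
  assumes "set ds \<subseteq> {1..}" "length ds \<ge> 2" "y \<in> {0..1}"
  shows "phis ds y \<in> {0<..<1}"
proof -
  obtain n m es where ds: "ds = n # m # es" using assms(2) by (cases ds rule: list.exhaust, simp, metis Suc_le_length_iff numeral_2_eq_2)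
  have n: "n \<ge> 1" "m \<ge> 1" using assms(1) ds by auto
  have u: "phis es y \<in> {0..1}" using phis_unit[of es] assms ds by auto
  have "0 < t (m+1)" by (rule tail_pos) simp
  then have v: "0 < phi m (phis es y)" "phi m (phis es y) \<le> 1"
    using phi_bounds(3)[OF n(2), of "phis es y"] phi_unit[OF n(2) u] u by auto
  have "0 < t (n+1)" by (rule tail_pos) simp
  then show ?thesis
    using phi_bounds(2)[OF n(1) v(1)] phi_bounds(3)[OF n(1) v(2)] tail_le_1[OF n(1)] ds by auto
qed

text \<open>Compactness gives a point of all closed cylinders; two further letters move it into the
  open ones.\<close>

lemma branch_point:
  assumes p: "branch W p" and W: "\<And>h w. w \<in> W h \<Longrightarrow> w \<noteq> [] \<and> set w \<subseteq> {1..}"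
  obtains x where "\<And>n. x \<in> cyl (p n)"
proof -
  have ext: "\<exists>w. p (Suc n) = p n @ w \<and> w \<noteq> [] \<and> set w \<subseteq> {1..}" for n
    using p W unfolding branch_def by metis
  have ext2: "\<exists>w. p (n + k) = p n @ w \<and> length w \<ge> k \<and> set w \<subseteq> {1..}" for n k
  proof (induction k)
    case (Suc k)
    then obtain w where w: "p (n + k) = p n @ w" "length w \<ge> k" "set w \<subseteq> {1..}" by blast
    obtain v where v: "p (Suc (n + k)) = p (n + k) @ v" "v \<noteq> []" "set v \<subseteq> {1..}" using ext by blast
    have "length v \<ge> 1" using v(2) by (cases v) auto
    then show ?case using w v by (intro exI[of _ "w @ v"]) auto
  qed simp
  have valid: "set (p n) \<subseteq> {1..}" for n using ext2[of 0 n] p by (auto simp: branch_def)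
  define F where "F = (\<lambda>n. phis (p n) ` {0..1})"
  have "\<Inter>(range F) \<noteq> {}"
  proof (rule compact_nest)
    show "compact (F n)" for n unfolding F_def by (intro compact_continuous_image phis_continuous) simp
    show "F n \<noteq> {}" for n by (simp add: F_def)
    fix m n :: nat assume "m \<le> n"
    then obtain w where w: "p n = p m @ w" "set w \<subseteq> {1..}" using ext2[of m "n - m"] by auto
    show "F n \<subseteq> F m" unfolding F_def w(1) using phis_unit[OF w(2)] by auto
  qed
  then obtain x where x: "\<And>n. x \<in> F n" by auto
  have "x \<in> cyl (p n)" for n
  proof -
    obtain w where w: "p (n + 2) = p n @ w" "length w \<ge> 2" "set w \<subseteq> {1..}" using ext2 by blast
    obtain y where y: "y \<in> {0..1}" "x = phis (p n) (phis w y)" using x[of "n + 2"] w(1) by (auto simp: F_def)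
    then show ?thesis using phis_two_unit[OF w(3,2)] by (auto simp: cyl_def)
  qed
  then show ?thesis using that by blast
qed

text \<open>\<open>lam\<close> is multiplicative, so the sum condition at a node reduces to that of
  \<open>W1\<close> or \<open>W2\<close>, whichever the history selects. Finitely many words occur
  in all, which bounds the ratios of lengths from below.\<close>

lemma hausdorff_measure_moran:
  assumes s: "0 < s" "s \<le> 1" and good: "good_words s W1" "good_words s W2"
    and W: "\<And>h. W h = W1 \<or> W h = W2"
    and E: "\<And>p x. branch W p \<Longrightarrow> (\<And>n. x \<in> cyl (p n)) \<Longrightarrow> x \<in> E"
  shows "hausdorff_measure s E \<noteq> 0"
proof -
  have gw: "finite V" "\<And>w. w \<in> V \<Longrightarrow> w \<noteq> [] \<and> set w \<subseteq> {1..}"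
    "\<And>v w. v \<in> V \<Longrightarrow> w \<in> V \<Longrightarrow> length v = length w" "(\<Sum>w\<in>V. lam w powr s) \<ge> 1"
    if "V = W1 \<or> V = W2" for V
  proof -
    have "good_words s V" using that good by auto
    then obtain N M where V: "finite V" "M > 0" "V \<subseteq> words {1..N} M" "(\<Sum>w\<in>V. lam w powr s) \<ge> 1"
      unfolding good_words_def by blast
    show "finite V" "(\<Sum>w\<in>V. lam w powr s) \<ge> 1" by fact+
    have *: "set w \<subseteq> {1..N}" "length w = M" if "w \<in> V" for w
      using V(3) that by (auto simp: words_def)
    show "w \<noteq> [] \<and> set w \<subseteq> {1..}" if "w \<in> V" for w using V(2) *[OF that] by auto
    show "length v = length w" if "v \<in> V" "w \<in> V" for v w using * that by simp
  qed
  have fin: "finite (W1 \<union> W2)" using gw(1)[of W1] gw(1)[of W2] by simp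
  have gv: "w \<noteq> []" "set w \<subseteq> {1..}" if "w \<in> W1 \<union> W2" for w
    using gw(2)[of W1 w] gw(2)[of W2 w] that by blast+
  have ne: "W1 \<noteq> {}" using good(1) by (auto simp: good_words_def)
  define r where "r = Min (lam ` (W1 \<union> W2))"
  have rle: "r \<le> lam w" if "w \<in> W1 \<union> W2" for w unfolding r_def using that fin by (intro Min_le) auto
  have "r \<in> lam ` (W1 \<union> W2)" unfolding r_def using fin ne by (intro Min_in) auto
  then obtain w0 where "w0 \<in> W1 \<union> W2" "r = lam w0" by blast
  then have r0: "r > 0" using lam_pos[OF gv(2)] by simp
  have \<kappa>w: "lam w \<le> \<kappa>" if w: "w \<in> W1 \<union> W2" for w
  proof -
    have "w \<noteq> []" "set w \<subseteq> {1..}" using gv[OF w] by auto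
    then have "lam w \<le> \<kappa> ^ length w" "length w \<ge> 1" using lam_le by (auto simp: Suc_le_eq)
    moreover have "\<kappa> ^ length w \<le> \<kappa> ^ 1" using \<kappa> calculation by (intro power_decreasing) auto
    ultimately show ?thesis by simp
  qed
  have r1: "r \<le> 1"
  proof -
    obtain w where "w \<in> W1 \<union> W2" using ne by blast
    then show ?thesis using rle[of w] \<kappa>w[of w] \<kappa>(2) by linarith
  qed
  have Wh: "w \<in> W1 \<union> W2" if "w \<in> W h" for w h using W[of h] that by auto
  have Wv: "w \<noteq> [] \<and> set w \<subseteq> {1..}" if "w \<in> W h" for w h using gv[OF Wh[OF that]] by blast
  show ?thesis
  proof (rule hausdorff_measure_tree_pos[where C=cyl and ch="\<lambda>h. (\<lambda>w. h @ w) ` W h" and len=lam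
        and P="\<lambda>h. set h \<subseteq> {1..}" and r=r and \<kappa>=\<kappa> and ?h0.0="[]"])
    fix h h' :: "nat list" assume h: "set h \<subseteq> {1..}"
    show "cyl h \<in> sets borel" using open_cyl[OF h] by simp
    show "emeasure lborel (cyl h) = ennreal (lam h)" by (rule emeasure_cyl[OF h])
    show "lam h > 0" by (rule lam_pos[OF h])
    show "\<bar>x - y\<bar> \<le> lam h" if "x \<in> cyl h" "y \<in> cyl h" for x y
      by (rule cyl_eq[OF h]) (use that in auto)
    show "finite ((\<lambda>w. h @ w) ` W h)" using gw(1)[OF W[of h]] by simp
    show "disjoint_family_on cyl ((\<lambda>w. h @ w) ` W h)"
      unfolding disjoint_family_on_def
    proof (intro ballI impI equals0I)
      fix c c' x assume c: "c \<in> (\<lambda>w. h @ w) ` W h" "c' \<in> (\<lambda>w. h @ w) ` W h" "c \<noteq> c'" "x \<in> cyl c \<inter> cyl c'"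
      then obtain w w' where w: "w \<in> W h" "w' \<in> W h" "c = h @ w" "c' = h @ w'" by blast
      have "c = c'"
      proof (rule cyl_disjoint)
        show "set c \<subseteq> {1..}" "set c' \<subseteq> {1..}" using w h Wv by auto
        show "length c = length c'" using gw(3)[OF W[of h] w(1,2)] w by simp
      qed (use c in auto)
      then show False using c by simp
    qed
    show "lam h powr s \<le> (\<Sum>h'\<in>(\<lambda>w. h @ w) ` W h. lam h' powr s)"
    proof -
      have "lam h powr s * 1 \<le> lam h powr s * (\<Sum>w\<in>W h. lam w powr s)"
        using gw(4)[OF W[of h]] by (intro mult_left_mono) auto
      also have "\<dots> = (\<Sum>w\<in>W h. lam (h @ w) powr s)"
        unfolding sum_distrib_left using Wv lam_pos h
        by (intro sum.cong refl) (auto simp: powr_mult less_imp_le)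
      also have "\<dots> = (\<Sum>h'\<in>(\<lambda>w. h @ w) ` W h. lam h' powr s)"
        by (subst sum.reindex) (auto simp: inj_on_def)
      finally show ?thesis by simp
    qed
    assume "h' \<in> (\<lambda>w. h @ w) ` W h"
    then obtain w where w: "w \<in> W h" "h' = h @ w" by blast
    show "set h' \<subseteq> {1..}" using w h Wv by auto
    show "cyl h' \<subseteq> cyl h" using cyl_subset Wv w by auto
    show "r * lam h \<le> lam h'" using rle[OF Wh[OF w(1)]] lam_pos[OF h] w by (simp add: mult.commute)
    show "lam h' \<le> \<kappa> * lam h" using \<kappa>w[OF Wh[OF w(1)]] lam_pos[OF h] w by (simp add: mult.commute)
  next
    fix p :: "nat \<Rightarrow> nat list" assume p: "p 0 = []" "\<And>n. p (Suc n) \<in> (\<lambda>w. p n @ w) ` W (p n)"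
    then have b: "branch W p" by (auto simp: branch_def)
    then obtain x where "\<And>n. x \<in> cyl (p n)" using branch_point Wv by blast
    then show "\<exists>x\<in>E. \<forall>n. x \<in> cyl (p n)" using E b by blast
  qed (use s r0 r1 \<kappa> in auto)
qed

section \<open>Derivatives at points with bounded digits\<close>

definition digits_le :: "nat \<Rightarrow> real \<Rightarrow> bool" where
  "digits_le N x \<longleftrightarrow> luroth_irrational A x \<and> (\<forall>k. digit x (Suc k) \<le> N)"

lemma digits_leD:
  assumes "digits_le N x"
  shows "luroth_irrational A x" "digits_le N (L x)" "digits_le N ((L ^^ k) x)"
    "digit x 1 \<ge> 1" "digit x 1 \<le> N" "x \<in> A (digit x 1)"
proof -
  show irr: "luroth_irrational A x" using assms by (simp add: digits_le_def)
  show d: "digits_le N ((L ^^ k) x)" for k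
    using assms irrational_funpow[OF irr, of k] by (simp add: digits_le_def)
  show "digits_le N (L x)" using d[of 1] by simp
  show d1: "digit x 1 \<ge> 1" by (rule irrational_digit_ge_1[OF irr])
  show "digit x 1 \<le> N" using assms by (simp add: digits_le_def)
  have "L x \<in> {0<..<1}" by (rule irrational_unit[OF irrational_luroth_map(1)[OF irr]])
  then have "phi (digit x 1) (L x) \<in> A (digit x 1)" using d1 by (intro phi_mem) auto
  then show "x \<in> A (digit x 1)" using irrational_luroth_map(2)[OF irr] by simp
qed

lemma theta_lower_digits_le:
  assumes "digits_le N x" shows "\<theta> x \<ge> (1/2) ^ N"
proof -
  note d = digits_leD[OF assms]
  have "(1/2::real) ^ N \<le> (1/2) ^ digit x 1" using d(5) by (intro power_decreasing) auto
  also have "\<dots> \<le> \<theta> x" by (rule theta_atom(2)[OF d(4,6)])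
  finally show ?thesis .
qed

text \<open>Together with the lower bound this keeps \<open>\<theta>\<close> away from 0 and 1 along
  the orbit of a point with bounded digits. A first digit 1 turns the lower bound at
  \<open>L x\<close> into an upper bound at \<open>x\<close>, as the branch reverses orientation;
  other digits give at most 1/2.\<close>

lemma theta_upper_digits_le:
  assumes "digits_le N x" shows "\<theta> x \<le> 1 - (1/2) ^ (N + 1)"
proof -
  note d = digits_leD[OF assms]
  show ?thesis
  proof (cases "digit x 1 = 1")
    case True
    have "\<theta> x = (1/2) ^ 1 * (2 - \<theta> (L x))" using theta_atom(1)[OF d(4,6)] True by simp
    then show ?thesis using theta_lower_digits_le[OF d(2)] by simp
  next
    case False
    have "(1/2::real) ^ digit x 1 \<le> (1/2) ^ 2" using False d(4) by (intro power_decreasing) auto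
    moreover have "\<theta> x \<le> 2 * (1/2) ^ digit x 1" by (rule theta_atom(3)[OF d(4,6)])
    moreover have "(1/2::real) ^ (N + 1) \<le> (1/2) ^ 1" by (intro power_decreasing) auto
    ultimately show ?thesis by (simp add: power2_eq_square)
  qed
qed

lemma exp_drift: "set ds \<subseteq> {1..} \<Longrightarrow> exp (drift ds) = (1/2) ^ sum_list ds / lam ds"
  using lam_pos[of ds] by (simp add: drift_def)

text \<open>Removing the common word of length \<open>k\<close> factors out the slope
  \<open>exp (drift (pre x k))\<close>. For the remaining pair, split by a tail, the numerator is
  bounded below because the digits of \<open>x\<close> are bounded, and the denominator is at most
  1. The second conclusion holds because no cylinder of \<open>x\<close> that is deeper than the
  common word contains \<open>y\<close>.\<close>

lemma difference_quotient:
  assumes x: "digits_le N x" and y: "y \<in> {0..1}" "y \<noteq> x"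
  obtains k where "(\<theta> y - \<theta> x) / (y - x) \<ge> (1/2) ^ (2 * N + 1) * exp (drift (pre x k))"
    "\<And>m. y \<in> cyl (pre x m) \<Longrightarrow> m \<le> k"
proof -
  have irr: "luroth_irrational A x" by (rule digits_leD(1)[OF x])
  have xu: "x \<in> {0..1}" using irrational_unit[OF irr] by auto
  obtain ds x' y' n where s: "set ds \<subseteq> {1..}" "x = phis ds x'" "y = phis ds y'"
    "x' = (L ^^ length ds) x" "ds = map (digit x) [1..<length ds + 1]" "n \<ge> 1"
    "(x' \<in> A n \<and> y' \<in> {0..t (n+1)}) \<or> (y' \<in> A n \<and> x' \<in> {0..t (n+1)})"
    using separating_word[OF xu y(1) y(2)[symmetric]] by metis
  define k where "k = length ds"
  have ds: "ds = pre x k" using s(5) by (simp only: pre_def k_def)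
  have x': "digits_le N x'" unfolding s(4) by (rule digits_leD(3)[OF x])
  note d = digits_leD[OF x']
  define e where "e = digit x' 1"
  have e: "e \<ge> 1" "e \<le> N" "x' \<in> A e" using d by (auto simp: e_def)
  have eN: "(1/2::real) ^ N \<le> (1/2) ^ e" using e by (intro power_decreasing) auto
  have th: "\<theta> x' = (1/2) ^ e * (2 - \<theta> (L x'))" by (rule theta_atom(1)[OF e(1,3)])
  have lo: "(1/2) ^ N \<le> \<theta> (L x')" and up: "\<theta> (L x') \<le> 1 - (1/2) ^ (N + 1)"
    using theta_lower_digits_le[OF d(2)] theta_upper_digits_le[OF d(2)] by auto
  have tn: "t (n+1) > 0" "t n \<le> 1" using tail_pos[of "n+1"] tail_le_1[OF s(6)] by auto
  have u: "x' \<in> {0..1}" "y' \<in> {0..1}"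
    using s(7) atom_eq[OF s(6)] tn tail_less[OF s(6)] by auto
  \<comment> \<open>A factor \<open>(1/2)^N\<close> comes from the first digit \<open>e\<close> of
    \<open>x'\<close>, and \<open>(1/2)^(N + 1)\<close> from the distance of
    \<open>\<theta> (L x')\<close> to 0 and 1.\<close>
  define c0 where "c0 = (1/2::real) ^ (2 * N + 1)"
  have c0: "c0 > 0" "(1/2::real) ^ N * (1/2) ^ (N + 1) = c0" "(1/2::real) ^ N * (1/2) ^ N = 2 * c0"
  proof -
    have e: "2 * N + 1 = Suc (N + N)" "N + (N + 1) = Suc (N + N)" by simp_all
    show "c0 > 0" by (simp add: c0_def)
    show "(1/2::real) ^ N * (1/2) ^ (N + 1) = c0" unfolding c0_def power_add[symmetric] e ..
    show "(1/2::real) ^ N * (1/2) ^ N = 2 * c0" unfolding c0_def e power_add[symmetric] by simp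
  qed
  have gap: "(\<theta> x' - \<theta> y') / (x' - y') \<ge> c0"
    using s(7)
  proof
    assume c: "x' \<in> A n \<and> y' \<in> {0..t (n+1)}"
    then have ne: "n = e" using atom_index_eq[OF s(6)] atom_index_eq[OF e(1,3)] by metis
    have "\<theta> y' \<le> (1/2) ^ e" using theta_below_tail[OF s(6), of y'] c ne by auto
    then have "\<theta> x' - \<theta> y' \<ge> (1/2) ^ e * (1 - \<theta> (L x'))" unfolding th by (simp add: algebra_simps)
    moreover have "(1/2) ^ e * (1 - \<theta> (L x')) \<ge> (1/2) ^ N * (1/2) ^ (N + 1)"
      using eN up by (intro mult_mono) auto
    ultimately have g: "\<theta> x' - \<theta> y' \<ge> c0" unfolding c0(2) by linarith
    have lt: "y' < x'" using c atom_eq[OF s(6)] by auto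
    have "c0 * (x' - y') \<le> c0" using u c0(1) by (intro mult_left_le) auto
    then show ?thesis using g lt by (simp add: pos_le_divide_eq)
  next
    assume c: "y' \<in> A n \<and> x' \<in> {0..t (n+1)}"
    \<comment> \<open>Now \<open>x'\<close> is below the cut, so its digit exceeds \<open>n\<close>
      and \<open>\<theta> y'\<close> is at least \<open>2 * (1/2)^e\<close>; subtracting
      \<open>\<theta> x'\<close> leaves at least \<open>(1/2)^e * \<theta> (L x')\<close>.\<close>
    have "e \<ge> n + 1"
    proof (rule ccontr)
      assume "\<not> ?thesis"
      then have "t (n+1) \<le> t (e+1)" using e by (intro tail_antimono) auto
      then show False using c e(3) atom_eq[OF e(1)] by auto
    qed
    then have "(1/2::real) ^ e \<le> (1/2) ^ (n + 1)" by (intro power_decreasing) auto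
    moreover have "(1/2) ^ n \<le> \<theta> y'" using theta_atom(2)[OF s(6)] c by auto
    ultimately have "\<theta> y' - \<theta> x' \<ge> (1/2) ^ e * \<theta> (L x')" unfolding th by (simp add: algebra_simps)
    moreover have "(1/2) ^ e * \<theta> (L x') \<ge> (1/2) ^ N * (1/2) ^ N"
      using eN lo by (intro mult_mono) auto
    ultimately have g: "\<theta> y' - \<theta> x' \<ge> c0" using c0(1) unfolding c0(3) by linarith
    have lt: "x' < y'" using c atom_eq[OF s(6)] by auto
    have "c0 * (y' - x') \<le> c0" using u c0(1) by (intro mult_left_le) auto
    then have "c0 \<le> (\<theta> y' - \<theta> x') / (y' - x')" using g lt by (simp add: pos_le_divide_eq)
    also have "\<dots> = (\<theta> x' - \<theta> y') / (x' - y')" by (metis minus_diff_eq minus_divide_divide)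
    finally show ?thesis .
  qed
  define sg where "sg = (-1::real) ^ length ds"
  have sg: "sg \<noteq> 0" by (simp add: sg_def)
  have l: "lam ds > 0" by (rule lam_pos[OF s(1)])
  have 1: "x - y = sg * lam ds * (x' - y')" unfolding s(2,3) sg_def by (rule phis_diff)
  have 2: "\<theta> x - \<theta> y = sg * (1/2) ^ sum_list ds * (\<theta> x' - \<theta> y')"
    unfolding s(2,3) sg_def by (rule theta_phis_diff[OF s(1) u])
  have "(\<theta> y - \<theta> x) / (y - x) = (\<theta> x - \<theta> y) / (x - y)" by (metis minus_diff_eq minus_divide_divide)
  also have "\<dots> = exp (drift ds) * ((\<theta> x' - \<theta> y') / (x' - y'))"
    unfolding 1 2 exp_drift[OF s(1)] using sg by simp
  finally have "(\<theta> y - \<theta> x) / (y - x) = exp (drift ds) * ((\<theta> x' - \<theta> y') / (x' - y'))" .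
  moreover have "exp (drift ds) * ((\<theta> x' - \<theta> y') / (x' - y')) \<ge> exp (drift ds) * c0"
    using gap by (intro mult_left_mono) auto
  ultimately have Q: "(\<theta> y - \<theta> x) / (y - x) \<ge> (1/2) ^ (2 * N + 1) * exp (drift (pre x k))"
    unfolding ds[symmetric] c0_def by (simp only: mult.commute)
  have "m \<le> k" if m: "y \<in> cyl (pre x m)" for m
  proof (rule ccontr)
    assume "\<not> m \<le> k"
    then have mk: "m = Suc k + (m - Suc k)" by simp
    have "cyl (pre x m) \<subseteq> cyl (pre x (Suc k))"
      by (subst mk, subst pre_append, rule cyl_subset) (use irrational_digit_ge_1[OF irr] in auto)
    then have "y \<in> cyl (ds @ [digit x (Suc k)])" using m ds by (auto simp: pre_Suc)
    then obtain v where v: "v \<in> {0<..<1}" "y = phis ds (phi (digit x (Suc k)) v)" by (auto simp: cyl_def)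
    have "digit x (Suc k) = e" using irrational_funpow(3)[OF irr, of k 0] s(4) by (simp add: e_def k_def)
    then have "y' = phi e v" using v(2) s(3) phis_inj[OF s(1)] by simp
    then have ye: "y' \<in> A e" using phi_mem[OF e(1), of v] v(1) by auto
    show False using s(7)
    proof
      assume c: "x' \<in> A n \<and> y' \<in> {0..t (n+1)}"
      then have "n = e" using atom_index_eq[OF s(6)] atom_index_eq[OF e(1,3)] by metis
      then show False using c ye atom_eq[OF e(1)] by auto
    next
      assume c: "y' \<in> A n \<and> x' \<in> {0..t (n+1)}"
      then have "n = e" using atom_index_eq[OF s(6)] atom_index_eq[OF e(1) ye] by metis
      then show False using c e(3) atom_eq[OF e(1)] by auto
    qed
  qed
  then show ?thesis using that Q by blast
qed

lemma eventually_mem_unit: "\<forall>\<^sub>F y in at x within {0..1::real}. y \<in> {0..1} \<and> y \<noteq> x"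
  by (auto simp: eventually_at_filter)

text \<open>For \<open>y\<close> in a deep cylinder of \<open>x\<close> the common word is long, so
  its slope, and with it the quotient, is large.\<close>

lemma mem_Theta_infinity:
  assumes x: "digits_le N x" and lim: "filterlim (\<lambda>k. drift (pre x k)) at_top sequentially"
  shows "x \<in> Theta_infinity A"
proof -
  have irr: "luroth_irrational A x" by (rule digits_leD(1)[OF x])
  have "filterlim (\<lambda>y. (\<theta> y - \<theta> x) / (y - x)) at_top (at x within {0..1})"
    unfolding filterlim_at_top
  proof
    fix Z :: real
    define c where "c = (1/2::real) ^ (2 * N + 1)"
    have c: "c > 0" by (simp add: c_def)
    obtain m where m: "\<And>k. k \<ge> m \<Longrightarrow> drift (pre x k) \<ge> ln (max Z 1 / c)"
      using lim unfolding filterlim_at_top eventually_sequentially by blast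
    have "\<forall>\<^sub>F y in at x within {0..1}. y \<in> cyl (pre x m)"
      using open_cyl[OF set_pre[OF irr]] irrational_mem_cyl[OF irr, of m]
      by (meson eventually_at_topological)
    then show "\<forall>\<^sub>F y in at x within {0..1}. Z \<le> (\<theta> y - \<theta> x) / (y - x)"
      using eventually_mem_unit
    proof eventually_elim
      case (elim y)
      obtain k where k: "(\<theta> y - \<theta> x) / (y - x) \<ge> c * exp (drift (pre x k))" "m \<le> k"
        using difference_quotient[OF x, of y, folded c_def] elim by metis
      have "max Z 1 / c = exp (ln (max Z 1 / c))" using c by (subst exp_ln) auto
      also have "\<dots> \<le> exp (drift (pre x k))" using m[OF k(2)] by (simp only: exp_le_cancel_iff)
      finally have "max Z 1 \<le> c * exp (drift (pre x k))" using c by (simp add: pos_divide_le_eq mult.commute)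
      then show ?case using k(1) by linarith
    qed
  qed
  then show ?thesis using irrational_unit[OF irr] by (auto simp: Theta_infinity_def)
qed

text \<open>The lower bound of \<open>difference_quotient\<close> excludes derivative 0. Derivative
  infinity is excluded along end points of the cylinders of \<open>x\<close>, where the quotient is
  at most \<open>2 * exp B\<close>.\<close>

lemma mem_Theta_sim:
  assumes x: "digits_le N x" and B: "\<And>k. \<bar>drift (pre x k)\<bar> \<le> B"
  shows "x \<in> Theta_sim A"
proof -
  have irr: "luroth_irrational A x" by (rule digits_leD(1)[OF x])
  have xu: "x \<in> {0..1}" using irrational_unit[OF irr] by auto
  let ?Q = "\<lambda>y. (\<theta> y - \<theta> x) / (y - x)"
  \<comment> \<open>The end of the unit interval farther from the orbit point, so that
    \<open>z k\<close> is at least half a cylinder length away from \<open>x\<close>.\<close>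
  define e where "e = (\<lambda>k. if (L ^^ k) x \<ge> 1/2 then 0 else 1::real)"
  define z where "z = (\<lambda>k. phis (pre x k) (e k))"
  have e: "e k \<in> {0..1}" "\<bar>(L ^^ k) x - e k\<bar> \<ge> 1/2" "\<bar>(L ^^ k) x - e k\<bar> \<le> 1" for k
    using orbit_unit[OF xu, of k] by (auto simp: e_def)
  have zx: "\<bar>x - z k\<bar> = lam (pre x k) * \<bar>(L ^^ k) x - e k\<bar>" for k
    unfolding z_def by (subst (1) irrational_funpow(2)[OF irr, of k]) (rule abs_phis_diff[OF set_pre[OF irr]])
  have zu: "z k \<in> {0..1}" for k unfolding z_def by (rule phis_unit[OF set_pre[OF irr] e(1)])
  have zne: "z k \<noteq> x" for k
  proof -
    have "\<bar>x - z k\<bar> > 0" unfolding zx using lam_pos[OF set_pre[OF irr]] e(2)[of k]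
      by (intro mult_pos_pos) auto
    then show ?thesis by auto
  qed
  have zQ: "?Q (z k) \<le> 2 * exp B" for k
  proof -
    let ?ds = "pre x k"
    have lu: "(L ^^ k) x \<in> {0..1}" by (rule orbit_unit[OF xu])
    have "\<bar>\<theta> x - \<theta> (z k)\<bar> = (1/2) ^ sum_list ?ds * \<bar>\<theta> ((L ^^ k) x) - \<theta> (e k)\<bar>"
    proof -
      have "\<theta> (phis ?ds ((L ^^ k) x)) - \<theta> (phis ?ds (e k)) =
         (-1) ^ length ?ds * (1/2) ^ sum_list ?ds * (\<theta> ((L ^^ k) x) - \<theta> (e k))"
        by (rule theta_phis_diff[OF set_pre[OF irr] lu e(1)])
      then show ?thesis using irrational_funpow(2)[OF irr, of k] by (simp add: z_def abs_mult power_abs)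
    qed
    also have "\<dots> \<le> (1/2) ^ sum_list ?ds * 1"
      using theta_unit[OF lu] theta_unit[OF e(1)[of k]] by (intro mult_left_mono) auto
    finally have 1: "\<bar>\<theta> x - \<theta> (z k)\<bar> \<le> (1/2) ^ sum_list ?ds" by simp
    have l: "lam ?ds > 0" by (rule lam_pos[OF set_pre[OF irr]])
    have 2: "\<bar>x - z k\<bar> \<ge> lam ?ds * (1/2)" unfolding zx using e(2)[of k] l by (intro mult_left_mono) auto
    have "?Q (z k) \<le> \<bar>?Q (z k)\<bar>" by (rule abs_ge_self)
    also have "\<dots> = \<bar>\<theta> x - \<theta> (z k)\<bar> / \<bar>x - z k\<bar>"
      by (simp only: abs_divide abs_minus_commute[of "\<theta> x"] abs_minus_commute[of x])
    also have "\<dots> \<le> (1/2) ^ sum_list ?ds / (lam ?ds * (1/2))" using 1 2 l by (intro frac_le) auto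
    also have "\<dots> = 2 * exp (drift ?ds)" by (simp add: exp_drift[OF set_pre[OF irr]])
    also have "\<dots> \<le> 2 * exp B" using B[of k] by simp
    finally show ?thesis .
  qed
  have "z \<longlonglongrightarrow> x"
  proof (rule Lim_null_comparison[THEN LIM_zero_cancel])
    show "\<forall>\<^sub>F k in sequentially. norm (z k - x) \<le> \<kappa> ^ k"
    proof (intro always_eventually allI)
      fix k
      have "\<bar>x - z k\<bar> \<le> lam (pre x k) * 1" unfolding zx using e(3)[of k] lam_pos[OF set_pre[OF irr]]
        by (intro mult_left_mono) (auto simp: less_imp_le)
      also have "\<dots> \<le> \<kappa> ^ k" using lam_le[OF set_pre[OF irr], of k] by simp
      finally show "norm (z k - x) \<le> \<kappa> ^ k" by (simp add: abs_minus_commute)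
    qed
    show "(\<lambda>k. \<kappa> ^ k) \<longlonglongrightarrow> 0" using \<kappa> by (intro LIMSEQ_power_zero) auto
  qed
  then have zlim: "filterlim z (at x within {0..1}) sequentially"
    using zu zne by (auto simp: filterlim_at)
  have "x \<notin> Theta_infinity A"
  proof
    assume "x \<in> Theta_infinity A"
    then have "filterlim ?Q at_top (at x within {0..1})" by (simp add: Theta_infinity_def)
    then have "filterlim (\<lambda>k. ?Q (z k)) at_top sequentially" by (rule filterlim_compose[OF _ zlim])
    then have "\<forall>\<^sub>F k in sequentially. 2 * exp B < ?Q (z k)" by (simp add: filterlim_at_top_dense)
    then obtain k where "2 * exp B < ?Q (z k)" by (auto simp: eventually_sequentially)
    then show False using zQ[of k] by simp
  qed
  moreover have "x \<notin> Theta_zero A"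
  proof
    assume "x \<in> Theta_zero A"
    then have "(?Q \<longlongrightarrow> 0) (at x within {0..1})" by (simp add: Theta_zero_def has_field_derivative_iff)
    then have "(\<lambda>k. ?Q (z k)) \<longlonglongrightarrow> 0" by (rule filterlim_compose[OF _ zlim])
    moreover have "?Q (z k) \<ge> (1/2) ^ (2 * N + 1) * exp (- B)" for k
    proof -
      obtain j where "?Q (z k) \<ge> (1/2) ^ (2 * N + 1) * exp (drift (pre x j))"
        using difference_quotient[OF x zu zne] by metis
      moreover have "(1/2) ^ (2 * N + 1) * exp (drift (pre x j)) \<ge> (1/2) ^ (2 * N + 1) * exp (- B)"
        using B[of j] by (intro mult_left_mono) auto
      ultimately show ?thesis by linarith
    qed
    ultimately have "(1/2) ^ (2 * N + 1) * exp (- B) \<le> 0" by (intro LIMSEQ_le_const) auto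
    moreover have "0 < (1/2::real) ^ (2 * N + 1) * exp (- B)"
      by (intro mult_pos_pos zero_less_power exp_gt_zero) simp
    ultimately show False by linarith
  qed
  ultimately show ?thesis using xu by (simp add: Theta_sim_def)
qed

lemma abs_drift_le: "set w \<subseteq> {1..N} \<Longrightarrow> \<bar>drift w\<bar> \<le> length w * (\<Sum>d=1..N. \<bar>log_ratio d\<bar>)"
proof -
  assume w: "set w \<subseteq> {1..N}"
  have "\<bar>sum_list (map log_ratio w)\<bar> \<le> length w * (\<Sum>d=1..N. \<bar>log_ratio d\<bar>)" using w
  proof (induction w)
    case (Cons n w)
    have "\<bar>log_ratio n\<bar> \<le> (\<Sum>d=1..N. \<bar>log_ratio d\<bar>)" using Cons.prems by (intro member_le_sum) auto
    then show ?case using Cons by (auto simp: algebra_simps)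
  qed simp
  moreover have "set w \<subseteq> {1..}" using w by auto
  ultimately show ?thesis by (simp add: sum_list_log_ratio)
qed

text \<open>Every prefix of \<open>x\<close> extends some stage \<open>p n\<close> by at most
  \<open>M\<close> letters, so drifts along all prefixes follow those at the stages up to a
  constant. The bound on \<open>k\<close> ensures that long prefixes belong to late stages.\<close>

lemma branch_digits:
  assumes p: "branch W p" and W: "\<And>h. W h \<subseteq> (\<Union>m\<in>{1..M}. words {1..N} m)"
    and x: "\<And>n. x \<in> cyl (p n)"
  shows "digits_le N x" "set (p n) \<subseteq> {1..N}" "p n = pre x (length (p n))"
    "\<exists>n. k < (n + 1) * M \<and> \<bar>drift (pre x k) - drift (p n)\<bar> \<le> M * (\<Sum>d=1..N. \<bar>log_ratio d\<bar>)"
proof -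
  have ext: "\<exists>w. p (Suc n) = p n @ w \<and> length w \<ge> 1 \<and> length w \<le> M \<and> set w \<subseteq> {1..N}" for n
  proof -
    obtain w where w: "w \<in> W (p n)" "p (Suc n) = p n @ w" using p unfolding branch_def by blast
    then obtain m where "m \<in> {1..M}" "w \<in> words {1..N} m" using W[of "p n"] by blast
    then show ?thesis using w(2) by (intro exI[of _ w]) (auto simp: words_def)
  qed
  have all: "set (p n) \<subseteq> {1..N} \<and> length (p n) \<ge> n \<and> length (p n) \<le> n * M" for n
  proof (induction n)
    case 0
    then show ?case using p by (simp add: branch_def)
  next
    case (Suc n)
    obtain w where "p (Suc n) = p n @ w" "length w \<ge> 1" "length w \<le> M" "set w \<subseteq> {1..N}" using ext by blast
    then show ?case using Suc by auto
  qed
  then show pN: "set (p n) \<subseteq> {1..N}" for n by blast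
  have pv: "set (p n) \<subseteq> {1..}" for n using pN[of n] by auto
  have irr: "luroth_irrational A x"
    by (rule irrational_of_cyl) (use all pv x in blast)
  show pp: "p n = pre x (length (p n))" for n using mem_cyl_pre[OF pv x] by simp
  have dN: "digit x (Suc k) \<le> N" for k
  proof -
    have "Suc k \<in> set [1..<length (p (Suc k)) + 1]" using all[of "Suc k"] by (simp del: upt_Suc)
    then have "digit x (Suc k) \<in> set (pre x (length (p (Suc k))))" unfolding pre_def by (metis image_eqI set_map)
    then show ?thesis using pN[of "Suc k"] pp[of "Suc k"] by auto
  qed
  then show "digits_le N x" using irr by (simp add: digits_le_def)
  let ?XN = "\<Sum>d=1..N. \<bar>log_ratio d\<bar>"
  define n where "n = (LEAST n. k < length (p (Suc n)))"
  have "k < length (p (Suc k))" using all[of "Suc k"] by simp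
  then have n: "k < length (p (Suc n))" unfolding n_def by (rule LeastI)
  have le: "length (p n) \<le> k"
  proof (cases n)
    case 0
    then show ?thesis using p by (simp add: branch_def)
  next
    case (Suc m)
    then have "\<not> k < length (p (Suc m))" unfolding n_def using not_less_Least[of m "\<lambda>n. k < length (p (Suc n))"] by simp
    then show ?thesis using Suc by simp
  qed
  have M: "length (p (Suc n)) \<le> length (p n) + M" using ext[of n] by auto
  have kM: "k < (n + 1) * M" using n all[of "Suc n"] by simp
  define w where "w = map (\<lambda>i. digit x (length (p n) + i)) [1..<(k - length (p n)) + 1]"
  have eq: "pre x k = p n @ w" using pre_append[of x "length (p n)" "k - length (p n)"] le pp[of n] by (simp add: w_def del: upt_Suc)
  have wN: "set w \<subseteq> {1..N}"
  proof
    fix d assume "d \<in> set w"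
    then obtain i where i: "i \<ge> 1" "d = digit x (length (p n) + i)" by (auto simp: w_def simp del: upt_Suc)
    then obtain j where "length (p n) + i = Suc j" by (cases i) auto
    then show "d \<in> {1..N}" using i dN[of j] irrational_digit_ge_1[OF irr, of "Suc j"] by simp
  qed
  have wv: "set w \<subseteq> {1..}" using wN by auto
  have "length w = k - length (p n)" by (simp add: w_def del: upt_Suc)
  then have lw: "length w \<le> M" using n M by linarith
  have "\<bar>drift (pre x k) - drift (p n)\<bar> = \<bar>drift w\<bar>" unfolding eq using drift_append[OF pv wv] by simp
  also have "\<dots> \<le> length w * ?XN" by (rule abs_drift_le[OF wN])
  also have "\<dots> \<le> M * ?XN" using lw by (intro mult_right_mono) (auto intro!: sum_nonneg)
  finally show "\<exists>n. k < (n + 1) * M \<and> \<bar>drift (pre x k) - drift (p n)\<bar> \<le> M * ?XN" using kM by blast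
qed

section \<open>Farey cylinders and the Lyapunov spectrum\<close>

lemma farey_code_prefix_eq: "farey_code_prefix A x n = take n (code (pre x n))"
  by (simp add: farey_code_prefix_def code_def pre_def code_block_def o_def del: upt_Suc)

lemma pre_le: assumes "k \<le> m" obtains es where "pre x m = pre x k @ es"
  using pre_append[of x k "m - k"] assms that by auto

lemma farey_code_prefix_mono:
  assumes "n \<le> m" shows "farey_code_prefix A x n = take n (code (pre x m))"
proof -
  obtain es where es: "pre x m = pre x n @ es" using pre_le[OF assms] .
  have "n \<le> length (code (pre x n))" using length_code_ge[of "pre x n"] by simp
  then show ?thesis by (simp add: farey_code_prefix_eq es)
qed

lemma farey_cylinder_antimono:
  assumes "n \<le> m" shows "farey_cylinder A m x \<subseteq> farey_cylinder A n x"
  unfolding farey_cylinder_def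
proof (intro closure_mono subsetI CollectI)
  fix y assume y: "y \<in> {y. luroth_irrational A y \<and> farey_code_prefix A y m = farey_code_prefix A x m}"
  have "farey_code_prefix A z n = take n (farey_code_prefix A z m)" for z
    using assms by (simp add: farey_code_prefix_mono[OF assms] farey_code_prefix_eq[of z m] min_absorb1)
  then show "luroth_irrational A y \<and> farey_code_prefix A y n = farey_code_prefix A x n" using y by simp
qed

lemma farey_code_prefix_luroth:
  assumes "luroth_irrational A x" "n = sum_list (pre x k)"
  shows "farey_code_prefix A x n = code (pre x k)"
proof -
  have "k \<le> n" using length_le_sum_list[OF set_pre[OF assms(1)], of k] assms(2) by simp
  then obtain es where es: "pre x n = pre x k @ es" using pre_le by blast
  have "length (code (pre x k)) = n" using length_code[OF set_pre[OF assms(1)]] assms(2) by simp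
  then show ?thesis by (simp add: farey_code_prefix_eq es)
qed

text \<open>At a level that completes a block, \<open>code_decode\<close> turns equality of code
  prefixes into equality of the first \<open>k\<close> digits.\<close>

lemma farey_cylinder_luroth:
  assumes x: "luroth_irrational A x" and n: "n = sum_list (pre x k)"
  shows "farey_cylinder A n x = closure {y. luroth_irrational A y \<and> pre y k = pre x k}"
proof -
  have kn: "k \<le> n" using length_le_sum_list[OF set_pre[OF x], of k] n by simp
  have "farey_code_prefix A y n = farey_code_prefix A x n \<longleftrightarrow> pre y k = pre x k"
    if y: "luroth_irrational A y" for y
  proof
    assume "farey_code_prefix A y n = farey_code_prefix A x n"
    then have "take (sum_list (pre x k)) (code (pre y n)) = code (pre x k)"
      using farey_code_prefix_luroth[OF x n] n by (simp add: farey_code_prefix_eq)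
    then have "take (length (pre x k)) (pre y n) = pre x k"
      using set_pre[OF x] set_pre[OF y] kn by (intro code_decode) auto
    moreover obtain es where "pre y n = pre y k @ es" using pre_le[OF kn] .
    ultimately show "pre y k = pre x k" by simp
  next
    assume "pre y k = pre x k"
    then show "farey_code_prefix A y n = farey_code_prefix A x n"
      using farey_code_prefix_luroth[OF x n] farey_code_prefix_luroth[OF y, of n k] n by simp
  qed
  then show ?thesis unfolding farey_cylinder_def by (intro arg_cong[where f=closure]) auto
qed

text \<open>\<open>ds\<close> and \<open>n\<close> are left unconstrained: the form only serves to
  show that the points with a finite expansion are countable.\<close>

lemma terminates_form:
  "luroth_terminates_at A x m \<Longrightarrow> x \<in> {0<..1} \<Longrightarrow> \<exists>ds n. x = phis ds (t n)"
proof (induction m arbitrary: x)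
  case (Suc m)
  show ?case
  proof (cases "m = 0")
    case True
    then have "(\<exists>n\<ge>2. x = t n) \<or> x = t 1" using Suc.prems(1) tail_1 by (auto simp: luroth_terminates_at_def)
    then obtain n where "x = t n" by blast
    then show ?thesis by (intro exI[of _ "[]"] exI[of _ n]) simp
  next
    case False
    obtain n where n: "n \<ge> 1" "x \<in> A n" using Suc.prems(2) atom_cases[of x] by auto
    have pos: "(L ^^ m) x > 0" using terminates_orbit(1)[OF Suc.prems(1)] by simp
    then have "L x \<noteq> 0" using False orbit_zero_mono[of 1 x m] by auto
    then have Lx: "L x \<in> {0<..<1}" using luroth_map_atom(2)[OF n] by auto
    have x: "x = phi n (L x)" using luroth_map_atom(3)[OF n] by simp
    have "luroth_terminates_at A (L x) m"
      using terminates_phi(2)[OF n(1) Lx, of m] False Suc.prems(1) x by simp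
    then obtain ds k where "L x = phis ds (t k)" using Suc.IH Lx by fastforce
    then have "x = phis (n # ds) (t k)" using x by simp
    then show ?thesis by blast
  qed
qed (simp add: luroth_terminates_at_def)

lemma countable_rational: "countable {x \<in> {0<..1}. \<not> luroth_irrational A x}"
proof (rule countable_subset)
  show "{x \<in> {0<..1}. \<not> luroth_irrational A x} \<subseteq> range (\<lambda>(ds, n). phis ds (t n))"
    using terminates_form by (fastforce simp: luroth_irrational_def)
qed auto

text \<open>A squeeze: the closure lies in the closed interval spanned by
  \<open>cyl (pre x k)\<close> and contains that cylinder up to a countable set.\<close>

lemma farey_cylinder_measure:
  assumes x: "luroth_irrational A x"
  shows "measure lborel (farey_cylinder A (sum_list (pre x k)) x) = lam (pre x k)"
proof -
  let ?ds = "pre x k"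
  let ?S = "{y. luroth_irrational A y \<and> pre y k = ?ds}"
  let ?R = "{x \<in> {0<..1}. \<not> luroth_irrational A x}"
  have v: "set ?ds \<subseteq> {1..}" by (rule set_pre[OF x])
  have l: "lam ?ds > 0" by (rule lam_pos[OF v])
  obtain a b where ab: "cyl ?ds = {a<..<b}" "b - a = lam ?ds" using cyl_eq[OF v] .
  have "?S \<subseteq> cyl ?ds"
  proof
    fix y assume "y \<in> ?S"
    then show "y \<in> cyl ?ds" using irrational_mem_cyl[of y k] by simp
  qed
  then have "closure ?S \<subseteq> {a..b}"
    using ab l by (metis closure_greaterThanLessThan closure_mono diff_gt_0_iff_gt)
  then have up: "emeasure lborel (closure ?S) \<le> emeasure lborel {a..b}" by (intro emeasure_mono) auto
  have R: "?R \<in> null_sets lborel" using countable_rational by (rule countable_imp_null_set_lborel)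
  have "cyl ?ds - ?R \<subseteq> ?S"
  proof
    fix y assume y: "y \<in> cyl ?ds - ?R"
    then obtain w where w: "w \<in> {0<..<1}" "y = phis ?ds w" by (auto simp: cyl_def)
    have "y \<in> {0<..<1}" unfolding w(2) by (rule phis_unit_open[OF v w(1)])
    then have "luroth_irrational A y" using y by auto
    moreover have "pre y (length ?ds) = ?ds" by (rule mem_cyl_pre[OF v]) (use y in auto)
    ultimately show "y \<in> ?S" by simp
  qed
  also have "?S \<subseteq> closure ?S" by (rule closure_subset)
  finally have "emeasure lborel (cyl ?ds - ?R) \<le> emeasure lborel (closure ?S)"
    by (intro emeasure_mono) auto
  moreover have "emeasure lborel (cyl ?ds - ?R) = emeasure lborel (cyl ?ds)"
    using R open_cyl[OF v] by (intro emeasure_Diff_null_set) auto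
  ultimately have "ennreal (lam ?ds) \<le> emeasure lborel (closure ?S)" by (simp add: emeasure_cyl[OF v])
  moreover have "emeasure lborel {a..b} = ennreal (lam ?ds)" using ab l by simp
  ultimately have "emeasure lborel (closure ?S) = ennreal (lam ?ds)" using up by auto
  then show ?thesis
    using farey_cylinder_luroth[OF x refl, of k] l by (simp add: measure_def)
qed

lemma farey_cylinder_unit: "farey_cylinder A n x \<subseteq> {0..1}"
  unfolding farey_cylinder_def
  by (rule closure_minimal) (auto simp: luroth_irrational_def)

lemma measure_farey_cylinder_mono:
  assumes "n \<le> m"
  shows "measure lborel (farey_cylinder A m x) \<le> measure lborel (farey_cylinder A n x)"
proof (rule measure_mono_fmeasurable[OF farey_cylinder_antimono[OF assms]])
  have b: "farey_cylinder A k x \<in> sets lborel" for k by (simp add: farey_cylinder_def)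
  then show "farey_cylinder A m x \<in> sets lborel" .
  have "emeasure lborel (farey_cylinder A n x) \<le> emeasure lborel {0..1::real}"
    by (intro emeasure_mono farey_cylinder_unit) auto
  then show "farey_cylinder A n x \<in> fmeasurable lborel"
    using b by (intro fmeasurableI) (auto simp: order_le_less_trans)
qed

lemma sum_list_pre_ge: "luroth_irrational A x \<Longrightarrow> sum_list (pre x k) \<ge> k"
  using length_le_sum_list[OF set_pre, of x k] by simp

lemma ln_lam: "set ds \<subseteq> {1..} \<Longrightarrow> ln (lam ds) = - (real (sum_list ds) * ln 2) - drift ds"
  using lam_pos[of ds] by (simp add: drift_def ln_div ln_realpow)

text \<open>At completed blocks the logarithm of the measure is \<open>- n * ln 2\<close> up to the
  bounded drift. Between them, monotonicity and bounded digits add a bounded error, which disappears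
  after division by \<open>n\<close>.\<close>

lemma mem_lyapunov_level:
  assumes x: "digits_le N x" and B: "\<And>k. \<bar>drift (pre x k)\<bar> \<le> B"
  shows "x \<in> lyapunov_level A (ln 2)"
proof -
  have irr: "luroth_irrational A x" by (rule digits_leD(1)[OF x])
  define \<mu> where "\<mu> = (\<lambda>n. measure lborel (farey_cylinder A n x))"
  define K where "K = real N * ln 2 + B"
  let ?\<sigma> = "\<lambda>k. sum_list (pre x k)"
  have \<mu>\<sigma>: "\<mu> (?\<sigma> k) = lam (pre x k)" for k unfolding \<mu>_def by (rule farey_cylinder_measure[OF irr])
  have bound: "\<bar>ln (\<mu> n) + real n * ln 2\<bar> \<le> K" for n
  proof -
    define k where "k = (LEAST k. n < ?\<sigma> (Suc k))"
    have "n < ?\<sigma> (Suc n)" using sum_list_pre_ge[OF irr, of "Suc n"] by simp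
    then have k1: "n < ?\<sigma> (Suc k)" unfolding k_def by (rule LeastI)
    have k0: "?\<sigma> k \<le> n"
    proof (cases k)
      case 0
      then show ?thesis by (simp add: pre_def)
    next
      case (Suc m)
      then have "\<not> n < ?\<sigma> (Suc m)" unfolding k_def using not_less_Least[of m "\<lambda>k. n < ?\<sigma> (Suc k)"] by simp
      then show ?thesis using Suc by simp
    qed
    have "?\<sigma> (Suc k) = ?\<sigma> k + digit x (Suc k)" by (simp add: pre_Suc)
    moreover have "digit x (Suc k) \<le> N" using x by (simp add: digits_le_def)
    ultimately have \<sigma>: "?\<sigma> (Suc k) \<le> ?\<sigma> k + N" by simp
    have lo: "lam (pre x (Suc k)) \<le> \<mu> n"
      using measure_farey_cylinder_mono[of n "?\<sigma> (Suc k)" x] k1 \<mu>\<sigma>[of "Suc k"] by (simp add: \<mu>_def)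
    have up: "\<mu> n \<le> lam (pre x k)"
      using measure_farey_cylinder_mono[of "?\<sigma> k" n x] k0 \<mu>\<sigma>[of k] by (simp add: \<mu>_def)
    have pos: "0 < lam (pre x (Suc k))" by (rule lam_pos[OF set_pre[OF irr]])
    have "ln (lam (pre x (Suc k))) \<le> ln (\<mu> n)" using lo pos by simp
    moreover have "ln (\<mu> n) \<le> ln (lam (pre x k))" using up lo pos by simp
    moreover have "ln (lam (pre x j)) = - (real (?\<sigma> j) * ln 2) - drift (pre x j)" for j
      by (rule ln_lam[OF set_pre[OF irr]])
    ultimately have "- (real (?\<sigma> (Suc k)) * ln 2) - drift (pre x (Suc k)) \<le> ln (\<mu> n)"
      "ln (\<mu> n) \<le> - (real (?\<sigma> k) * ln 2) - drift (pre x k)" by simp_all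
    moreover have "real (?\<sigma> (Suc k)) * ln 2 \<le> (real n + N) * ln 2" using \<sigma> k0 by (intro mult_right_mono) auto
    moreover have "(real n - N) * ln 2 \<le> real (?\<sigma> k) * ln 2" using \<sigma> k1 by (intro mult_right_mono) auto
    ultimately show ?thesis using B[of k] B[of "Suc k"] by (simp add: K_def algebra_simps abs_le_iff)
  qed
  have "(\<lambda>n. ln (\<mu> n) / (- real n) - ln 2) \<longlonglongrightarrow> 0"
  proof (rule Lim_null_comparison)
    show "\<forall>\<^sub>F n in sequentially. norm (ln (\<mu> n) / (- real n) - ln 2) \<le> K / real n"
      using eventually_gt_at_top[of "0::nat"]
    proof eventually_elim
      case (elim n)
      have "ln (\<mu> n) / (- real n) - ln 2 = - ((ln (\<mu> n) + real n * ln 2) / real n)"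
        using elim by (simp add: field_simps)
      then have "norm (ln (\<mu> n) / (- real n) - ln 2) = \<bar>ln (\<mu> n) + real n * ln 2\<bar> / real n"
        by (simp add: abs_divide)
      also have "\<dots> \<le> K / real n" using bound[of n] by (intro divide_right_mono) auto
      finally show ?case .
    qed
    show "(\<lambda>n. K / real n) \<longlonglongrightarrow> 0" by (rule lim_const_over_n)
  qed
  then have "(\<lambda>n. ln (\<mu> n) / (- real n)) \<longlonglongrightarrow> ln 2" by (rule LIM_zero_cancel)
  then show ?thesis using irr by (simp add: lyapunov_level_def \<mu>_def)
qed

text \<open>Membership only gives lengths \<open>2^(-n(1 + o(1)))\<close> at completed blocks. With
  \<open>\<gamma> < 1\<close> they are eventually at most \<open>2^(-\<gamma> n)\<close>, so the
  cylinders of \<open>x\<close> themselves are the covering sets; the loss is paid for by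
  \<open>\<eta>\<close>, since \<open>\<gamma> * (q + \<eta>) = q\<close>.\<close>

lemma hausdorff_measure_lyapunov_level:
  assumes f: "feasible u q" and \<eta>: "\<eta> > 0"
  shows "hausdorff_measure (u + (q + \<eta>)) (lyapunov_level A (ln 2)) = 0"
proof -
  have uq: "0 \<le> u" "0 < q" using f by (auto simp: feasible_def)
  define I where "I = {ds. set ds \<subseteq> {1::nat..}}"
  define \<gamma> where "\<gamma> = q / (q + \<eta>)"
  have \<gamma>: "0 < \<gamma>" "\<gamma> < 1" "\<gamma> * (q + \<eta>) = q" using uq \<eta> by (auto simp: \<gamma>_def)
  define h where "h = (\<lambda>ds. ((1/2::real) ^ sum_list ds) powr \<gamma>)"
  define r where "r = (\<lambda>ds. min (lam ds) (h ds))"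
  \<comment> \<open>Words whose cylinder is too long get the empty set, so that every diameter is at
    most \<open>r ds\<close>.\<close>
  define B where "B = (\<lambda>ds. if lam ds \<le> h ds then cyl ds else {})"
  have r0: "r ds \<ge> 0" if "ds \<in> I" for ds using that lam_pos[of ds] by (auto simp: r_def h_def I_def)
  show ?thesis
  proof (rule hausdorff_measure_limsup_zero_countable[of _ I B r])
    show "u + (q + \<eta>) > 0" using uq \<eta> by simp
    show "countable I" by (rule countableI_type)
    show "infinite I"
    proof
      assume "finite I"
      then have "finite (length ` I)" by simp
      moreover have "length ` I = UNIV"
      proof (intro equalityI subsetI UNIV_I)
        fix n :: nat
        show "n \<in> length ` I" by (rule image_eqI[of _ _ "replicate n 1"]) (auto simp: I_def)
      qed
      ultimately show False by simp
    qed
    fix ds assume ds: "ds \<in> I"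
    then have v: "set ds \<subseteq> {1..}" by (simp add: I_def)
    obtain a b where ab: "cyl ds = {a<..<b}" "b - a = lam ds" using cyl_eq[OF v] .
    then show "bounded (B ds)" by (simp add: B_def)
    have "diameter (cyl ds) \<le> lam ds"
      using ab lam_pos[OF v] by (simp add: diameter_open_interval)
    then show "diameter (B ds) \<le> r ds" using r0[OF ds] by (auto simp: B_def r_def diameter_empty)
  next
    show "(\<lambda>ds. r ds powr (u + (q + \<eta>))) summable_on I"
    proof (rule summable_on_comparison_test)
      show "(\<lambda>ds. lam ds powr u * ((1/2) ^ sum_list ds) powr q) summable_on I"
        unfolding I_def by (rule summable_on_weights(1)[OF f])
      fix ds assume ds: "ds \<in> I"
      have "r ds powr (u + (q + \<eta>)) = r ds powr u * r ds powr (q + \<eta>)" by (rule powr_add)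
      also have "\<dots> \<le> lam ds powr u * h ds powr (q + \<eta>)"
        using uq \<eta> r0[OF ds] by (intro mult_mono powr_mono2) (auto simp: r_def)
      also have "h ds powr (q + \<eta>) = ((1/2) ^ sum_list ds) powr q"
        using \<gamma>(3) by (simp add: h_def powr_powr)
      finally show "r ds powr (u + (q + \<eta>)) \<le> lam ds powr u * ((1/2) ^ sum_list ds) powr q" .
    qed simp
  next
    fix x assume x: "x \<in> lyapunov_level A (ln 2)"
    then have irr: "luroth_irrational A x" by (simp add: lyapunov_level_def)
    let ?\<sigma> = "\<lambda>k. sum_list (pre x k)"
    have "filterlim ?\<sigma> sequentially sequentially"
      by (rule filterlim_at_top_mono[OF filterlim_ident]) (use sum_list_pre_ge[OF irr] in auto)
    then have "(\<lambda>k. ln (measure lborel (farey_cylinder A (?\<sigma> k) x)) / (- real (?\<sigma> k))) \<longlonglongrightarrow> ln 2"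
      using x unfolding lyapunov_level_def by (auto intro: filterlim_compose)
    then have "(\<lambda>k. ln (lam (pre x k)) / (- real (?\<sigma> k))) \<longlonglongrightarrow> ln 2"
      by (simp only: farey_cylinder_measure[OF irr])
    then have "\<forall>\<^sub>F k in sequentially. ln (lam (pre x k)) / (- real (?\<sigma> k)) > \<gamma> * ln 2"
      by (rule order_tendstoD) (use \<gamma> in auto)
    then obtain k0 where k0: "\<And>k. k \<ge> k0 \<Longrightarrow> ln (lam (pre x k)) / (- real (?\<sigma> k)) > \<gamma> * ln 2"
      by (auto simp: eventually_sequentially)
    have mem: "pre x k \<in> {ds \<in> I. x \<in> B ds}" if k: "k \<ge> max k0 1" for k
    proof -
      have \<sigma>: "real (?\<sigma> k) > 0" using sum_list_pre_ge[OF irr, of k] k by simp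
      have v: "set (pre x k) \<subseteq> {1..}" by (rule set_pre[OF irr])
      have "\<gamma> * ln 2 < - (ln (lam (pre x k)) / real (?\<sigma> k))" using k0[of k] k by simp
      then have "\<gamma> * ln 2 * real (?\<sigma> k) < - ln (lam (pre x k))" using \<sigma> by (simp add: field_simps)
      then have "ln (lam (pre x k)) \<le> \<gamma> * (real (?\<sigma> k) * - ln 2)" by (simp add: algebra_simps)
      also have "\<dots> = ln (h (pre x k))" by (simp add: h_def ln_powr ln_realpow ln_div)
      finally have "lam (pre x k) \<le> h (pre x k)"
        using lam_pos[OF v] by (subst (asm) ln_le_cancel_iff) (auto simp: h_def)
      then show ?thesis using irrational_mem_cyl[OF irr] v by (simp add: B_def I_def)
    qed
    show "infinite {ds \<in> I. x \<in> B ds}"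
    proof
      assume "finite {ds \<in> I. x \<in> B ds}"
      then have "finite (pre x ` {max k0 1..})" by (rule finite_subset[rotated]) (use mem in force)
      moreover have "inj_on (pre x) {max k0 1..}" by (rule inj_onI) (metis length_pre)
      ultimately show False using infinite_Ici[of "max k0 1"] by (simp add: finite_image_iff)
    qed
  qed
qed

section \<open>The lower bound\<close>

text \<open>Appending only words of positive drift makes the derivative infinite; choosing the sign of
  the drift against the current one keeps it bounded, which yields neither derivative 0 nor
  infinity and the exponent \<open>ln 2\<close> at once.\<close>

lemma hausdorff_measure_lower:
  assumes nd: "\<not> dyadic_partition A" and s: "0 < s" "s < 1"
    and D: "\<And>u q. feasible u q \<Longrightarrow> D \<le> u + q" "s < D"
  shows "hausdorff_measure s (Theta_infinity A) \<noteq> 0"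
    "hausdorff_measure s (Theta_sim A \<inter> lyapunov_level A (ln 2)) \<noteq> 0"
proof -
  obtain W1 where W1: "good_words s W1" "\<And>w. w \<in> W1 \<Longrightarrow> drift w > 0"
    using exists_good_words(1)[OF assms] by blast
  obtain W2 where W2: "good_words s W2" "\<And>w. w \<in> W2 \<Longrightarrow> drift w < 0"
    using exists_good_words(2)[OF assms] by blast
  obtain N1 M1 where 1: "finite W1" "M1 > 0" "W1 \<subseteq> words {1..N1} M1" using W1(1) unfolding good_words_def by blast
  obtain N2 M2 where 2: "finite W2" "M2 > 0" "W2 \<subseteq> words {1..N2} M2" using W2(1) unfolding good_words_def by blast
  define N where "N = max N1 N2"
  define M where "M = max M1 M2"
  have sub1: "W1 \<subseteq> (\<Union>m\<in>{1..M}. words {1..N} m)"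
  proof
    fix w assume "w \<in> W1"
    then have "w \<in> words {1..N1} M1" using 1 by blast
    then have "w \<in> words {1..N} M1" using words_mono[of "{1..N1}" "{1..N}"] by (auto simp: N_def)
    then show "w \<in> (\<Union>m\<in>{1..M}. words {1..N} m)" using 1(2) by (intro UN_I[of M1]) (auto simp: M_def)
  qed
  have sub2: "W2 \<subseteq> (\<Union>m\<in>{1..M}. words {1..N} m)"
  proof
    fix w assume "w \<in> W2"
    then have "w \<in> words {1..N2} M2" using 2 by blast
    then have "w \<in> words {1..N} M2" using words_mono[of "{1..N2}" "{1..N}"] by (auto simp: N_def)
    then show "w \<in> (\<Union>m\<in>{1..M}. words {1..N} m)" using 2(2) by (intro UN_I[of M2]) (auto simp: M_def)
  qed
  define B0 where "B0 = M * (\<Sum>d=1..N. \<bar>log_ratio d\<bar>)"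
  have dw: "set w \<subseteq> {1..}" "\<bar>drift w\<bar> \<le> B0" if w: "w \<in> W1 \<union> W2" for w
  proof -
    have "w \<in> (\<Union>m\<in>{1..M}. words {1..N} m)" using w sub1 sub2 by blast
    then obtain m where "m \<in> {1..M}" "w \<in> words {1..N} m" by blast
    then have m: "m \<le> M" "set w \<subseteq> {1..N}" "length w = m" by (simp_all add: words_def)
    then show "set w \<subseteq> {1..}" by auto
    have "\<bar>drift w\<bar> \<le> length w * (\<Sum>d=1..N. \<bar>log_ratio d\<bar>)" by (rule abs_drift_le[OF m(2)])
    also have "\<dots> \<le> B0" unfolding B0_def using m by (intro mult_right_mono) (auto intro!: sum_nonneg)
    finally show "\<bar>drift w\<bar> \<le> B0" .
  qed
  have B0: "B0 \<ge> 0" unfolding B0_def by (intro mult_nonneg_nonneg sum_nonneg) auto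
  show "hausdorff_measure s (Theta_infinity A) \<noteq> 0"
  proof (rule hausdorff_measure_moran[of s W1 W1 "\<lambda>_. W1"])
    fix p x assume p: "branch (\<lambda>_. W1) p" "\<And>n. x \<in> cyl (p n)"
    note bd = branch_digits[OF p(1) sub1 p(2)]
    have ne: "W1 \<noteq> {}" using W1(1) by (auto simp: good_words_def)
    define \<delta> where "\<delta> = Min (drift ` W1)"
    have "\<delta> \<in> drift ` W1" unfolding \<delta>_def using ne 1 by (intro Min_in) auto
    then have \<delta>: "\<delta> > 0" using W1(2) by auto
    have \<delta>le: "\<delta> \<le> drift w" if "w \<in> W1" for w unfolding \<delta>_def using that 1 by (intro Min_le) auto
    have pn: "drift (p n) \<ge> n * \<delta>" for n
    proof (induction n)
      case 0
      then show ?case using p(1) by (simp add: branch_def drift_def)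
    next
      case (Suc n)
      obtain w where w: "w \<in> W1" "p (Suc n) = p n @ w" using p(1) unfolding branch_def by blast
      have "drift (p (Suc n)) = drift (p n) + drift w"
        unfolding w(2) using bd(2)[of n] dw(1)[of w] w(1) by (intro drift_append) auto
      then show ?case using Suc \<delta>le[OF w(1)] by (simp add: algebra_simps)
    qed
    have M: "M > 0" using 1 by (simp add: M_def)
    have low: "drift (pre x k) \<ge> (real k / M - 1) * \<delta> - B0" for k
    proof -
      obtain n where n: "k < (n + 1) * M" "\<bar>drift (pre x k) - drift (p n)\<bar> \<le> B0"
        using bd(4)[of k] unfolding B0_def by blast
      have "real k < (real n + 1) * real M" using n(1) by (metis of_nat_1 of_nat_add of_nat_less_iff of_nat_mult)
      then have "real k / M - 1 \<le> n" using M by (simp add: field_simps)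
      then have "(real k / M - 1) * \<delta> \<le> n * \<delta>" using \<delta> by (intro mult_right_mono) auto
      then show ?thesis using n(2) pn[of n] by linarith
    qed
    have "filterlim (\<lambda>k. (real k / M - 1) * \<delta> - B0) at_top sequentially"
      using M \<delta> by real_asymp
    then have "filterlim (\<lambda>k. drift (pre x k)) at_top sequentially"
      by (rule filterlim_at_top_mono) (use low in auto)
    then show "x \<in> Theta_infinity A" using bd(1) by (intro mem_Theta_infinity)
  qed (use s W1 in auto)
  let ?W = "\<lambda>h. if drift h \<le> 0 then W1 else W2"
  show "hausdorff_measure s (Theta_sim A \<inter> lyapunov_level A (ln 2)) \<noteq> 0"
  proof (rule hausdorff_measure_moran[of s W1 W2 ?W])
    fix p x assume p: "branch ?W p" "\<And>n. x \<in> cyl (p n)"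
    have sub: "?W h \<subseteq> (\<Union>m\<in>{1..M}. words {1..N} m)" for h using sub1 sub2 by simp
    note bd = branch_digits[OF p(1) sub p(2)]
    have pn: "\<bar>drift (p n)\<bar> \<le> B0" for n
    proof (induction n)
      case 0
      then show ?case using p(1) B0 by (simp add: branch_def drift_def)
    next
      case (Suc n)
      obtain w where w: "w \<in> ?W (p n)" "p (Suc n) = p n @ w" using p(1) unfolding branch_def by blast
      have w12: "w \<in> W1 \<union> W2" using w(1) by (auto split: if_splits)
      have eq: "drift (p (Suc n)) = drift (p n) + drift w"
        unfolding w(2) using bd(2)[of n] dw(1)[OF w12] by (intro drift_append) auto
      show ?case
      proof (cases "drift (p n) \<le> 0")
        case True
        then have "drift w > 0" using w(1) W1(2) by auto
        then show ?thesis using eq Suc dw(2)[OF w12] True by linarith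
      next
        case False
        then have "drift w < 0" using w(1) W2(2) by auto
        then show ?thesis using eq Suc dw(2)[OF w12] False by linarith
      qed
    qed
    have "\<bar>drift (pre x k)\<bar> \<le> 2 * B0" for k
    proof -
      obtain n where "\<bar>drift (pre x k) - drift (p n)\<bar> \<le> B0" using bd(4)[of k] unfolding B0_def by blast
      then show ?thesis using pn[of n] by linarith
    qed
    then show "x \<in> Theta_sim A \<inter> lyapunov_level A (ln 2)"
      using mem_Theta_sim[OF bd(1)] mem_lyapunov_level[OF bd(1)] by blast
  qed (use s W1 W2 in auto)
qed

lemma Theta_infinity_disjoint: "Theta_infinity A \<subseteq> {0..1} - Theta_zero A"
proof
  fix x assume x: "x \<in> Theta_infinity A"
  let ?F = "at x within {0..1::real}"
  have xu: "x \<in> {0..1}" using x by (simp add: Theta_infinity_def)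
  have nt: "?F \<noteq> bot" using xu by (auto simp: trivial_limit_within islimpt_Icc)
  have "x \<notin> Theta_zero A"
  proof
    assume "x \<in> Theta_zero A"
    then have "((\<lambda>y. (\<theta> y - \<theta> x) / (y - x)) \<longlongrightarrow> 0) ?F" by (simp add: Theta_zero_def has_field_derivative_iff)
    moreover have "filterlim (\<lambda>y. (\<theta> y - \<theta> x) / (y - x)) at_top ?F" using x by (simp add: Theta_infinity_def)
    ultimately show False using not_tendsto_and_filterlim_at_infinity[OF nt]
      filterlim_at_top_imp_at_infinity by blast
  qed
  then show "x \<in> {0..1} - Theta_zero A" using xu by simp
qed

end

theorem theorem1:
  fixes A :: "nat \<Rightarrow> real set"
  assumes "luroth_partition A"
    and "\<not> dyadic_partition A"
    and "expanding A \<or> (\<exists>\<tau>\<ge>0. expansive A \<tau> \<and> eventually_decreasing A)"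
  shows "hausdorff_dim (Theta_infinity A) = hausdorff_dim (Theta_sim A) \<and>
         hausdorff_dim (Theta_sim A) = hausdorff_dim (lyapunov_level A (ln 2)) \<and>
         hausdorff_dim (lyapunov_level A (ln 2)) < hausdorff_dim (Theta_zero A) \<and>
         hausdorff_dim (Theta_zero A) = 1"
proof -
  interpret luroth A by (rule luroth.intro) (rule assms(1))
  define S where "S = {u + q | u q. feasible u q}"
  define D where "D = Inf S"
  obtain u0 q0 where uq0: "feasible u0 q0" "u0 + q0 < 1" using exists_feasible_less_1[OF assms(2)] by blast
  have S0: "u0 + q0 \<in> S" using uq0 by (auto simp: S_def)
  have Spos: "x \<ge> 0" if "x \<in> S" for x using that by (auto simp: S_def feasible_def)
  then have bdd: "bdd_below S" by (rule bdd_belowI)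
  have DS: "D \<le> u + q" if "feasible u q" for u q
    unfolding D_def using that bdd by (intro cInf_lower) (auto simp: S_def)
  have D0: "D \<ge> 0" unfolding D_def using S0 Spos by (intro cInf_greatest) auto
  have D1: "D < 1" using DS[OF uq0(1)] uq0(2) by simp
  \<comment> \<open>Positivity on the intersection passes to both \<open>Theta_sim A\<close> and the
    level set, so one Moran set serves two lower bounds.\<close>
  have low: "hausdorff_measure s (Theta_infinity A) \<noteq> 0" "hausdorff_measure s (Theta_sim A) \<noteq> 0"
    "hausdorff_measure s (lyapunov_level A (ln 2)) \<noteq> 0" if "0 < s" "s < D" for s
    using hausdorff_measure_lower[OF assms(2) that(1) _ DS that(2)] that D1
      hausdorff_measure_mono_zero[of s "Theta_sim A" "Theta_sim A \<inter> lyapunov_level A (ln 2)"]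
      hausdorff_measure_mono_zero[of s "lyapunov_level A (ln 2)" "Theta_sim A \<inter> lyapunov_level A (ln 2)"]
    by auto
  have near: "\<exists>u q. feasible u q \<and> u + q < D + e" if "e > 0" for e
  proof -
    have "\<exists>x\<in>S. x < D + e" unfolding D_def using S0 bdd that by (subst cInf_less_iff[symmetric]) auto
    then show ?thesis by (auto simp: S_def)
  qed
  have up: "hausdorff_dim E \<le> ennreal D" if E: "E \<subseteq> {0..1} - Theta_zero A" for E
  proof (rule ennreal_le_epsilon)
    fix e :: real assume e: "e > 0"
    obtain u q where uq: "feasible u q" "u + q < D + e" using near[OF e] by blast
    have "hausdorff_dim E \<le> ennreal (u + q)"
      by (rule hausdorff_dim_le) (use uq(1) hausdorff_measure_mono_zero[OF hausdorff_measure_non_Theta_zero E]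
        in \<open>auto simp: feasible_def\<close>)
    also have "\<dots> \<le> ennreal (D + e)" using uq(2) by (intro ennreal_leI) auto
    also have "\<dots> = ennreal D + ennreal e" using D0 e by (intro ennreal_plus) auto
    finally show "hausdorff_dim E \<le> ennreal D + ennreal e" .
  qed
  \<comment> \<open>\<open>up\<close> concerns subsets of the complement of
    \<open>Theta_zero A\<close>; the level set has its own cover, with \<open>\<eta>\<close> using
    up the slack between \<open>u + q\<close> and \<open>D + e\<close>.\<close>
  have upL: "hausdorff_dim (lyapunov_level A (ln 2)) \<le> ennreal D"
  proof (rule ennreal_le_epsilon)
    fix e :: real assume e: "e > 0"
    obtain u q where uq: "feasible u q" "u + q < D + e" using near[OF e] by blast
    define \<eta> where "\<eta> = D + e - (u + q)"
    have "hausdorff_measure (u + (q + \<eta>)) (lyapunov_level A (ln 2)) = 0"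
      by (rule hausdorff_measure_lyapunov_level[OF uq(1)]) (use uq in \<open>simp add: \<eta>_def\<close>)
    then have "hausdorff_dim (lyapunov_level A (ln 2)) \<le> ennreal (D + e)"
      using D0 e by (intro hausdorff_dim_le) (auto simp: \<eta>_def)
    also have "\<dots> = ennreal D + ennreal e" using D0 e by (intro ennreal_plus) auto
    finally show "hausdorff_dim (lyapunov_level A (ln 2)) \<le> ennreal D + ennreal e" .
  qed
  have eq1: "hausdorff_dim (Theta_infinity A) = ennreal D"
    by (intro antisym up Theta_infinity_disjoint hausdorff_dim_ge low(1))
  have eq2: "hausdorff_dim (Theta_sim A) = ennreal D"
    by (intro antisym up hausdorff_dim_ge low(2)) (auto simp: Theta_sim_def)
  have eq3: "hausdorff_dim (lyapunov_level A (ln 2)) = ennreal D"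
    by (intro antisym upL hausdorff_dim_ge low(3))
  have eq4: "hausdorff_dim (Theta_zero A) = 1"
  proof (rule antisym)
    show "hausdorff_dim (Theta_zero A) \<le> 1"
    proof (rule ennreal_le_epsilon)
      fix e :: real assume e: "e > 0"
      have "hausdorff_measure (1 + e) (Theta_zero A) = 0"
        by (rule hausdorff_measure_mono_zero[OF hausdorff_measure_unit_interval])
           (use e in \<open>auto simp: Theta_zero_def\<close>)
      then have "hausdorff_dim (Theta_zero A) \<le> ennreal (1 + e)" using e by (intro hausdorff_dim_le) auto
      also have "\<dots> = 1 + ennreal e" using e by (subst ennreal_plus) auto
      finally show "hausdorff_dim (Theta_zero A) \<le> 1 + ennreal e" .
    qed
    \<comment> \<open>Both exponents involved are at most 1, so otherwise the unit interval would be
      a union of two Lebesgue null sets.\<close>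
    have "hausdorff_measure s (Theta_zero A) \<noteq> 0" if "0 < s" "s < 1" for s
    proof
      assume "hausdorff_measure s (Theta_zero A) = 0"
      then have "negligible (Theta_zero A)" using that by (intro hausdorff_measure_zero_negligible) auto
      moreover have "negligible ({0..1} - Theta_zero A)"
        using hausdorff_measure_non_Theta_zero[OF uq0(1)] uq0(2)
        by (intro hausdorff_measure_zero_negligible) auto
      ultimately have "negligible (Theta_zero A \<union> ({0..1} - Theta_zero A))" by (rule negligible_Un)
      then have "negligible {0..1::real}" by (rule negligible_subset) auto
      then show False using negligible_interval(1)[of 0 "1::real"] by (simp add: box_real)
    qed
    then have "ennreal 1 \<le> hausdorff_dim (Theta_zero A)" by (rule hausdorff_dim_ge)
    then show "1 \<le> hausdorff_dim (Theta_zero A)" by simp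
  qed
  have "ennreal D < 1" using D0 D1 ennreal_lessI[of 1 D] by simp
  then show ?thesis using eq1 eq2 eq3 eq4 by simp
qed

end
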